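(* Let $A=\lim_{n\to\infty}(A_n,\phi_n)$ be a unital $C^*$-algebra which is the inductive limit of a sequence of unital $C^*$-algebras $A_n$. Suppose that $r$ is such that $\mathrm{Dur}(A_n)\le r$ for all $n$. Then $\mathrm{Dur}(A)\le r$.
   Context: For a unital $C^*$-algebra $B$, $U_0(B)$ is the connected component of the identity in the unitary group $U(B)$ (norm topology), and $CU(B)$ is the norm closure of the commutator subgroup of $U_0(B)$. For integers $n\ge m\ge1$ let $i_B^{(m,n)}\colon U_0(M_m(B))/CU(M_m(B))\to U_0(M_n(B))/CU(M_n(B))$ be the homomorphism induced by $u\mapsto\mathrm{diag}(u,1_{n-m})$. The determinant rank of $B$ is $\mathrm{Dur}(B)=\min\{m\in\mathbb N : i_B^{(m,n)}\text{ is an isomorphism for all } n>m\}$ (with $m\ge1$), and $\mathrm{Dur}(B)=\infty$ if no such $m$ exists. *)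

theory Defs
  imports "HOL-Analysis.Analysis" "HOL-Algebra.Algebra" "HOL-Library.Extended_Nat"
begin

no_notation eq_closure_of ("closure'_of\<index>")

section \<open>Unital C*-algebras\<close>

text \<open>
  C*-algebras are records with an explicit carrier: the members of a sequence of different
  algebras can then share one element type, and so can the matrices of all sizes over
  a given algebra.
\<close>

definition complex_field :: "complex ring" where
  "complex_field = \<lparr>carrier = UNIV, mult = (*), one = 1, ring.zero = 0, ring.add = (+)\<rparr>"

record 'a cstar = "(complex, 'a) module" +
  star :: "'a \<Rightarrow> 'a"
  cnorm :: "'a \<Rightarrow> real"

text \<open>
  The value 0 outside the carrier is only there because the locale
  \<^locale>\<open>Metric_space\<close> wants distances to be nonnegative and symmetric on the whole type.
\<close>

definition cdist :: "('a, 'c) cstar_scheme \<Rightarrow> 'a \<Rightarrow> 'a \<Rightarrow> real" where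
  "cdist B x y = (if x \<in> carrier B \<and> y \<in> carrier B then cnorm B (x \<ominus>\<^bsub>B\<^esub> y) else 0)"

locale normed_star_algebra = module complex_field B + ring B
  for B :: "('a, 'c) cstar_scheme" (structure) +
  assumes smult_mult_left:
      "\<lbrakk>x \<in> carrier B; y \<in> carrier B\<rbrakk> \<Longrightarrow> (c \<odot> x) \<otimes> y = c \<odot> (x \<otimes> y)"
    and smult_mult_right:
      "\<lbrakk>x \<in> carrier B; y \<in> carrier B\<rbrakk> \<Longrightarrow> x \<otimes> (c \<odot> y) = c \<odot> (x \<otimes> y)"
    and star_closed: "x \<in> carrier B \<Longrightarrow> star B x \<in> carrier B"
    and star_star: "x \<in> carrier B \<Longrightarrow> star B (star B x) = x"
    and star_add:
      "\<lbrakk>x \<in> carrier B; y \<in> carrier B\<rbrakk> \<Longrightarrow> star B (x \<oplus> y) = star B x \<oplus> star B y"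
    and star_smult: "x \<in> carrier B \<Longrightarrow> star B (c \<odot> x) = cnj c \<odot> star B x"
    and star_mult:
      "\<lbrakk>x \<in> carrier B; y \<in> carrier B\<rbrakk> \<Longrightarrow> star B (x \<otimes> y) = star B y \<otimes> star B x"
    and cnorm_nonneg: "x \<in> carrier B \<Longrightarrow> 0 \<le> cnorm B x"
    and cnorm_eq_0_iff: "x \<in> carrier B \<Longrightarrow> cnorm B x = 0 \<longleftrightarrow> x = \<zero>"
    and cnorm_triangle:
      "\<lbrakk>x \<in> carrier B; y \<in> carrier B\<rbrakk> \<Longrightarrow> cnorm B (x \<oplus> y) \<le> cnorm B x + cnorm B y"
    and cnorm_smult: "x \<in> carrier B \<Longrightarrow> cnorm B (c \<odot> x) = cmod c * cnorm B x"
    and cnorm_mult: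
      "\<lbrakk>x \<in> carrier B; y \<in> carrier B\<rbrakk> \<Longrightarrow> cnorm B (x \<otimes> y) \<le> cnorm B x * cnorm B y"
begin

lemma cnorm_minus_commute:
  assumes "x \<in> carrier B" "y \<in> carrier B"
  shows "cnorm B (x \<ominus> y) = cnorm B (y \<ominus> x)"
proof -
  have c: "x \<ominus> y \<in> carrier B" using assms by simp
  have "(- 1) \<odot> (x \<ominus> y) \<oplus> (x \<ominus> y) = (- 1) \<odot> (x \<ominus> y) \<oplus> 1 \<odot> (x \<ominus> y)"
    using c smult_one[OF c] by (simp add: complex_field_def)
  also have "\<dots> = (- 1 + 1) \<odot> (x \<ominus> y)"
    using smult_l_distr[of "-1" 1, OF _ _ c] by (simp add: complex_field_def)
  also have "\<dots> = \<zero>"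
    using smult_l_null[OF c] by (simp add: complex_field_def)
  finally have "(- 1) \<odot> (x \<ominus> y) = \<ominus> (x \<ominus> y)"
    using c by (intro minus_equality[symmetric])
      (auto simp: complex_field_def intro!: smult_closed)
  also have "\<dots> = y \<ominus> x"
    using assms by (simp add: a_minus_def minus_add a_comm)
  finally show ?thesis
    using cnorm_smult[OF c, of "-1"] by simp
qed

sublocale metric: Metric_space "carrier B" "cdist B"
proof
  fix x y show "0 \<le> cdist B x y"
    by (simp add: cdist_def cnorm_nonneg)
next
  fix x y show "cdist B x y = cdist B y x"
    by (auto simp: cdist_def cnorm_minus_commute)
next
  fix x y assume xy: "x \<in> carrier B" "y \<in> carrier B"
  then show "cdist B x y = 0 \<longleftrightarrow> x = y"
    by (simp add: cdist_def cnorm_eq_0_iff)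
next
  fix x y z assume xyz: "x \<in> carrier B" "y \<in> carrier B" "z \<in> carrier B"
  have "x \<ominus> z = (x \<ominus> y) \<oplus> (y \<ominus> z)"
    using xyz by (simp add: a_minus_def a_assoc r_neg1)
  then show "cdist B x z \<le> cdist B x y + cdist B y z"
    using xyz cnorm_triangle[of "x \<ominus> y" "y \<ominus> z"] by (simp add: cdist_def)
qed

end

locale unital_cstar_algebra = normed_star_algebra +
  assumes complete: "metric.mcomplete"
    and cstar_identity: "x \<in> carrier B \<Longrightarrow> cnorm B (star B x \<otimes> x) = (cnorm B x)\<^sup>2"

definition norm_topology :: "('a, 'c) cstar_scheme \<Rightarrow> 'a topology" where
  "norm_topology B = Metric_space.mtopology (carrier B) (cdist B)"


section \<open>Matrix algebras\<close>

text \<open>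
  An \<open>n\<close> by \<open>n\<close> matrix over \<open>B\<close> is an extensional function on pairs of indices below \<open>n\<close>.
  Its C*-norm is the operator norm for the action by left multiplication on
  the Hilbert \<open>B\<close>-module of columns of length \<open>n\<close>, where the column \<open>x\<close> has norm
  \<open>\<parallel>\<Sum>i. x\<^sub>i* x\<^sub>i\<parallel>\<^sup>1\<^sup>/\<^sup>2\<close>.
\<close>

definition column_norm :: "nat \<Rightarrow> ('a, 'c) cstar_scheme \<Rightarrow> (nat \<Rightarrow> 'a) \<Rightarrow> real" where
  "column_norm n B x = sqrt (cnorm B (\<Oplus>\<^bsub>B\<^esub>i\<in>{..<n}. star B (x i) \<otimes>\<^bsub>B\<^esub> x i))"

definition matrix_norm :: "nat \<Rightarrow> ('a, 'c) cstar_scheme \<Rightarrow> (nat \<times> nat \<Rightarrow> 'a) \<Rightarrow> real" where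
  "matrix_norm n B T =
     Sup {column_norm n B (\<lambda>i. \<Oplus>\<^bsub>B\<^esub>j\<in>{..<n}. T (i, j) \<otimes>\<^bsub>B\<^esub> x j) |x.
            x \<in> {..<n} \<rightarrow>\<^sub>E carrier B \<and> column_norm n B x \<le> 1}"

definition matrix_algebra :: "nat \<Rightarrow> ('a, 'c) cstar_scheme \<Rightarrow> (nat \<times> nat \<Rightarrow> 'a) cstar" where
  "matrix_algebra n B =
     \<lparr>carrier = {..<n} \<times> {..<n} \<rightarrow>\<^sub>E carrier B,
      mult = (\<lambda>S T. \<lambda>(i, j)\<in>{..<n} \<times> {..<n}. \<Oplus>\<^bsub>B\<^esub>k\<in>{..<n}. S (i, k) \<otimes>\<^bsub>B\<^esub> T (k, j)),
      one = (\<lambda>(i, j)\<in>{..<n} \<times> {..<n}. if i = j then \<one>\<^bsub>B\<^esub> else \<zero>\<^bsub>B\<^esub>),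
      ring.zero = (\<lambda>(i, j)\<in>{..<n} \<times> {..<n}. \<zero>\<^bsub>B\<^esub>),
      ring.add = (\<lambda>S T. \<lambda>(i, j)\<in>{..<n} \<times> {..<n}. S (i, j) \<oplus>\<^bsub>B\<^esub> T (i, j)),
      smult = (\<lambda>c T. \<lambda>(i, j)\<in>{..<n} \<times> {..<n}. c \<odot>\<^bsub>B\<^esub> T (i, j)),
      star = (\<lambda>T. \<lambda>(i, j)\<in>{..<n} \<times> {..<n}. star B (T (j, i))),
      cnorm = matrix_norm n B\<rparr>"

definition diag_one ::
    "nat \<Rightarrow> nat \<Rightarrow> ('a, 'c) cstar_scheme \<Rightarrow> (nat \<times> nat \<Rightarrow> 'a) \<Rightarrow> (nat \<times> nat \<Rightarrow> 'a)" where
  "diag_one m n B u =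
     (\<lambda>(i, j)\<in>{..<n} \<times> {..<n}.
        if i < m \<and> j < m then u (i, j) else if i = j then \<one>\<^bsub>B\<^esub> else \<zero>\<^bsub>B\<^esub>)"


section \<open>Unitary groups and the determinant rank\<close>

definition unitary_group :: "('a, 'c) cstar_scheme \<Rightarrow> 'a monoid" where
  "unitary_group B =
     \<lparr>carrier = {u \<in> carrier B. star B u \<otimes>\<^bsub>B\<^esub> u = \<one>\<^bsub>B\<^esub> \<and> u \<otimes>\<^bsub>B\<^esub> star B u = \<one>\<^bsub>B\<^esub>},
      mult = mult B, one = \<one>\<^bsub>B\<^esub>\<rparr>"

definition U0 :: "('a, 'c) cstar_scheme \<Rightarrow> 'a monoid" where
  "U0 B = (unitary_group B)
     \<lparr>carrier := connected_component_of_set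
        (subtopology (norm_topology B) (carrier (unitary_group B))) \<one>\<^bsub>B\<^esub>\<rparr>"

definition CU :: "('a, 'c) cstar_scheme \<Rightarrow> 'a set" where
  "CU B = norm_topology B closure_of (derived (U0 B) (carrier (U0 B)))"

definition U0_mod_CU :: "nat \<Rightarrow> ('a, 'c) cstar_scheme \<Rightarrow> (nat \<times> nat \<Rightarrow> 'a) set monoid" where
  "U0_mod_CU n B = U0 (matrix_algebra n B) Mod CU (matrix_algebra n B)"

text \<open>
  The coset of \<open>u\<close> goes to the coset of \<open>diag(u, 1)\<close>; the latter does not depend on
  the representative \<open>u\<close>, so the set below is a singleton.
\<close>

definition i_map ::
    "nat \<Rightarrow> nat \<Rightarrow> ('a, 'c) cstar_scheme \<Rightarrow> (nat \<times> nat \<Rightarrow> 'a) set \<Rightarrow> (nat \<times> nat \<Rightarrow> 'a) set" where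
  "i_map m n B K =
     the_elem ((\<lambda>u. CU (matrix_algebra n B) #>\<^bsub>U0 (matrix_algebra n B)\<^esub> diag_one m n B u) ` K)"

text \<open>The infimum of the empty set in \<^typ>\<open>enat\<close> is \<open>\<infinity>\<close>.\<close>

definition Dur :: "('a, 'c) cstar_scheme \<Rightarrow> enat" where
  "Dur B = Inf (enat ` {m. 1 \<le> m \<and>
     (\<forall>n>m. i_map m n B \<in> iso (U0_mod_CU m B) (U0_mod_CU n B))})"


section \<open>Inductive limits\<close>

text \<open>Homomorphisms are not required to preserve the unit.\<close>

definition star_hom :: "('a, 'c) cstar_scheme \<Rightarrow> ('b, 'd) cstar_scheme \<Rightarrow> ('a \<Rightarrow> 'b) set" where
  "star_hom A B = {f \<in> carrier A \<rightarrow> carrier B.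
     (\<forall>x\<in>carrier A. \<forall>y\<in>carrier A.
        f (x \<oplus>\<^bsub>A\<^esub> y) = f x \<oplus>\<^bsub>B\<^esub> f y \<and> f (x \<otimes>\<^bsub>A\<^esub> y) = f x \<otimes>\<^bsub>B\<^esub> f y) \<and>
     (\<forall>x\<in>carrier A. \<forall>c. f (c \<odot>\<^bsub>A\<^esub> x) = c \<odot>\<^bsub>B\<^esub> f x) \<and>
     (\<forall>x\<in>carrier A. f (star A x) = star B (f x))}"

text \<open>\<open>connecting \<phi> n k\<close> is the composite map from the \<open>n\<close>-th to the \<open>(n + k)\<close>-th algebra.\<close>

primrec connecting :: "(nat \<Rightarrow> 'a \<Rightarrow> 'a) \<Rightarrow> nat \<Rightarrow> nat \<Rightarrow> 'a \<Rightarrow> 'a" where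
  "connecting \<phi> n 0 = (\<lambda>x. x)"
| "connecting \<phi> n (Suc k) = (\<lambda>x. \<phi> (n + k) (connecting \<phi> n k x))"

text \<open>
  The C*-algebraic inductive limit is the Hausdorff completion of the algebraic direct limit
  with respect to the seminorm that sends the class of \<open>x\<close> in the \<open>n\<close>-th algebra to
  the limit of the norms of its images in the later algebras. Thus \<open>B\<close> is this
  limit, with canonical maps \<open>\<psi>\<close>, if these maps are compatible, recover the
  seminorm and have dense joint range in the (complete) algebra \<open>B\<close>.
\<close>

definition inductive_limit ::
    "(nat \<Rightarrow> ('a, 'c) cstar_scheme) \<Rightarrow> (nat \<Rightarrow> 'a \<Rightarrow> 'a) \<Rightarrow>
     ('b, 'd) cstar_scheme \<Rightarrow> (nat \<Rightarrow> 'a \<Rightarrow> 'b) \<Rightarrow> bool" where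
  "inductive_limit A \<phi> B \<psi> \<longleftrightarrow>
     (\<forall>n. \<phi> n \<in> star_hom (A n) (A (Suc n))) \<and>
     (\<forall>n. \<psi> n \<in> star_hom (A n) B) \<and>
     (\<forall>n. \<forall>x\<in>carrier (A n). \<psi> (Suc n) (\<phi> n x) = \<psi> n x) \<and>
     (\<forall>n. \<forall>x\<in>carrier (A n).
        (\<lambda>k. cnorm (A (n + k)) (connecting \<phi> n k x)) \<longlonglongrightarrow> cnorm B (\<psi> n x)) \<and>
     norm_topology B closure_of (\<Union>n. \<psi> n ` carrier (A n)) = carrier B"

end

(*
  The map from U_0(M_m)/CU(M_m) to U_0(M_n)/CU(M_n) is always surjective: to first order every
  skew matrix is the sum of a skew matrix in the corner M_m and of skew parts of commutators, and
  Newton iteration turns this into a factorization u = g d of unitaries near 1, with g in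
  U_0(M_m) and d in CU(M_n) and with control of g - 1. So only injectivity has to be carried over
  to the limit. If u in U_0(M_m(A)) lies in CU(M_n(A)), a lift of u to a late stage is close to a
  product of commutators over M_n, because norms in the limit are limits of norms. The factorization
  at that stage moves the lift into CU(M_n(A_l)) by a small change within U_0(M_m(A_l)),
  where injectivity applies, and u is a limit of the images of such elements.

  The analysis takes place in a type of infinite matrices over a type that contains all the
  C*-algebras on a given carrier type as corners. Unitaries of a corner with unit e are replaced by
  u - e + 1, which makes diag(u, 1) the same element as u and copes with maps that do not preserve
  units. Homomorphisms are lifted to matrices entrywise; the norm there is only equivalent to the
  C*-norm, but entrywise homomorphisms are contractive for it.
*)

theory Submission
  imports Defs
begin

text \<open>The C*-identity is never established for matrices. It is used for the base algebras
  only, where it makes star homomorphisms contractive and compares the operator norm on matrices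
  with the norms of the entries. Every argument about unitaries of matrices takes place in a
  complete normed star algebra, in which unitaries need not have norm 1. This excludes spectral
  theory and fixes the tools: near 1 a unitary is recovered from its skew part by
  \<open>chart\<close>, which needs nothing but a square root obtained by iteration. The obstacle in
  passing to the limit is that an approximation of a unitary is not unitary, and the relations that
  define unitaries need not hold at a finite stage. Skew elements form a real linear space, so they
  can be lifted first and mapped to unitaries by \<open>chart\<close> afterwards. The order of
  choices matters as well: the constants of the factorization depend on the matrix size alone, so
  one tolerance serves all stages, and the stage can be chosen after it.\<close>

section \<open>Star algebras as a type class\<close>

text \<open>Complex star algebras, seen as real normed algebras with multiplication by the imaginary
  unit, \<open>itimes\<close>. The adjoint is isometric, but the C*-identity is left out because the
  row-sum norm on matrices violates it in general.\<close>

class star_algebra_1 = real_normed_algebra_1 +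
  fixes adj :: "'a \<Rightarrow> 'a" and itimes :: "'a \<Rightarrow> 'a"
  assumes adj_add: "adj (x + y) = adj x + adj y"
    and adj_mult: "adj (x * y) = adj y * adj x"
    and adj_adj [simp]: "adj (adj x) = x"
    and adj_scaleR: "adj (r *\<^sub>R x) = r *\<^sub>R adj x"
    and norm_adj [simp]: "norm (adj x) = norm x"
    and itimes_add: "itimes (x + y) = itimes x + itimes y"
    and itimes_scaleR: "itimes (r *\<^sub>R x) = r *\<^sub>R itimes x"
    and itimes_mult_left: "itimes x * y = itimes (x * y)"
    and itimes_mult_right: "x * itimes y = itimes (x * y)"
    and itimes_itimes: "itimes (itimes x) = - x"
    and adj_itimes: "adj (itimes x) = - itimes (adj x)"
    and norm_itimes [simp]: "norm (itimes x) = norm x"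

lemma adj_zero [simp]: "adj (0::'a::star_algebra_1) = 0"
  using adj_scaleR[of 0 "0::'a"] by simp

lemma adj_minus: "adj (- x) = - adj (x::'a::star_algebra_1)"
  using adj_scaleR[of "-1" x] by simp

lemma adj_diff: "adj (x - y) = adj x - adj (y::'a::star_algebra_1)"
  using adj_add[of x "- y"] by (simp add: adj_minus)

lemma adj_one [simp]: "adj (1::'a::star_algebra_1) = 1"
  using adj_mult[of "adj (1::'a)" 1] by simp

lemma adj_sum: "adj (sum f A) = (\<Sum>i\<in>A. adj (f i :: 'a::star_algebra_1))"
  by (induction A rule: infinite_finite_induct) (simp_all add: adj_add)

lemma itimes_minus: "itimes (- x) = - itimes (x::'a::star_algebra_1)"
  using itimes_scaleR[of "-1" x] by simp

lemma itimes_diff: "itimes (x - y) = itimes x - itimes (y::'a::star_algebra_1)"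
  using itimes_add[of x "- y"] by (simp add: itimes_minus)

lemmas adj_simps = adj_add adj_mult adj_scaleR adj_minus adj_diff adj_itimes
lemmas itimes_simps = itimes_add itimes_scaleR itimes_minus itimes_diff itimes_mult_left
  itimes_mult_right itimes_itimes

lemma bounded_linear_adj: "bounded_linear (adj :: 'a::star_algebra_1 \<Rightarrow> 'a)"
  by (rule bounded_linear_intro[where K = 1]) (simp_all add: adj_simps)

lemmas tendsto_adj [tendsto_intros] = bounded_linear.tendsto[OF bounded_linear_adj]
lemmas continuous_on_adj [continuous_intros] = bounded_linear.continuous_on[OF bounded_linear_adj]

text \<open>Telescoping bounds \<open>norm (Y m - Y n)\<close> by \<open>h m - h n\<close> for
  \<open>n \<le> m\<close>. It serves the square-root iteration and the Newton iteration, both of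
  which come with an explicit scalar majorant.\<close>

lemma Cauchy_dominated:
  fixes Y :: "nat \<Rightarrow> 'a::real_normed_vector" and h :: "nat \<Rightarrow> real"
  assumes inc: "\<And>n. norm (Y (Suc n) - Y n) \<le> h (Suc n) - h n" and h: "Cauchy h"
  shows "Cauchy Y"
proof -
  have le: "norm (Y m - Y n) \<le> h m - h n" if "n \<le> m" for m n
    using that
  proof (induction m rule: dec_induct)
    case (step m)
    then show ?case
      using inc[of m] norm_triangle_ineq[of "Y (Suc m) - Y m" "Y m - Y n"] by simp
  qed simp
  show ?thesis
  proof (rule CauchyI')
    fix \<epsilon> :: real assume "\<epsilon> > 0"
    then obtain M where "\<And>m n. m \<ge> M \<Longrightarrow> n \<ge> M \<Longrightarrow> norm (h m - h n) < \<epsilon>"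
      using CauchyD[OF h] by blast
    moreover have "norm (Y m - Y n) \<le> norm (h m - h n)" if "m < n" for m n
      using le[of m n] that by (simp add: norm_minus_commute)
    ultimately show "\<exists>M. \<forall>m\<ge>M. \<forall>n>m. dist (Y m) (Y n) < \<epsilon>"
      unfolding dist_norm by (meson le_less_trans less_imp_le_nat order.trans)
  qed
qed

text \<open>The unit \<open>e\<close> of the subalgebra is in general not the unit of the type.\<close>

locale star_subalgebra =
  fixes C :: "'a::star_algebra_1 set" and e :: 'a
  assumes add_closed: "\<lbrakk>x \<in> C; y \<in> C\<rbrakk> \<Longrightarrow> x + y \<in> C"
    and scaleR_closed: "x \<in> C \<Longrightarrow> r *\<^sub>R x \<in> C"
    and mult_closed: "\<lbrakk>x \<in> C; y \<in> C\<rbrakk> \<Longrightarrow> x * y \<in> C"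
    and adj_closed: "x \<in> C \<Longrightarrow> adj x \<in> C"
    and itimes_closed: "x \<in> C \<Longrightarrow> itimes x \<in> C"
    and complete_C: "complete C"
    and unit_closed: "e \<in> C"
    and unit_left: "x \<in> C \<Longrightarrow> e * x = x"
    and unit_right: "x \<in> C \<Longrightarrow> x * e = x"
begin

lemma zero_closed: "0 \<in> C"
  using scaleR_closed[OF unit_closed, of 0] by simp

lemma minus_closed: "x \<in> C \<Longrightarrow> - x \<in> C"
  using scaleR_closed[of x "-1"] by simp

lemma diff_closed: "\<lbrakk>x \<in> C; y \<in> C\<rbrakk> \<Longrightarrow> x - y \<in> C"
  using add_closed[of x "- y"] minus_closed by simp

lemma sum_closed: "(\<And>i. i \<in> A \<Longrightarrow> f i \<in> C) \<Longrightarrow> sum f A \<in> C"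
  by (induction A rule: infinite_finite_induct) (auto simp: zero_closed add_closed)

lemmas closed_rules = add_closed scaleR_closed mult_closed adj_closed itimes_closed unit_closed
  zero_closed minus_closed diff_closed sum_closed

lemma closed_C: "closed C"
  by (simp add: complete_C complete_imp_closed)

lemma adj_unit [simp]: "adj e = e"
  by (metis adj_adj adj_closed adj_mult unit_closed unit_left unit_right)

lemma unit_unit [simp]: "e * e = e"
  by (simp add: unit_closed unit_left)

text \<open>
  The square root \<open>1 - y\<close> of \<open>1 - x\<close>, by the iteration \<open>y \<mapsto> (x + y\<^sup>2)/2\<close>. Its increments are
  dominated by those of the same iteration for the number \<open>1\<close>, which converges.
\<close>

lemma ex_root:
  assumes x: "x \<in> C" and nx: "norm x \<le> 1"
  obtains y where "y \<in> C" "y + y = x + y * y" "norm y \<le> norm x"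
    "adj x = x \<Longrightarrow> adj y = y" "\<And>z. z * x = x * z \<Longrightarrow> z * y = y * z"
proof -
  define Y where "Y n = rec_nat 0 (\<lambda>_ y. (1/2) *\<^sub>R (x + y * y)) n" for n :: nat
  define h where "h n = rec_nat (0::real) (\<lambda>_ t. (1/2) * (1 + t * t)) n" for n :: nat
  have Y0: "Y 0 = 0" and YS: "Y (Suc n) = (1/2) *\<^sub>R (x + Y n * Y n)" for n
    by (simp_all add: Y_def)
  have h0: "h 0 = (0::real)" and hS: "h (Suc n) = (1/2) * (1 + h n * h n)" for n
    by (simp_all add: h_def)
  have h_nonneg: "0 \<le> h n" for n
    by (induction n) (simp_all add: h0 hS)
  have h_le: "h n \<le> 1" for n
  proof (induction n)
    case (Suc n)
    then show ?case using h_nonneg[of n] mult_le_one[of "h n" "h n"] by (simp add: hS)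
  qed (simp add: h0)
  \<comment> \<open>The increment of \<open>h\<close> at \<open>n\<close> is
    \<open>(h n - 1)\<^sup>2 / 2\<close>.\<close>
  have h_mono: "h n \<le> h (Suc n)" for n
    using zero_le_square[of "h n - 1"] by (simp add: hS algebra_simps)
  then have "incseq h" by (rule incseq_SucI)
  then have "Cauchy h"
    using h_le incseq_convergent[of h 1] by (metis LIMSEQ_imp_Cauchy)
  have YC: "Y n \<in> C" for n
    by (induction n) (auto simp: Y0 YS intro!: closed_rules x)
  have Yh: "norm (Y n) \<le> h n \<and> norm (Y (Suc n) - Y n) \<le> h (Suc n) - h n" for n
  proof (induction n)
    case 0
    show ?case using nx by (simp add: Y0 YS h0 hS)
  next
    case (Suc n)
    have 1: "norm (Y (Suc n)) \<le> h (Suc n)"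
      using norm_triangle_ineq[of "Y n" "Y (Suc n) - Y n"] Suc by simp
    \<comment> \<open>A difference of squares without commutativity; the same formula for
      \<open>h\<close> gives exactly the increments of \<open>h\<close>, so the bounds match term by
      term.\<close>
    have dd: "(1/2) *\<^sub>R (x + a * a) - (1/2) *\<^sub>R (x + b * b)
        = (1/2) *\<^sub>R (a * (a - b) + (a - b) * b)" for a b
      by (simp add: algebra_simps)
    have "Y (Suc (Suc n)) - Y (Suc n)
        = (1/2) *\<^sub>R (Y (Suc n) * (Y (Suc n) - Y n) + (Y (Suc n) - Y n) * Y n)"
      using dd[of "Y (Suc n)" "Y n"] by (simp only: YS[symmetric])
    also have "norm \<dots> \<le> (1/2) * (norm (Y (Suc n)) * norm (Y (Suc n) - Y n)
        + norm (Y (Suc n) - Y n) * norm (Y n))"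
      by (simp add: order.trans[OF norm_triangle_ineq add_mono[OF norm_mult_ineq norm_mult_ineq]])
    also have "\<dots> \<le> (1/2) * (h (Suc n) * (h (Suc n) - h n) + (h (Suc n) - h n) * h n)"
      using 1 Suc h_nonneg h_mono by (intro mult_left_mono add_mono mult_mono) auto
    also have "\<dots> = h (Suc (Suc n)) - h (Suc n)"
      by (simp add: hS[of "Suc n"] hS[of n] algebra_simps)
    finally show ?case using 1 by simp
  qed
  have "Cauchy Y" by (rule Cauchy_dominated[OF _ \<open>Cauchy h\<close>]) (use Yh in blast)
  then obtain y where y: "y \<in> C" "Y \<longlonglongrightarrow> y"
    using complete_C YC unfolding complete_def by blast
  have YS_lim: "(\<lambda>n. (1/2) *\<^sub>R (x + Y n * Y n)) \<longlonglongrightarrow> (1/2) *\<^sub>R (x + y * y)"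
    by (intro tendsto_intros y)
  moreover have "(\<lambda>n. (1/2) *\<^sub>R (x + Y n * Y n)) \<longlonglongrightarrow> y"
    using LIMSEQ_Suc[OF y(2)] by (simp add: YS)
  ultimately have eq: "y = (1/2) *\<^sub>R (x + y * y)"
    by (blast intro: LIMSEQ_unique)
  show ?thesis
  proof
    show "y \<in> C" by fact
    have "y + y = 2 *\<^sub>R y" by (simp add: scaleR_2)
    also have "\<dots> = 2 *\<^sub>R ((1/2) *\<^sub>R (x + y * y))" using eq by simp
    finally show "y + y = x + y * y" by simp
    have "norm (Y n) \<le> norm x" for n
    proof (induction n)
      case (Suc n)
      have "norm (Y n * Y n) \<le> norm (Y n) * norm (Y n)" by (rule norm_mult_ineq)
      also have "\<dots> \<le> norm x * 1"
        using Suc nx by (intro mult_mono) auto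
      finally show ?case
        using norm_triangle_ineq[of x "Y n * Y n"] by (simp add: YS)
    qed (simp add: Y0)
    then show "norm y \<le> norm x"
      using y(2) tendsto_norm Lim_bounded by blast
  next
    assume "adj x = x"
    then have "adj (Y n) = Y n" for n
      by (induction n) (simp_all add: Y0 YS adj_simps)
    then show "adj y = y"
      using tendsto_adj[OF y(2)] y(2) LIMSEQ_unique by auto
  next
    fix z assume z: "z * x = x * z"
    have "z * Y n = Y n * z" for n
    proof (induction n)
      case (Suc n)
      then have "z * (Y n * Y n) = Y n * Y n * z" by (metis mult.assoc)
      then show ?case using z by (simp add: YS distrib_left distrib_right)
    qed (simp add: Y0)
    moreover have "(\<lambda>n. z * Y n) \<longlonglongrightarrow> z * y" "(\<lambda>n. Y n * z) \<longlonglongrightarrow> y * z"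
      by (intro tendsto_intros y)+
    ultimately show "z * y = y * z"
      using LIMSEQ_unique by auto
  qed
qed

end

section \<open>Order in a C*-algebra\<close>

locale cstar_subalgebra = star_subalgebra +
  assumes cstar_id: "x \<in> C \<Longrightarrow> norm (adj x * x) = (norm x)\<^sup>2"
begin

lemma norm_unit_cases: "e = 0 \<or> norm e = 1"
  using cstar_id[OF unit_closed] by (auto simp: power2_eq_square)

lemma norm_unit_le: "norm e \<le> 1"
  using norm_unit_cases by auto

text \<open>
  Positivity is expressed without spectra; for selfadjoint \<open>h\<close> the existence of such a \<open>t\<close>
  says that the spectrum of \<open>h\<close> is contained in \<open>[0, 2t]\<close>.
\<close>

definition pos :: "'a \<Rightarrow> bool" where
  "pos h \<longleftrightarrow> h \<in> C \<and> adj h = h \<and> (\<exists>t\<ge>0. norm (t *\<^sub>R e - h) \<le> t)"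

lemma pos_closed: "pos h \<Longrightarrow> h \<in> C"
  and pos_adj: "pos h \<Longrightarrow> adj h = h"
  by (simp_all add: pos_def)

lemma posI: "\<lbrakk>h \<in> C; adj h = h; norm (t *\<^sub>R e - h) \<le> t\<rbrakk> \<Longrightarrow> pos h"
  unfolding pos_def using norm_ge_zero[of "t *\<^sub>R e - h"] by (metis order.trans)

lemma pos_zero: "pos 0"
  by (rule posI[where t = 0]) (simp_all add: closed_rules)

lemma pos_add:
  assumes "pos h" "pos k"
  shows "pos (h + k)"
proof -
  obtain t s where "norm (t *\<^sub>R e - h) \<le> t" "norm (s *\<^sub>R e - k) \<le> s"
    using assms unfolding pos_def by blast
  then have "norm ((t + s) *\<^sub>R e - (h + k)) \<le> t + s"
    using norm_triangle_ineq[of "t *\<^sub>R e - h" "s *\<^sub>R e - k"] by (simp add: algebra_simps)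
  then show ?thesis
    using assms by (intro posI) (auto simp: pos_def adj_simps closed_rules)
qed

lemma pos_scaleR:
  assumes "pos h" "0 \<le> r"
  shows "pos (r *\<^sub>R h)"
proof -
  obtain t where "norm (t *\<^sub>R e - h) \<le> t"
    using assms unfolding pos_def by blast
  then have "norm (r *\<^sub>R (t *\<^sub>R e - h)) \<le> r * t"
    using assms by (simp add: mult_left_mono)
  then have "norm ((r * t) *\<^sub>R e - r *\<^sub>R h) \<le> r * t"
    by (simp add: algebra_simps)
  then show ?thesis
    using assms by (intro posI) (auto simp: pos_def adj_simps closed_rules)
qed

lemma pos_sum: "(\<And>i. i \<in> I \<Longrightarrow> pos (f i)) \<Longrightarrow> pos (sum f I)"
  by (induction I rule: infinite_finite_induct) (auto simp: pos_zero pos_add)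

text \<open>The bound \<open>norm (t *\<^sub>R e - h) \<le> t\<close> puts
  \<open>x = e - (1/t) *\<^sub>R h\<close> into the unit ball, so \<open>ex_root\<close> yields a
  square root of \<open>e - x\<close>, which is then rescaled by \<open>sqrt t\<close>. The last
  clause stands in for the fact that \<open>s\<close> is a limit of polynomials in
  \<open>h\<close>.\<close>

lemma pos_sqrt:
  assumes "pos h"
  obtains s where "pos s" "s * s = h" "\<And>z. \<lbrakk>z \<in> C; z * h = h * z\<rbrakk> \<Longrightarrow> z * s = s * z"
proof -
  obtain t where t: "0 \<le> t" "norm (t *\<^sub>R e - h) \<le> t" and h: "h \<in> C" "adj h = h"
    using assms unfolding pos_def by blast
  show ?thesis
  proof (cases "t = 0")
    case True
    then show ?thesis using t that[of 0] pos_zero by simp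
  next
    case False
    define x where "x = e - (1/t) *\<^sub>R h"
    have x: "x \<in> C" "adj x = x" using h by (auto simp: x_def adj_simps closed_rules)
    have "x = (1/t) *\<^sub>R (t *\<^sub>R e - h)" using False by (simp add: x_def algebra_simps)
    then have nx: "norm x \<le> 1" using t False by (simp add: divide_simps)
    obtain y where y: "y \<in> C" "y + y = x + y * y" "norm y \<le> norm x"
      "adj x = x \<Longrightarrow> adj y = y" "\<And>z. z * x = x * z \<Longrightarrow> z * y = y * z"
      using ex_root[OF x(1) nx] by blast
    have y2: "y * y = y + y - x" using y(2) by simp
    define s where "s = sqrt t *\<^sub>R (e - y)"
    show ?thesis
    proof
      show "pos s"
      proof (rule posI)
        show "s \<in> C" "adj s = s"
          using x y(1,4) by (auto simp: s_def adj_simps closed_rules)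
        have "sqrt t *\<^sub>R e - s = sqrt t *\<^sub>R y" by (simp add: s_def algebra_simps)
        then show "norm (sqrt t *\<^sub>R e - s) \<le> sqrt t"
          using t y(3) nx by (simp add: mult_left_le)
      qed
      have "s * s = t *\<^sub>R ((e - y) * (e - y))"
        using t by (simp add: s_def)
      also have "(e - y) * (e - y) = e - x"
        using y(1) y2 by (simp add: algebra_simps unit_left unit_right)
      also have "t *\<^sub>R \<dots> = h" using False by (simp add: x_def)
      finally show "s * s = h" .
    next
      fix z assume z: "z \<in> C" "z * h = h * z"
      then have "z * x = x * z"
        by (simp add: x_def algebra_simps unit_left unit_right)
      then show "z * s = s * z"
        using y(5) z(1) by (simp add: s_def algebra_simps unit_left unit_right)
    qed
  qed
qed

text \<open>\<open>u = d + itimes g\<close> is normal with real part \<open>d\<close>, and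
  \<open>adj u * u\<close> is the multiple \<open>t * t\<close> of the unit, so the C*-identity
  bounds \<open>norm u\<close> by \<open>t\<close>.\<close>

lemma norm_le_of_sum_of_squares:
  assumes "d \<in> C" "g \<in> C" "adj d = d" "adj g = g" and comm: "d * g = g * d"
    and sq: "d * d + g * g = (t * t) *\<^sub>R e" and t: "0 \<le> t"
  shows "norm d \<le> t"
proof -
  define u where "u = d + itimes g"
  have u: "u \<in> C" using assms by (simp add: u_def closed_rules)
  have adju: "adj u = d - itimes g" using assms by (simp add: u_def adj_simps itimes_simps)
  have "adj u * u = d * d + g * g"
    using comm by (simp add: adju) (simp add: u_def algebra_simps itimes_simps)
  then have "(norm u)\<^sup>2 \<le> t\<^sup>2"
    using cstar_id[OF u] mult_left_mono[OF norm_unit_le, of "t * t"] sq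
    by (simp add: power2_eq_square)
  then have nu: "norm u \<le> t" using t by (rule power2_le_imp_le)
  have "u + adj u = 2 *\<^sub>R d" unfolding adju by (simp add: u_def scaleR_2)
  then have "2 * norm d = norm (u + adj u)" by simp
  also have "\<dots> \<le> norm u + norm u" using norm_triangle_ineq[of u "adj u"] by simp
  finally have "norm d \<le> norm u" by simp
  then show ?thesis using nu by simp
qed

text \<open>The square root \<open>s\<close> of \<open>(t * t) *\<^sub>R e - k * k\<close> commutes
  with \<open>k\<close>, and the two squares add up to \<open>(t * t) *\<^sub>R e\<close>. The
  preceding lemma gives \<open>norm s \<le> t\<close>, and the element to be estimated is
  \<open>s * s\<close>. This makes squares of selfadjoint elements positive.\<close>

lemma norm_unit_diff_square:
  assumes k: "k \<in> C" "adj k = k" and nk: "norm k \<le> t"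
  shows "norm ((t * t) *\<^sub>R e - k * k) \<le> t * t"
proof (cases "t = 0")
  case True
  then show ?thesis using nk by simp
next
  case False
  then have t: "t > 0" using nk norm_ge_zero[of k] by linarith
  define x where "x = (1 / (t * t)) *\<^sub>R (k * k)"
  have x: "x \<in> C" "adj x = x" using k by (auto simp: x_def adj_simps closed_rules)
  have "norm (k * k) \<le> t * t"
    using norm_mult_ineq[of k k] mult_mono[OF nk nk] t by simp
  then have nx: "norm x \<le> 1" using t by (simp add: x_def divide_simps)
  obtain y where y: "y \<in> C" "y + y = x + y * y" "adj x = x \<Longrightarrow> adj y = y"
    "\<And>z. z * x = x * z \<Longrightarrow> z * y = y * z"
    using ex_root[OF x(1) nx] by blast
  have y2: "y * y = y + y - x" using y(2) by simp
  have "k * x = x * k" by (simp add: x_def mult.assoc)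
  then have ky: "k * y = y * k" by (rule y(4))
  define s where "s = t *\<^sub>R (e - y)"
  have s: "s \<in> C" "adj s = s" using x y(1,3) by (auto simp: s_def adj_simps closed_rules)
  have "s * s = (t * t) *\<^sub>R ((e - y) * (e - y))" by (simp add: s_def)
  also have "(e - y) * (e - y) = e - x"
    using y(1) y2 by (simp add: algebra_simps unit_left unit_right)
  finally have ss: "s * s = (t * t) *\<^sub>R e - k * k"
    using t by (simp add: x_def scaleR_diff_right)
  have "norm s \<le> t"
  proof (rule norm_le_of_sum_of_squares[OF s(1) k(1) s(2) k(2)])
    show "s * k = k * s"
      using ky k(1) by (simp add: s_def algebra_simps unit_left unit_right)
  qed (use ss t in auto)
  then have "norm (s * s) \<le> t * t"
    using norm_mult_ineq[of s s] mult_mono[of "norm s" t "norm s" t] t by simp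
  then show ?thesis using ss by simp
qed

lemma pos_square:
  assumes "k \<in> C" "adj k = k"
  shows "pos (k * k)"
  using norm_unit_diff_square[OF assms order_refl] assms
  by (intro posI) (auto simp: adj_simps closed_rules)

text \<open>The definition of \<open>pos\<close> provides some \<open>t\<close> only; writing
  \<open>h = s * s\<close> shows that every \<open>t\<close> above the norm of \<open>h\<close>
  serves.\<close>

lemma norm_unit_diff_pos:
  assumes "pos h" "norm h \<le> t"
  shows "norm (t *\<^sub>R e - h) \<le> t"
proof -
  obtain s where s: "pos s" "s * s = h" using pos_sqrt[OF assms(1)] by metis
  have t: "0 \<le> t" using assms(2) norm_ge_zero order.trans by blast
  have "(norm s)\<^sup>2 \<le> t"
    using cstar_id[of s] s assms(2) by (simp add: pos_closed pos_adj)
  then have "norm s \<le> sqrt t" using real_le_rsqrt by blast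
  then show ?thesis
    using norm_unit_diff_square[of s "sqrt t"] s t by (simp add: pos_closed pos_adj)
qed

lemma pos_unit_diff:
  assumes "h \<in> C" "adj h = h" "norm h \<le> t"
  shows "pos (t *\<^sub>R e - h)"
  using assms by (intro posI[where t = t]) (auto simp: adj_simps closed_rules)

text \<open>With commuting roots \<open>s\<close> of \<open>h\<close> and \<open>q\<close> of
  \<open>t *\<^sub>R e - h\<close>, the squares of \<open>(t/2) *\<^sub>R e - h\<close> and of
  \<open>s * q\<close> add up to \<open>(t/2)\<^sup>2\<close> times the unit. So \<open>h\<close>
  lies within \<open>t/2\<close> of \<open>(t/2) *\<^sub>R e\<close>.\<close>

lemma norm_le_of_pos:
  assumes h: "pos h" and k: "pos (t *\<^sub>R e - h)" and t: "0 \<le> t"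
  shows "norm h \<le> t"
proof -
  obtain s where s: "pos s" "s * s = h" "\<And>z. \<lbrakk>z \<in> C; z * h = h * z\<rbrakk> \<Longrightarrow> z * s = s * z"
    using pos_sqrt[OF h] by metis
  obtain q where q: "pos q" "q * q = t *\<^sub>R e - h"
    "\<And>z. \<lbrakk>z \<in> C; z * (t *\<^sub>R e - h) = (t *\<^sub>R e - h) * z\<rbrakk> \<Longrightarrow> z * q = q * z"
    using pos_sqrt[OF k] by metis
  note sq = s(1)[THEN pos_closed] q(1)[THEN pos_closed] s(1)[THEN pos_adj] q(1)[THEN pos_adj]
    h[THEN pos_closed] h[THEN pos_adj]
  have "s * h = h * s" by (simp add: mult.assoc flip: s(2))
  then have com: "s * q = q * s" "h * q = q * h"
    using q(3)[of s] q(3)[of h] sq by (auto simp: algebra_simps unit_left unit_right)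
  then have hs: "h * (s * q) = (s * q) * h" using \<open>s * h = h * s\<close> by (metis mult.assoc)
  define d where "d = (t/2) *\<^sub>R e - h"
  have "norm d \<le> t / 2"
  proof (rule norm_le_of_sum_of_squares[where g = "s * q"])
    show "d * (s * q) = s * q * d"
      using hs sq by (simp add: d_def algebra_simps unit_left unit_right closed_rules)
    have "(s * q) * (s * q) = (s * s) * (q * q)" using com by (metis mult.assoc)
    also have "\<dots> = t *\<^sub>R h - h * h"
      unfolding s(2) q(2) using sq by (simp add: algebra_simps unit_right)
    finally show "d * d + (s * q) * (s * q) = (t / 2 * (t / 2)) *\<^sub>R e"
      using sq by (simp add: d_def algebra_simps unit_left unit_right flip: scaleR_add_left)
  qed (use sq com t in \<open>auto simp: d_def adj_simps closed_rules\<close>)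
  moreover have "norm h \<le> norm ((t/2) *\<^sub>R e) + norm d"
    using norm_triangle_ineq4[of "(t/2) *\<^sub>R e" d] by (simp add: d_def)
  moreover have "norm ((t/2) *\<^sub>R e) \<le> t / 2"
    using norm_unit_le t by (simp add: mult_left_le)
  ultimately show ?thesis by linarith
qed

text \<open>In the order of the algebra, \<open>h\<close> is below \<open>h + k\<close>, which is
  below its norm times the unit.\<close>

lemma norm_pos_mono:
  assumes "pos h" "pos k"
  shows "norm h \<le> norm (h + k)"
proof (rule norm_le_of_pos[OF assms(1)])
  have "pos (norm (h + k) *\<^sub>R e - (h + k))"
    using assms by (intro pos_unit_diff) (auto simp: pos_def adj_simps closed_rules)
  from pos_add[OF this assms(2)] show "pos (norm (h + k) *\<^sub>R e - h)"
    by (simp add: algebra_simps)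
qed simp

text \<open>
  If \<open>b*b = -k\<close> with \<open>k\<close> positive, then \<open>q = bb*\<close> is positive because \<open>b*b + bb*\<close> is. Now
  \<open>(N + q)\<^sup>2 - N\<^sup>2 = b(2N - k)b*\<close> where \<open>N = \<parallel>b\<parallel>\<^sup>2\<close>: the left hand side has norm at least \<open>3N\<^sup>2\<close>,
  the right hand side at most \<open>2N\<^sup>2\<close>.
\<close>

lemma neg_adj_mult_pos_imp_zero:
  assumes b: "b \<in> C" and neg: "pos (- (adj b * b))"
  shows "b = 0"
proof (rule ccontr)
  assume "b \<noteq> 0"
  define N where "N = (norm b)\<^sup>2"
  define q where "q = b * adj b"
  have N: "N > 0" using \<open>b \<noteq> 0\<close> by (simp add: N_def)
  have "e \<noteq> 0" using unit_left[OF b] \<open>b \<noteq> 0\<close> by auto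
  then have ne: "norm e = 1" using norm_unit_cases by blast
  have q: "q \<in> C" "adj q = q" using b by (auto simp: q_def adj_simps closed_rules)
  \<comment> \<open>Twice the real part of \<open>b\<close> and, up to sign, twice its imaginary
    part: half the sum of their squares is \<open>adj b * b + b * adj b\<close>.\<close>
  define c where "c = b + adj b"
  define d where "d = itimes (b - adj b)"
  have cd: "c \<in> C" "adj c = c" "d \<in> C" "adj d = d"
    using b by (auto simp: c_def d_def adj_simps itimes_simps closed_rules algebra_simps)
  have "2 *\<^sub>R q = (c * c + d * d) + 2 *\<^sub>R (- (adj b * b))"
    by (simp add: c_def d_def q_def algebra_simps itimes_simps scaleR_2)
  moreover have "pos \<dots>"
    using cd neg by (intro pos_add pos_square pos_scaleR) auto
  ultimately have "pos (2 *\<^sub>R q)" by simp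
  then have "pos ((1/2) *\<^sub>R (2 *\<^sub>R q))" by (rule pos_scaleR) simp
  then have pq: "pos q" by simp
  have "pos e" using pos_square[OF unit_closed] by simp
  then have pN: "pos (N *\<^sub>R e)" using N by (intro pos_scaleR) auto
  define M where "M = norm (N *\<^sub>R e + q)"
  have "N \<le> M" using norm_pos_mono[OF pN pq] ne N by (simp add: M_def)
  \<comment> \<open>\<open>q\<close> is below \<open>M - N\<close> times the unit while
    \<open>norm q = N\<close>, so \<open>M \<ge> 2 * N\<close>. This is the source of the lower
    bound \<open>3 * N * N\<close> for \<open>M * M - N * N\<close>.\<close>
  have "norm q \<le> M - N"
  proof (rule norm_le_of_pos[OF pq])
    have "pos (M *\<^sub>R e - (N *\<^sub>R e + q))"
      using q by (intro pos_unit_diff) (auto simp: M_def adj_simps closed_rules)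
    then show "pos ((M - N) *\<^sub>R e - q)" by (simp add: algebra_simps)
  qed (use \<open>N \<le> M\<close> in simp)
  moreover have "norm q = N"
    using cstar_id[of "adj b"] b by (simp add: q_def N_def closed_rules)
  ultimately have M: "2 * N \<le> M" by simp
  have sq: "(N *\<^sub>R e + q) * (N *\<^sub>R e + q) = (N * N) *\<^sub>R e + b * ((2 * N) *\<^sub>R e + adj b * b) * adj b"
    using b q by (simp add: q_def algebra_simps unit_left unit_right closed_rules scaleR_2
        flip: scaleR_add_left)
  have "norm (adj b * b) \<le> N" using cstar_id[OF b] by (simp add: N_def)
  then have "norm (N *\<^sub>R e + adj b * b) \<le> N"
    using norm_unit_diff_pos[OF neg, of N] by simp
  then have "norm (N *\<^sub>R e + (N *\<^sub>R e + adj b * b)) \<le> N + N"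
    using N ne norm_triangle_ineq[of "N *\<^sub>R e" "N *\<^sub>R e + adj b * b"] by simp
  moreover have "N *\<^sub>R e + (N *\<^sub>R e + adj b * b) = (2 * N) *\<^sub>R e + adj b * b"
    by (simp flip: scaleR_add_left add.assoc)
  ultimately have "norm ((2 * N) *\<^sub>R e + adj b * b) \<le> 2 * N" by simp
  then have "norm (b * ((2 * N) *\<^sub>R e + adj b * b) * adj b) \<le> norm b * (2 * N) * norm b"
    using N by (intro order.trans[OF norm_mult_ineq] mult_mono order.trans[OF norm_mult_ineq]) auto
  then have "norm ((N *\<^sub>R e + q) * (N *\<^sub>R e + q)) \<le> N * N + 2 * N * N"
    unfolding sq using N ne
    by (intro order.trans[OF norm_triangle_ineq] add_mono) (auto simp: N_def power2_eq_square)
  moreover have "norm ((N *\<^sub>R e + q) * (N *\<^sub>R e + q)) = M * M"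
    using cstar_id[of "N *\<^sub>R e + q"] q
    by (simp add: M_def adj_simps closed_rules power2_eq_square)
  moreover have "(2 * N) * (2 * N) \<le> M * M" using M N by (intro mult_mono) auto
  moreover have "0 < N * N" using N by simp
  ultimately show False by simp
qed

text \<open>
  With \<open>h = a*a\<close>, \<open>m = |h|\<close> and \<open>k = m - h\<close> one has \<open>hk = -k\<^sup>2/2\<close>, so the previous lemma applies
  to \<open>b = ak\<close> and kills the negative part \<open>k/2\<close> of \<open>h\<close>.
\<close>

lemma pos_adj_mult:
  assumes a: "a \<in> C"
  shows "pos (adj a * a)"
proof -
  define h where "h = adj a * a"
  have h: "h \<in> C" "adj h = h" using a by (auto simp: h_def adj_simps closed_rules)
  obtain m where m: "pos m" "m * m = h * h" "\<And>z. \<lbrakk>z \<in> C; z * (h * h) = h * h * z\<rbrakk> \<Longrightarrow> z * m = m * z"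
    using pos_sqrt[OF pos_square[OF h]] by metis
  \<comment> \<open>\<open>h * k = - (m * k)\<close> makes \<open>adj b * b\<close> equal to
    \<open>- (k * m * k)\<close>; a root of \<open>m\<close> that commutes with \<open>k\<close>
    exhibits \<open>k * m * k\<close> as the square of \<open>g * k\<close>.\<close>
  obtain g where g: "pos g" "g * g = m" "\<And>z. \<lbrakk>z \<in> C; z * m = m * z\<rbrakk> \<Longrightarrow> z * g = g * z"
    using pos_sqrt[OF m(1)] by metis
  have hm: "h * m = m * h" using m(3)[of h] h by (simp add: mult.assoc)
  define k where "k = m - h"
  have k: "k \<in> C" "adj k = k" using h m(1) by (auto simp: k_def pos_def adj_simps closed_rules)
  have "k * m = m * k" using hm by (simp add: k_def algebra_simps)
  then have kg: "k * g = g * k" by (rule g(3)[OF k(1)])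
  have hk: "h * k = - (m * k)" using hm m(2) by (simp add: k_def algebra_simps)
  have kk: "k * k = 2 *\<^sub>R (m * k)" using hm m(2) by (simp add: k_def algebra_simps scaleR_2)
  define b where "b = a * k"
  have "adj b * b = k * (h * k)" by (simp add: b_def h_def adj_simps k mult.assoc)
  also have "\<dots> = - (k * (g * g * k))" using hk g(2) by simp
  also have "\<dots> = - ((g * k) * (g * k))" using kg by (metis mult.assoc)
  finally have bb: "adj b * b = - ((g * k) * (g * k))" .
  have gk: "g * k \<in> C" "adj (g * k) = g * k"
    using k kg g(1) by (auto simp: pos_def adj_simps closed_rules)
  have "b = 0"
  proof (rule neg_adj_mult_pos_imp_zero)
    show "b \<in> C" using a k by (simp add: b_def closed_rules)
    show "pos (- (adj b * b))" unfolding bb using pos_square[OF gk] by simp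
  qed
  then have "(g * k) * (g * k) = 0" using bb by simp
  then have "norm (g * k) = 0" using cstar_id[OF gk(1)] gk(2) by simp
  then have "m * k = 0" by (simp add: mult.assoc flip: g(2))
  then have "k * k = 0" using kk by simp
  then have "norm k = 0" using cstar_id[OF k(1)] k(2) by simp
  then have "m = h" by (simp add: k_def)
  then show ?thesis using m(1) by (simp add: h_def)
qed

lemma norm_sum_adj_mult_mono:
  assumes "finite I" "i \<in> I" "\<And>j. j \<in> I \<Longrightarrow> f j \<in> C"
  shows "(norm (f i))\<^sup>2 \<le> norm (\<Sum>j\<in>I. adj (f j) * f j)"
proof -
  have "(\<Sum>j\<in>I. adj (f j) * f j) = adj (f i) * f i + (\<Sum>j\<in>I - {i}. adj (f j) * f j)"
    using assms by (simp add: sum.remove)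
  moreover have "norm (adj (f i) * f i) \<le> norm \<dots>"
    using assms by (intro norm_pos_mono pos_sum pos_adj_mult) auto
  ultimately show ?thesis using cstar_id[OF assms(3)[OF assms(2)]] by simp
qed

text \<open>
  From \<open>(x + y)*(x + y) + (cx - y/c)*(cx - y/c) = (1 + c\<^sup>2)x*x + (1 + 1/c\<^sup>2)y*y\<close> by choosing \<open>c\<close>.
\<close>

lemma column_triangle:
  assumes I: "finite I" and x: "\<And>j. j \<in> I \<Longrightarrow> x j \<in> C" and y: "\<And>j. j \<in> I \<Longrightarrow> y j \<in> C"
  shows "sqrt (norm (\<Sum>j\<in>I. adj (x j + y j) * (x j + y j)))
    \<le> sqrt (norm (\<Sum>j\<in>I. adj (x j) * x j)) + sqrt (norm (\<Sum>j\<in>I. adj (y j) * y j))"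
proof -
  define S where "S x = (\<Sum>j\<in>I. adj (x j) * x j)" for x :: "'b \<Rightarrow> 'a"
  define a b where "a = sqrt (norm (S x))" and "b = sqrt (norm (S y))"
  have zero: "x j = 0" if "norm (S x) = 0" "\<And>j. j \<in> I \<Longrightarrow> x j \<in> C" "j \<in> I" for x j
    using norm_sum_adj_mult_mono[OF I that(3), of x] that(1,2) by (simp add: S_def)
  have nonneg: "0 \<le> a" "0 \<le> b" by (simp_all add: a_def b_def)
  have "norm (S (\<lambda>j. x j + y j)) \<le> (a + b)\<^sup>2"
  proof (cases "a = 0 \<or> b = 0")
    case True
    then consider "\<And>j. j \<in> I \<Longrightarrow> x j = 0" | "\<And>j. j \<in> I \<Longrightarrow> y j = 0"
      using zero[of x] zero[of y] x y by (auto simp: a_def b_def)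
    then have "S (\<lambda>j. x j + y j) = S x \<or> S (\<lambda>j. x j + y j) = S y"
      by cases (simp_all add: S_def)
    then have "norm (S (\<lambda>j. x j + y j)) = a\<^sup>2 \<or> norm (S (\<lambda>j. x j + y j)) = b\<^sup>2"
      by (auto simp: a_def b_def)
    then show ?thesis using nonneg by (auto simp: power2_sum)
  next
    case False
    then have ab: "0 < a" "0 < b" using nonneg by auto
    \<comment> \<open>This \<open>c\<close> minimizes \<open>(1 + c\<^sup>2) * a\<^sup>2 + (1 +
      (1/c)\<^sup>2) * b\<^sup>2\<close>, and the minimum is \<open>(a + b)\<^sup>2\<close>.\<close>
    define c where "c = sqrt (b / a)"
    have c: "c > 0" "c\<^sup>2 = b / a" using ab by (simp_all add: c_def)
    define T where "T = (\<Sum>j\<in>I. adj (c *\<^sub>R x j - (1/c) *\<^sub>R y j) * (c *\<^sub>R x j - (1/c) *\<^sub>R y j))"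
    have "S (\<lambda>j. x j + y j) + T = (1 + c\<^sup>2) *\<^sub>R S x + (1 + (1/c)\<^sup>2) *\<^sub>R S y"
      unfolding S_def T_def scaleR_sum_right sum.distrib[symmetric]
      using c by (intro sum.cong refl) (simp add: adj_simps algebra_simps power2_eq_square)
    moreover have "norm (S (\<lambda>j. x j + y j)) \<le> norm (S (\<lambda>j. x j + y j) + T)"
      unfolding S_def T_def using x y by (intro norm_pos_mono pos_sum pos_adj_mult closed_rules) auto
    ultimately have "norm (S (\<lambda>j. x j + y j)) \<le> norm ((1 + c\<^sup>2) *\<^sub>R S x + (1 + (1/c)\<^sup>2) *\<^sub>R S y)"
      by simp
    also have "\<dots> \<le> norm ((1 + c\<^sup>2) *\<^sub>R S x) + norm ((1 + (1/c)\<^sup>2) *\<^sub>R S y)"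
      by (rule norm_triangle_ineq)
    also have "\<dots> = (1 + c\<^sup>2) * norm (S x) + (1 + (1/c)\<^sup>2) * norm (S y)"
      by (simp only: norm_scaleR) (simp add: add_nonneg_nonneg)
    also have "norm (S x) = a\<^sup>2" by (simp add: a_def)
    also have "norm (S y) = b\<^sup>2" by (simp add: b_def)
    also have "(1 + c\<^sup>2) * a\<^sup>2 + (1 + (1/c)\<^sup>2) * b\<^sup>2 = (a + b)\<^sup>2"
      using ab c(2) by (simp add: power_divide) (simp add: field_simps power2_eq_square)
    finally show ?thesis .
  qed
  then have "sqrt (norm (S (\<lambda>j. x j + y j))) \<le> a + b"
    using nonneg by (intro real_le_lsqrt) auto
  then show ?thesis by (simp add: S_def a_def b_def)
qed

end

text \<open>Let \<open>t\<close> be the squared norm of \<open>a\<close> and \<open>s\<close> a root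
  of \<open>t *\<^sub>R e - adj a * a\<close>. Then \<open>f s * f s\<close> is
  \<open>t *\<^sub>R f e - adj (f a) * f a\<close>. The projection \<open>e' - f e\<close> is
  positive, and adding \<open>t\<close> times it shows that
  \<open>t *\<^sub>R e' - adj (f a) * f a\<close> is positive. The correction by this projection
  takes care of maps that do not preserve the unit.\<close>

lemma star_hom_contractive:
  fixes f :: "'a::star_algebra_1 \<Rightarrow> 'b::star_algebra_1"
  assumes C: "cstar_subalgebra C e" and D: "cstar_subalgebra D e'"
    and f: "\<And>x. x \<in> C \<Longrightarrow> f x \<in> D"
    and add: "\<And>x y. \<lbrakk>x \<in> C; y \<in> C\<rbrakk> \<Longrightarrow> f (x + y) = f x + f y"
    and mult: "\<And>x y. \<lbrakk>x \<in> C; y \<in> C\<rbrakk> \<Longrightarrow> f (x * y) = f x * f y"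
    and scaleR: "\<And>r x. x \<in> C \<Longrightarrow> f (r *\<^sub>R x) = r *\<^sub>R f x"
    and adj: "\<And>x. x \<in> C \<Longrightarrow> f (adj x) = adj (f x)"
    and a: "a \<in> C"
  shows "norm (f a) \<le> norm a"
proof -
  interpret C: cstar_subalgebra C e by fact
  interpret D: cstar_subalgebra D e' by fact
  define t where "t = (norm a)\<^sup>2"
  have "C.pos (t *\<^sub>R e - adj a * a)"
    using a by (intro C.pos_unit_diff) (auto simp: t_def adj_simps C.closed_rules C.cstar_id)
  then obtain s where s: "C.pos s" "s * s = t *\<^sub>R e - adj a * a"
    using C.pos_sqrt by metis
  have sC: "s \<in> C" "adj s = s" using s(1) C.pos_closed C.pos_adj by auto
  have diff: "f (x - y) = f x - f y" if "x \<in> C" "y \<in> C" for x y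
    using add[of "x - y" y] that by (simp add: C.closed_rules)
  have "f s * f s = f (t *\<^sub>R e - adj a * a)" using mult sC s(2) by metis
  then have fs: "f s * f s = t *\<^sub>R f e - adj (f a) * f a"
    using a by (simp add: diff mult scaleR adj C.closed_rules)
  have "D.pos (f s * f s)"
    using sC adj[of s] f by (intro D.pos_square) auto
  moreover
  have fe: "f e * f e = f e" "adj (f e) = f e"
    using mult[of e e] adj[of e] by (simp_all add: C.unit_closed)
  then have "D.pos ((e' - f e) * (e' - f e))"
    using f by (intro D.pos_square) (auto simp: adj_simps C.unit_closed D.closed_rules)
  then have "D.pos (e' - f e)"
    using fe f[OF C.unit_closed] by (simp add: algebra_simps D.unit_left D.unit_right)
  then have "D.pos (t *\<^sub>R (e' - f e))"
    by (rule D.pos_scaleR) (simp add: t_def)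
  ultimately have "D.pos (f s * f s + t *\<^sub>R (e' - f e))"
    by (rule D.pos_add)
  then have "D.pos (t *\<^sub>R e' - adj (f a) * f a)"
    by (simp add: fs algebra_simps)
  then have "norm (adj (f a) * f a) \<le> t"
    using f a by (intro D.norm_le_of_pos D.pos_adj_mult) (auto simp: t_def)
  then show ?thesis
    using D.cstar_id[OF f[OF a]] by (auto simp: t_def intro: power2_le_imp_le)
qed

section \<open>Unitaries near a subalgebra\<close>

text \<open>
  The group of those unitaries of the type that differ from \<open>1\<close> by an element of \<open>C\<close>. For
  a subalgebra \<open>C\<close> with unit \<open>e\<close> it is isomorphic, by \<open>u \<mapsto> u - 1 + e\<close>, to the unitary group of \<open>C\<close>.
  In this picture neither the embedding \<open>diag(u, 1)\<close> nor non-unital homomorphisms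
  need corrections by units.
\<close>

definition uni :: "'a::star_algebra_1 set \<Rightarrow> 'a set" where
  "uni C = {u. u - 1 \<in> C \<and> adj u * u = 1 \<and> u * adj u = 1}"

definition uni0 :: "'a::star_algebra_1 set \<Rightarrow> 'a set" where
  "uni0 C = connected_component_set (uni C) 1"

definition uni0_group :: "'a::star_algebra_1 set \<Rightarrow> 'a monoid" where
  "uni0_group C = \<lparr>carrier = uni0 C, mult = (*), one = 1\<rparr>"

definition comm_uni :: "'a::star_algebra_1 set \<Rightarrow> 'a set" where
  "comm_uni C = derived (uni0_group C) (uni0 C)"

definition cl_comm_uni :: "'a::star_algebra_1 set \<Rightarrow> 'a set" where
  "cl_comm_uni C = closure (comm_uni C)"

lemma uni_adj_left: "u \<in> uni C \<Longrightarrow> adj u * u = 1"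
  and uni_adj_right: "u \<in> uni C \<Longrightarrow> u * adj u = 1"
  and uni_diff: "u \<in> uni C \<Longrightarrow> u - 1 \<in> C"
  by (simp_all add: uni_def)

lemma uni_cancel:
  assumes "u \<in> uni C"
  shows "adj u * (u * x) = x" "u * (adj u * x) = x"
  using assms by (simp_all add: uni_def flip: mult.assoc)

lemma uni_mono: "C \<subseteq> D \<Longrightarrow> uni C \<subseteq> uni D"
  by (auto simp: uni_def)

lemma uni0_mono: "C \<subseteq> D \<Longrightarrow> uni0 C \<subseteq> uni0 D"
  unfolding uni0_def by (intro connected_component_mono uni_mono)

lemma uni0_subset: "uni0 C \<subseteq> uni C"
  unfolding uni0_def by (rule connected_component_subset)

text \<open>\<open>1 - y\<close> is the square root of \<open>1 - w\<close> near 1. The bound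
  \<open>1/4\<close> makes the solution unique, so it depends on \<open>w\<close> alone and not on
  the subalgebra in which it was found, and contractive homomorphisms carry it to the root of the
  image.\<close>

definition quad_root :: "'a::star_algebra_1 \<Rightarrow> 'a" where
  "quad_root w = (THE y. norm y \<le> 1/4 \<and> y + y = w + y * y)"

text \<open>\<open>chart x = x + (1 + x\<^sup>2)\<^sup>1\<^sup>/\<^sup>2\<close>, a unitary with skew part \<open>x\<close> if \<open>x\<close> is skew and small.\<close>

definition chart :: "'a::star_algebra_1 \<Rightarrow> 'a" where
  "chart x = 1 + x - quad_root (- (x * x))"

text \<open>Subtracting the equations expresses \<open>2 *\<^sub>R (y - y')\<close> by
  \<open>w - w'\<close> and two terms that the bounds \<open>1/4\<close> absorb. For
  \<open>w = w'\<close> this is uniqueness; in general it makes \<open>chart\<close>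
  Lipschitz.\<close>

lemma quad_root_unique:
  fixes y y' :: "'a::real_normed_algebra_1"
  assumes "norm y \<le> 1/4" "y + y = w + y * y" "norm y' \<le> 1/4" "y' + y' = w' + y' * y'"
  shows "norm (y - y') \<le> norm (w - w')"
proof -
  have "2 *\<^sub>R (y - y') = (y + y) - (y' + y')" by (simp add: scaleR_2)
  also have "\<dots> = (w - w') + (y * (y - y') + (y - y') * y')"
    unfolding assms(2,4) by (simp add: algebra_simps)
  finally have "2 * norm (y - y') = norm ((w - w') + (y * (y - y') + (y - y') * y'))"
    by (metis norm_scaleR abs_numeral)
  also have "\<dots> \<le> norm (w - w') + (norm y * norm (y - y') + norm (y - y') * norm y')"
    by (intro norm_triangle_le add_left_mono order.refl add_mono norm_mult_ineq)
  also have "\<dots> \<le> norm (w - w') + (1/4 * norm (y - y') + norm (y - y') * (1/4))"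
    using assms by (intro add_left_mono add_mono mult_mono) auto
  finally show ?thesis using norm_ge_zero[of "w - w'"] by linarith
qed

lemma quad_root_eqI:
  assumes "norm y \<le> 1/4" "y + y = w + y * y"
  shows "quad_root w = y"
  unfolding quad_root_def
proof (rule the_equality)
  fix y' assume "norm y' \<le> 1/4 \<and> y' + y' = w + y' * y'"
  then show "y' = y" using quad_root_unique[of y' w y w] assms by simp
qed (use assms in simp)

context star_subalgebra
begin

lemma quad_root_props:
  assumes w: "w \<in> C" "norm w \<le> 1/4"
  shows "quad_root w \<in> C" "quad_root w + quad_root w = w + quad_root w * quad_root w" "norm (quad_root w) \<le> norm w"
    "adj w = w \<Longrightarrow> adj (quad_root w) = quad_root w" "z * w = w * z \<Longrightarrow> z * quad_root w = quad_root w * z"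
proof -
  have "norm w \<le> 1" using w by simp
  then obtain y where y: "y \<in> C" "y + y = w + y * y" "norm y \<le> norm w"
    "adj w = w \<Longrightarrow> adj y = y" "\<And>z. z * w = w * z \<Longrightarrow> z * y = y * z"
    using ex_root[OF w(1)] by blast
  have r: "quad_root w = y" by (rule quad_root_eqI) (use y(2,3) w(2) in auto)
  show "quad_root w \<in> C" "quad_root w + quad_root w = w + quad_root w * quad_root w" "norm (quad_root w) \<le> norm w"
    "adj w = w \<Longrightarrow> adj (quad_root w) = quad_root w" "z * w = w * z \<Longrightarrow> z * quad_root w = quad_root w * z"
    unfolding r by (fact y)+
qed

lemma norm_square_le:
  fixes x :: 'a
  assumes "norm x \<le> 1/2"
  shows "norm (- (x * x)) \<le> (norm x)\<^sup>2" "norm (- (x * x)) \<le> 1/4"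
proof -
  show 1: "norm (- (x * x)) \<le> (norm x)\<^sup>2"
    using norm_mult_ineq[of x x] by (simp add: power2_eq_square)
  have "norm x * norm x \<le> 1/2 * (1/2)" using assms by (intro mult_mono) auto
  then show "norm (- (x * x)) \<le> 1/4" using norm_mult_ineq[of x x] by simp
qed

text \<open>With \<open>r = 1 - y\<close> the root of \<open>1 + x * x\<close>, the elements
  \<open>r + x\<close> and \<open>r - x\<close> are adjoint to each other and commute, and their
  product is \<open>r * r - x * x = 1\<close>. The quadratic error is \<open>norm y\<close>, which
  is at most the norm of \<open>x * x\<close>.\<close>

lemma chart_props:
  assumes x: "x \<in> C" "adj x = - x" "norm x \<le> 1/2"
  shows "chart x \<in> uni C" "norm (chart x - 1 - x) \<le> (norm x)\<^sup>2" "adj (chart x) = chart (- x)"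
proof -
  define w where "w = - (x * x)"
  have w: "w \<in> C" "adj w = w" using x by (auto simp: w_def adj_simps closed_rules)
  have nw: "norm w \<le> 1/4" "norm w \<le> (norm x)\<^sup>2"
    using norm_square_le[OF x(3)] by (simp_all add: w_def)
  define y where "y = quad_root w"
  note r = quad_root_props[OF w(1) nw(1), folded y_def]
  have ay: "adj y = y" using r(4) w by simp
  have xy: "x * y = y * x" using r(5)[of x] by (simp add: w_def mult.assoc)
  have yy: "y * y = y + y - w" using r(2) by simp
  have E: "chart x = 1 + x - y" by (simp add: chart_def y_def w_def)
  have aE: "adj (chart x) = 1 - x - y" by (simp add: E adj_simps x ay)
  show "adj (chart x) = chart (- x)" using aE by (simp add: chart_def y_def w_def)
  have "adj (chart x) * chart x = 1" "chart x * adj (chart x) = 1"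
    unfolding aE unfolding E using xy yy by (simp_all add: algebra_simps w_def)
  then show "chart x \<in> uni C"
    using x r(1) by (auto simp: uni_def E intro!: closed_rules)
  show "norm (chart x - 1 - x) \<le> (norm x)\<^sup>2" using r(3) nw by (simp add: E)
qed

lemma chart_lipschitz:
  assumes x: "x \<in> C" "norm x \<le> 1/2" and x': "x' \<in> C" "norm x' \<le> 1/2"
  shows "norm (chart x - chart x') \<le> 2 * norm (x - x')"
proof -
  define w where "w x = - (x * x)" for x :: 'a
  have w: "w x \<in> C" "norm (w x) \<le> 1/4" if "x \<in> C" "norm x \<le> 1/2" for x
    using norm_square_le[OF that(2)] that(1) by (auto simp: w_def intro!: closed_rules)
  note r = quad_root_props[OF w[OF x]] and r' = quad_root_props[OF w[OF x']]
  have "norm (quad_root (w x) - quad_root (w x')) \<le> norm (w x - w x')"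
    using r(2,3) r'(2,3) w[OF x] w[OF x'] by (intro quad_root_unique) auto
  also have "w x - w x' = - (x * (x - x') + (x - x') * x')"
    by (simp add: w_def algebra_simps)
  also have "norm \<dots> \<le> norm x * norm (x - x') + norm (x - x') * norm x'"
    unfolding norm_minus_cancel
    by (intro order.trans[OF norm_triangle_ineq] add_mono norm_mult_ineq)
  also have "\<dots> \<le> 1/2 * norm (x - x') + norm (x - x') * (1/2)"
    using x x' by (intro add_mono mult_mono) auto
  finally have 1: "norm (quad_root (w x) - quad_root (w x')) \<le> norm (x - x')" by simp
  have "chart x - chart x' = (x - x') - (quad_root (w x) - quad_root (w x'))"
    by (simp add: chart_def w_def)
  then show ?thesis
    using 1 norm_triangle_ineq4[of "x - x'" "quad_root (w x) - quad_root (w x')"] by simp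
qed

text \<open>The skew part \<open>x\<close> of \<open>u\<close>, and \<open>y\<close> with
  \<open>1 - y\<close> the selfadjoint part, satisfy the quadratic equation of the root. The bound
  \<open>1/4\<close> on \<open>norm (u - 1)\<close> passes to \<open>norm y\<close>, so
  \<open>y\<close> is the root that \<open>quad_root\<close> selects.\<close>

lemma chart_surj:
  assumes u: "u \<in> uni C" and nu: "norm (u - 1) \<le> 1/4"
  obtains x where "x \<in> C" "adj x = - x" "norm x \<le> norm (u - 1)" "chart x = u"
proof
  define x where "x = (1/2) *\<^sub>R (u - adj u)"
  define y where "y = (1/2) *\<^sub>R ((1 - u) + (1 - adj u))"
  have x_eq: "x = (1/2) *\<^sub>R ((u - 1) - adj (u - 1))" by (simp add: x_def adj_simps)
  have nadj: "norm (adj u - 1) = norm (u - 1)"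
    using norm_adj[of "u - 1"] by (simp add: adj_simps)
  show "x \<in> C" unfolding x_eq using u by (intro closed_rules uni_diff)
  show "adj x = - x" by (simp add: x_def adj_simps algebra_simps)
  show "norm x \<le> norm (u - 1)"
    using norm_triangle_ineq4[of "u - 1" "adj (u - 1)"] by (simp add: x_eq)
  have xx: "x + x = u - adj u" and yy: "y + y = (1 - u) + (1 - adj u)"
    by (simp_all add: x_def y_def flip: scaleR_add_left)
  have "norm y \<le> 1/4"
    using norm_triangle_ineq[of "1 - u" "1 - adj u"] nu nadj
    by (simp add: y_def norm_minus_commute[of 1])
  moreover have "y + y = - (x * x) + y * y"
  proof -
    \<comment> \<open>Four copies of the equation clear the factors \<open>1/2\<close> in
      \<open>x\<close> and \<open>y\<close>.\<close>
    have "(- (x * x) + y * y) + (- (x * x) + y * y) + (- (x * x) + y * y) + (- (x * x) + y * y)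
        = (y + y) * (y + y) - (x + x) * (x + x)"
      by (simp add: algebra_simps)
    also have "\<dots> = ((1 - u) + (1 - adj u)) + ((1 - u) + (1 - adj u))
        + ((1 - u) + (1 - adj u)) + ((1 - u) + (1 - adj u))"
      unfolding xx yy using uni_adj_left[OF u] uni_adj_right[OF u]
      by (simp add: algebra_simps mult_2 mult_2_right)
    also have "\<dots> = (y + y) + (y + y) + (y + y) + (y + y)" by (simp only: yy)
    finally have "4 *\<^sub>R (- (x * x) + y * y) = 4 *\<^sub>R (y + y)"
      using scaleR_add_left[of 2 2 "- (x * x) + y * y"] scaleR_add_left[of 2 2 "y + y"]
      by (simp add: scaleR_2 add.assoc)
    then show ?thesis by (simp only: scaleR_cancel_left) simp
  qed
  ultimately have "quad_root (- (x * x)) = y" by (rule quad_root_eqI)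
  then have "chart x = 1 + x - y" by (simp add: chart_def)
  also have "\<dots> = u"
  proof -
    have "(1 + x - y) + (1 + x - y) = 1 + 1 + (x + x) - (y + y)" by simp
    also have "\<dots> = u + u" unfolding xx yy by simp
    finally have "2 *\<^sub>R (1 + x - y) = 2 *\<^sub>R u" by (simp only: scaleR_2)
    then show ?thesis by (simp only: scaleR_cancel_left) simp
  qed
  finally show "chart x = u" .
qed

section \<open>The unitary group and its identity component\<close>

lemma one_uni: "1 \<in> uni C"
  by (simp add: uni_def zero_closed)

lemma mult_uni:
  assumes "u \<in> uni C" "v \<in> uni C"
  shows "u * v \<in> uni C"
proof -
  have "u * v - 1 = (u - 1) * (v - 1) + (u - 1) + (v - 1)" by (simp add: algebra_simps)
  also have "\<dots> \<in> C" using assms by (intro closed_rules uni_diff)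
  finally show ?thesis
    using assms by (simp add: uni_def adj_simps mult.assoc uni_cancel[OF assms(1)] uni_cancel[OF assms(2)])
qed

lemma adj_uni:
  assumes "u \<in> uni C"
  shows "adj u \<in> uni C"
proof -
  have "adj u - 1 = adj (u - 1)" by (simp add: adj_simps)
  also have "\<dots> \<in> C" using assms by (intro closed_rules uni_diff)
  finally show ?thesis using assms by (simp add: uni_def)
qed

lemma closed_uni: "closed (uni C)"
proof -
  have "uni C = {u. u - 1 \<in> C} \<inter> {u. adj u * u = 1} \<inter> {u. u * adj u = 1}"
    by (auto simp: uni_def)
  moreover have "closed {u. u - 1 \<in> C}"
    using closed_C by (intro closed_vimage[of C "\<lambda>u. u - 1", unfolded vimage_def] continuous_intros)
  ultimately show ?thesis
    by (auto intro!: closed_Int closed_Collect_eq continuous_intros)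
qed

lemma connected_uni0: "connected (uni0 C)"
  by (simp add: uni0_def)

lemma one_uni0: "1 \<in> uni0 C"
  by (simp add: uni0_def one_uni)

lemma uni0I:
  assumes "connected S" "S \<subseteq> uni C" "u \<in> S" "u \<in> uni0 C" "v \<in> S"
  shows "v \<in> uni0 C"
proof -
  have "connected_component (uni C) u v"
    using assms unfolding connected_component_def by blast
  then show ?thesis
    using assms(4) unfolding uni0_def mem_Collect_eq by (rule connected_component_trans[rotated])
qed

lemma mult_uni0:
  assumes "u \<in> uni0 C" "v \<in> uni0 C"
  shows "u * v \<in> uni0 C"
proof (rule uni0I)
  show "connected ((*) u ` uni0 C)"
    by (intro connected_continuous_image connected_uni0 continuous_intros)
  show "(*) u ` uni0 C \<subseteq> uni C"
    using assms uni0_subset mult_uni by blast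
  show "u \<in> (*) u ` uni0 C" using one_uni0 by force
qed (use assms in auto)

lemma adj_uni0:
  assumes "u \<in> uni0 C"
  shows "adj u \<in> uni0 C"
proof (rule uni0I)
  show "connected (adj ` uni0 C)"
    by (intro connected_continuous_image connected_uni0 continuous_intros)
  show "adj ` uni0 C \<subseteq> uni C"
    using uni0_subset adj_uni by blast
  show "1 \<in> adj ` uni0 C" using one_uni0 by force
qed (use assms one_uni0 in auto)

lemma path_uni0:
  fixes a :: real
  assumes "continuous_on {0..a} p" "p 0 = 1" "p ` {0..a} \<subseteq> uni C" "0 \<le> a"
  shows "p a \<in> uni0 C"
proof (rule uni0I)
  show "connected (p ` {0..a})"
    by (intro connected_continuous_image assms) simp
  show "1 \<in> p ` {0..a}" using assms by (auto intro!: image_eqI[of 1 p 0])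
qed (use assms one_uni0 in auto)

lemma chart_uni0:
  assumes x: "x \<in> C" "adj x = - x" "norm x \<le> 1/2"
  shows "chart x \<in> uni0 C"
proof -
  have tx: "t *\<^sub>R x \<in> C" "adj (t *\<^sub>R x) = - (t *\<^sub>R x)" "norm (t *\<^sub>R x) \<le> 1/2"
    if "t \<in> {0..1}" for t
  proof -
    show "t *\<^sub>R x \<in> C" "adj (t *\<^sub>R x) = - (t *\<^sub>R x)"
      using x by (auto simp: adj_simps intro!: closed_rules)
    show "norm (t *\<^sub>R x) \<le> 1/2"
      using that x(3) mult_mono[of t 1 "norm x" "1/2"] by simp
  qed
  have "chart (1 *\<^sub>R x) \<in> uni0 C"
  proof (rule path_uni0)
    have "2-lipschitz_on (C \<inter> cball 0 (1/2)) chart"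
      by (rule lipschitz_onI) (auto simp: dist_norm intro!: chart_lipschitz)
    then have "continuous_on (C \<inter> cball 0 (1/2)) chart"
      by (rule lipschitz_on_continuous_on)
    then show "continuous_on {0..1} (\<lambda>t. chart (t *\<^sub>R x))"
      by (rule continuous_on_compose2) (use tx in \<open>auto intro!: continuous_intros\<close>)
    have "quad_root (0::'a) = 0" by (rule quad_root_eqI) auto
    then show "chart (0 *\<^sub>R x) = 1" by (simp add: chart_def)
    show "(\<lambda>t. chart (t *\<^sub>R x)) ` {0..1} \<subseteq> uni C" using chart_props(1) tx by blast
  qed simp
  then show ?thesis by simp
qed

lemma near_one_uni0:
  assumes "u \<in> uni C" "norm (u - 1) \<le> 1/4"
  shows "u \<in> uni0 C"
proof -
  obtain x where "x \<in> C" "adj x = - x" "norm x \<le> norm (u - 1)" "chart x = u"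
    using chart_surj[OF assms] by blast
  then show ?thesis using chart_uni0[of x] assms(2) by simp
qed

text \<open>A connected group is generated by any neighbourhood of 1. Close points \<open>v\<close>
  and \<open>w\<close> of \<open>uni0 C\<close> differ by the factor \<open>adj v * w\<close> near
  1, so the truth value of \<open>P\<close> is locally constant on the connected set
  \<open>uni0 C\<close>.\<close>

lemma uni0_induct [consumes 2, case_names one mult]:
  assumes u: "u \<in> uni0 C" and \<delta>: "0 < \<delta>" and one: "P 1"
    and step: "\<And>u v. \<lbrakk>u \<in> uni0 C; P u; v \<in> uni C; norm (v - 1) < \<delta>\<rbrakk> \<Longrightarrow> P (u * v)"
  shows "P u"
proof -
  have near: "P w" if "v \<in> uni0 C" "w \<in> uni0 C" "P v" "norm v * norm (w - v) < \<delta>" for v w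
  proof -
    have vw: "v \<in> uni C" "w \<in> uni C" using that uni0_subset by blast+
    have "adj v * w - 1 = adj v * (w - v)"
      using uni_adj_left[OF vw(1)] by (simp add: algebra_simps)
    then have "norm (adj v * w - 1) < \<delta>"
      using that(4) norm_mult_ineq[of "adj v" "w - v"] by simp
    then have "P (v * (adj v * w))"
      using that vw by (intro step mult_uni adj_uni)
    then show ?thesis using uni_cancel[OF vw(1)] by simp
  qed
  have "P 1 \<longleftrightarrow> P u"
  proof (rule connected_equivalence_relation[of "uni0 C" 1 u "\<lambda>a b. P a \<longleftrightarrow> P b"])
    fix a assume a: "a \<in> uni0 C"
    \<comment> \<open>Unitaries need not have norm 1 here, so the radius depends on
      \<open>norm a\<close>; as it is at most 1, \<open>norm a + 1\<close> bounds both
      \<open>norm a\<close> and \<open>norm x\<close>.\<close>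
    define r where "r = min 1 (\<delta> / (norm a + 2))"
    have r: "r > 0" using \<delta> by (simp add: r_def add_nonneg_pos)
    show "\<exists>T. openin (top_of_set (uni0 C)) T \<and> a \<in> T \<and> (\<forall>x\<in>T. P a \<longleftrightarrow> P x)"
    proof (intro exI conjI ballI)
      show "openin (top_of_set (uni0 C)) (uni0 C \<inter> ball a r)" by (simp add: openin_open_Int)
      show "a \<in> uni0 C \<inter> ball a r" using a r by simp
      fix x assume x: "x \<in> uni0 C \<inter> ball a r"
      have nd: "norm (x - a) < r" using x by (simp add: dist_norm norm_minus_commute)
      then have "norm x \<le> norm a + 1"
        using norm_triangle_ineq[of a "x - a"] by (simp add: r_def)
      have *: "s * norm (x - a) < \<delta>" if "0 \<le> s" "s \<le> norm a + 1" for s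
      proof -
        have "s * norm (x - a) \<le> (norm a + 1) * r" using that nd by (intro mult_mono) auto
        also have "\<dots> < (norm a + 2) * r" using r by simp
        also have "\<dots> \<le> (norm a + 2) * (\<delta> / (norm a + 2))"
          by (intro mult_left_mono) (auto simp: r_def)
        also have "\<dots> = \<delta>"
          using norm_ge_zero[of a] by (simp add: add_nonneg_eq_0_iff)
        finally show ?thesis .
      qed
      show "P a \<longleftrightarrow> P x"
        using near[of a x] near[of x a] a x *[of "norm a"] *[of "norm x"] \<open>norm x \<le> norm a + 1\<close>
        by (auto simp: norm_minus_commute)
    qed
  qed (use u one_uni0 connected_uni0 in auto)
  then show ?thesis using one by simp
qed

section \<open>The commutator subgroup and its closure\<close>

lemma group_uni0: "group (uni0_group C)"
proof (rule groupI)
  fix u assume "u \<in> carrier (uni0_group C)"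
  then have "u \<in> uni0 C" by (simp add: uni0_group_def)
  then show "\<exists>v\<in>carrier (uni0_group C). v \<otimes>\<^bsub>uni0_group C\<^esub> u = \<one>\<^bsub>uni0_group C\<^esub>"
    using adj_uni0[of u] uni_adj_left[of u C] uni0_subset
    by (auto simp: uni0_group_def intro!: bexI[of _ "adj u"])
qed (auto simp: uni0_group_def one_uni0 mult_uni0 mult.assoc)

lemma inv_uni0:
  assumes "u \<in> uni0 C"
  shows "inv\<^bsub>uni0_group C\<^esub> u = adj u"
proof -
  interpret group "uni0_group C" by (rule group_uni0)
  show ?thesis
    using assms adj_uni0[of u] uni_adj_left[of u C] uni0_subset
    by (intro inv_equality) (auto simp: uni0_group_def)
qed

lemma subgroup_comm_uni: "subgroup (comm_uni C) (uni0_group C)"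
  using group.derived_is_subgroup[OF group_uni0, of "uni0 C"]
  by (simp add: comm_uni_def uni0_group_def)

lemma comm_uni_subset: "comm_uni C \<subseteq> uni0 C"
  using subgroup.subset[OF subgroup_comm_uni] by (simp add: uni0_group_def)

lemma one_comm_uni: "1 \<in> comm_uni C"
  using subgroup.one_closed[OF subgroup_comm_uni] by (simp add: uni0_group_def)

lemma mult_comm_uni: "\<lbrakk>u \<in> comm_uni C; v \<in> comm_uni C\<rbrakk> \<Longrightarrow> u * v \<in> comm_uni C"
  using subgroup.m_closed[OF subgroup_comm_uni] by (simp add: uni0_group_def)

lemma adj_comm_uni: "u \<in> comm_uni C \<Longrightarrow> adj u \<in> comm_uni C"
  using subgroup.m_inv_closed[OF subgroup_comm_uni, of u] inv_uni0[of u] comm_uni_subset by auto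

lemma commutator_comm_uni:
  assumes "u \<in> uni0 C" "v \<in> uni0 C"
  shows "u * v * adj u * adj v \<in> comm_uni C"
proof -
  let ?G = "uni0_group C"
  have eq: "u * v * adj u * adj v = u \<otimes>\<^bsub>?G\<^esub> v \<otimes>\<^bsub>?G\<^esub> inv\<^bsub>?G\<^esub> u \<otimes>\<^bsub>?G\<^esub> inv\<^bsub>?G\<^esub> v"
    unfolding inv_uni0[OF assms(1)] inv_uni0[OF assms(2)] by (simp add: uni0_group_def)
  show ?thesis
    unfolding comm_uni_def derived_def eq
    by (rule generate.incl, rule UN_I[OF assms(1)], rule UN_I[OF assms(2)], rule singletonI)
qed

text \<open>The inverse of the commutator of \<open>u\<close> and \<open>v\<close> is the commutator
  of \<open>v\<close> and \<open>u\<close>, so the products of commutators already form a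
  group.\<close>

lemma comm_uni_minimal:
  assumes one: "1 \<in> S" and mult: "\<And>u v. \<lbrakk>u \<in> S; v \<in> S\<rbrakk> \<Longrightarrow> u * v \<in> S"
    and comm: "\<And>u v. \<lbrakk>u \<in> uni0 C; v \<in> uni0 C\<rbrakk> \<Longrightarrow> u * v * adj u * adj v \<in> S"
  shows "comm_uni C \<subseteq> S"
proof
  have gen: "\<exists>u v. u \<in> uni0 C \<and> v \<in> uni0 C \<and> w = u * v * adj u * adj v"
    if "w \<in> derived_set (uni0_group C) (uni0 C)" for w
    using that inv_uni0 by (auto simp: uni0_group_def)
  fix w assume "w \<in> comm_uni C"
  then have "w \<in> generate (uni0_group C) (derived_set (uni0_group C) (uni0 C))"
    by (simp add: comm_uni_def derived_def)
  then show "w \<in> S"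
  proof (induction rule: generate.induct)
    case one
    then show ?case using assms(1) by (simp add: uni0_group_def)
  next
    case (incl h)
    then obtain u v where "u \<in> uni0 C" "v \<in> uni0 C" "h = u * v * adj u * adj v"
      using gen by blast
    then show ?case using comm[of u v] by simp
  next
    case (inv h)
    then obtain u v where uv: "u \<in> uni0 C" "v \<in> uni0 C" "h = u * v * adj u * adj v"
      using gen by blast
    then have "h \<in> uni0 C" by (auto intro!: mult_uni0 adj_uni0)
    then have "inv\<^bsub>uni0_group C\<^esub> h = v * u * adj v * adj u"
      using inv_uni0[of h] unfolding uv(3) by (simp add: adj_simps mult.assoc)
    then show ?case using comm[of v u] uv by simp
  next
    case (eng h1 h2)
    then show ?case using mult by (simp add: uni0_group_def)
  qed
qed

text \<open>\<open>u * d * adj u\<close> is the commutator of \<open>u\<close> and \<open>d\<close>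
  times \<open>d\<close>.\<close>

lemma conj_comm_uni:
  assumes "u \<in> uni0 C" "d \<in> comm_uni C"
  shows "u * d * adj u \<in> comm_uni C"
proof -
  have "u * d * adj u * adj d \<in> comm_uni C"
    using assms comm_uni_subset by (intro commutator_comm_uni) auto
  from mult_comm_uni[OF this assms(2)] have "u * d * adj u * (adj d * d) \<in> comm_uni C"
    by (simp add: mult.assoc)
  moreover have "d \<in> uni C" using assms(2) comm_uni_subset uni0_subset by blast
  ultimately show ?thesis by (simp add: uni_adj_left)
qed

lemma comm_uni_sub_cl: "comm_uni C \<subseteq> cl_comm_uni C"
  by (simp add: cl_comm_uni_def closure_subset)

lemma mult_cl_comm_uni:
  assumes "u \<in> cl_comm_uni C" "v \<in> cl_comm_uni C"
  shows "u * v \<in> cl_comm_uni C"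
proof -
  obtain f g where "\<And>n. f n \<in> comm_uni C" "f \<longlonglongrightarrow> u" "\<And>n. g n \<in> comm_uni C" "g \<longlonglongrightarrow> v"
    using assms unfolding cl_comm_uni_def closure_sequential by blast
  then show ?thesis
    unfolding cl_comm_uni_def closure_sequential
    by (intro exI[of _ "\<lambda>n. f n * g n"]) (auto intro!: mult_comm_uni tendsto_intros)
qed

lemma adj_cl_comm_uni:
  assumes "u \<in> cl_comm_uni C"
  shows "adj u \<in> cl_comm_uni C"
proof -
  obtain f where "\<And>n. f n \<in> comm_uni C" "f \<longlonglongrightarrow> u"
    using assms unfolding cl_comm_uni_def closure_sequential by blast
  then show ?thesis
    unfolding cl_comm_uni_def closure_sequential
    by (intro exI[of _ "\<lambda>n. adj (f n)"]) (auto intro!: adj_comm_uni tendsto_intros)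
qed

lemma conj_cl_comm_uni:
  assumes "u \<in> uni0 C" "d \<in> cl_comm_uni C"
  shows "u * d * adj u \<in> cl_comm_uni C"
proof -
  obtain f where "\<And>n. f n \<in> comm_uni C" "f \<longlonglongrightarrow> d"
    using assms unfolding cl_comm_uni_def closure_sequential by blast
  then show ?thesis
    unfolding cl_comm_uni_def closure_sequential using assms(1)
    by (intro exI[of _ "\<lambda>n. u * f n * adj u"]) (auto intro!: conj_comm_uni tendsto_intros)
qed

text \<open>If \<open>d\<close> is close to the unitary \<open>c\<close>, then
  \<open>adj d * c\<close> is within \<open>1/4\<close> of 1 and so lies in \<open>uni0 C\<close>.
  The identity \<open>adj d * c - 1 = adj (d - c) * c\<close> explains the factor
  \<open>norm c + 1\<close> in the required distance.\<close>

lemma cl_comm_uni_subset: "cl_comm_uni C \<subseteq> uni0 C"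
proof
  fix c assume c: "c \<in> cl_comm_uni C"
  have "comm_uni C \<subseteq> uni C" using comm_uni_subset uni0_subset by blast
  then have cu: "c \<in> uni C"
    using c closed_uni closure_minimal unfolding cl_comm_uni_def by blast
  obtain d where d: "d \<in> comm_uni C" "dist d c < 1 / (4 * (norm c + 1))"
    using c unfolding cl_comm_uni_def closure_approachable
    by (metis zero_less_divide_1_iff mult_pos_pos zero_less_numeral add_nonneg_pos norm_ge_zero zero_less_one)
  have du: "d \<in> uni0 C" "d \<in> uni C" using d comm_uni_subset uni0_subset by auto
  have "adj d * c - 1 = adj (d - c) * c"
    using uni_adj_left[OF cu] by (simp add: adj_simps algebra_simps)
  then have "norm (adj d * c - 1) \<le> norm (d - c) * norm c"
    using norm_mult_ineq[of "adj (d - c)" c] by simp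
  also have "\<dots> \<le> 1 / (4 * (norm c + 1)) * (norm c + 1)"
    using d(2) by (intro mult_mono) (auto simp: dist_norm)
  also have "\<dots> = 1/4" using norm_ge_zero[of c] by (simp add: divide_simps add_nonneg_eq_0_iff)
  finally have "adj d * c \<in> uni0 C"
    using cu du by (intro near_one_uni0 mult_uni adj_uni)
  from mult_uni0[OF du(1) this] show "c \<in> uni0 C"
    using uni_cancel[OF du(2)] by simp
qed

lemma one_cl_comm_uni: "1 \<in> cl_comm_uni C"
  using one_comm_uni comm_uni_sub_cl by blast

end

section \<open>Factorization of unitaries near the identity\<close>

text \<open>A further factor \<open>1 + w\<close> adds \<open>w * (p' - 1)\<close> to the
  first-order error, of norm at most \<open>2 * norm w * s'\<close>, and
  \<open>s'\<^sup>2 + 2 * norm w * s' \<le> (norm w + s')\<^sup>2\<close>. The second bound supplies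
  the factor 2, so it is carried along in the induction.\<close>

lemma prod_list_one_plus_bound:
  fixes ws :: "'a::real_normed_algebra_1 list"
  assumes "sum_list (map norm ws) \<le> 1"
  shows "norm (prod_list (map (\<lambda>w. 1 + w) ws) - 1 - sum_list ws) \<le> (sum_list (map norm ws))\<^sup>2 \<and>
    norm (prod_list (map (\<lambda>w. 1 + w) ws) - 1) \<le> 2 * sum_list (map norm ws)"
  using assms
proof (induction ws)
  case Nil
  then show ?case by simp
next
  case (Cons w ws)
  define s' p' where "s' = sum_list (map norm ws)" and "p' = prod_list (map (\<lambda>w. 1 + w) ws)"
  define s p where "s = norm w + s'" and "p = (1 + w) * p'"
  have s: "sum_list (map norm (w # ws)) = s" and p: "prod_list (map (\<lambda>w. 1 + w) (w # ws)) = p"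
    by (simp_all add: s_def p_def s'_def p'_def)
  have s1: "s \<le> 1" using Cons.prems unfolding s .
  have s'0: "0 \<le> s'" unfolding s'_def by (intro sum_list_nonneg) auto
  have "s' \<le> 1" using s1 norm_ge_zero[of w] unfolding s_def by linarith
  then have IH: "norm (p' - 1 - sum_list ws) \<le> s'\<^sup>2" "norm (p' - 1) \<le> 2 * s'"
    using Cons.IH by (simp_all add: s'_def p'_def)
  have "p - 1 - sum_list (w # ws) = (p' - 1 - sum_list ws) + w * (p' - 1)"
    by (simp add: p_def algebra_simps)
  also have "norm \<dots> \<le> s'\<^sup>2 + norm w * (2 * s')"
    using IH by (intro order.trans[OF norm_triangle_ineq] add_mono order.trans[OF norm_mult_ineq]
        mult_left_mono) auto
  also have "\<dots> \<le> s\<^sup>2" by (simp add: s_def power2_eq_square algebra_simps)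
  finally have 1: "norm (p - 1 - sum_list (w # ws)) \<le> s\<^sup>2" .
  have "norm (sum_list ws) \<le> s'"
    unfolding s'_def by (induction ws) (auto intro: order.trans[OF norm_triangle_ineq])
  then have "norm (sum_list (w # ws)) \<le> s"
    using norm_triangle_ineq[of w "sum_list ws"] by (simp add: s_def)
  then have "norm (p - 1) \<le> s\<^sup>2 + s"
    using 1 norm_triangle_ineq[of "p - 1 - sum_list (w # ws)" "sum_list (w # ws)"] by simp
  also have "s\<^sup>2 \<le> s"
    using s1 s'0 by (simp add: s_def power2_eq_square mult_left_le)
  finally show ?case using 1 unfolding s p by simp
qed

lemma norm_sum_list_le:
  fixes f :: "'b \<Rightarrow> 'a::real_normed_vector"
  assumes "\<And>x. x \<in> set xs \<Longrightarrow> norm (f x) \<le> g x"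
  shows "norm (sum_list (map f xs)) \<le> sum_list (map g xs)"
  using assms by (induction xs) (auto intro!: order.trans[OF norm_triangle_ineq] add_mono)

text \<open>
  To first order, \<open>y - VyV\<^sup>*\<close> is the commutator of \<open>chart y\<close> and \<open>V\<close>. The predicate says that every
  skew element of \<open>C\<close> is a sum of a skew element of \<open>H\<close> and of such differences, with
  control of the norms.
\<close>

definition spans :: "real \<Rightarrow> 'a::star_algebra_1 set \<Rightarrow> 'a set \<Rightarrow> bool" where
  "spans K H C \<longleftrightarrow> (\<forall>x\<in>C. adj x = - x \<longrightarrow> (\<exists>x0\<in>H. \<exists>yVs.
     adj x0 = - x0 \<and> norm x0 \<le> K * norm x \<and>
     (\<forall>(y, V)\<in>set yVs. y \<in> C \<and> adj y = - y \<and> V \<in> uni0 C \<and> norm V \<le> 3) \<and>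
     sum_list (map (\<lambda>(y, V). norm y) yVs) \<le> K * norm x \<and>
     x = x0 + sum_list (map (\<lambda>(y, V). y - V * y * adj V) yVs)))"

context star_subalgebra
begin

text \<open>\<open>c\<close> equals \<open>(1 + p) * (1 + q)\<close>, where
  \<open>p = chart y - 1\<close> is \<open>y\<close> and \<open>q = V * adj p * adj V\<close> is
  \<open>- (V * y * adj V)\<close> up to quadratic errors. Conjugation by \<open>V\<close> costs
  \<open>9 = 3 * 3\<close>, whence \<open>46 = 1 + 9 + 2 * 18\<close> and
  \<open>56 = 46 + 10\<close>.\<close>

lemma commutator_first_order:
  assumes y: "y \<in> C" "adj y = - y" "norm y \<le> 1/2" and V: "V \<in> uni0 C" "norm V \<le> 3"
  defines "c \<equiv> chart y * V * adj (chart y) * adj V"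
  shows "c \<in> comm_uni C" "norm (c - 1 - (y - V * y * adj V)) \<le> 46 * (norm y)\<^sup>2"
    "norm (c - 1) \<le> 56 * norm y"
proof -
  show "c \<in> comm_uni C"
    unfolding c_def using y V by (intro commutator_comm_uni chart_uni0)
  define p where "p = chart y - 1"
  define q where "q = V * adj p * adj V"
  have VV: "V * adj V = 1" using V uni0_subset uni_adj_right by blast
  have y2: "(norm y)\<^sup>2 \<le> norm y"
    using y(3) by (simp add: power2_eq_square mult_left_le)
  have py: "norm (p - y) \<le> (norm y)\<^sup>2" using chart_props(2)[OF y] by (simp add: p_def)
  have "norm p \<le> norm (p - y) + norm y" using norm_triangle_ineq[of "p - y" y] by simp
  then have p: "norm p \<le> 2 * norm y" using py y2 by simp
  have "norm (adj p + y) \<le> (norm y)\<^sup>2"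
    using py norm_adj[of "p - y"] y(2) by (simp add: adj_simps)
  have conj: "norm (V * a * adj V) \<le> 9 * norm a" for a
  proof -
    have "norm (V * a * adj V) \<le> (norm V * norm a) * norm V"
      by (rule order.trans[OF norm_mult_ineq]) (simp add: mult_right_mono norm_mult_ineq)
    also have "\<dots> \<le> (3 * norm a) * 3" using V by (intro mult_mono) auto
    finally show ?thesis by simp
  qed
  have q: "norm q \<le> 18 * norm y" using conj[of "adj p"] p by (simp add: q_def)
  have "norm (V * (adj p + y) * adj V) \<le> 9 * (norm y)\<^sup>2"
    using conj[of "adj p + y"] \<open>norm (adj p + y) \<le> (norm y)\<^sup>2\<close> by simp
  moreover have "norm (p * q) \<le> 36 * (norm y)\<^sup>2"
    using norm_mult_ineq[of p q] mult_mono[OF p q] by (simp add: power2_eq_square)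
  moreover have "c = (1 + p) * (V * V' * V'')" if "V' = adj (1 + p)" "V'' = adj V" for V' V''
    using that by (simp add: c_def p_def mult.assoc)
  then have "c = (1 + p) * (1 + q)"
    using VV by (simp add: q_def adj_simps algebra_simps)
  then have c: "c - 1 - (y - V * y * adj V) = (p - y) + V * (adj p + y) * adj V + p * q"
    by (simp add: q_def algebra_simps)
  ultimately show 1: "norm (c - 1 - (y - V * y * adj V)) \<le> 46 * (norm y)\<^sup>2"
    unfolding c using py
    by (intro order.trans[OF norm_triangle_ineq] order.trans[OF add_mono[OF norm_triangle_ineq order.refl]]) simp
  have "norm (y - V * y * adj V) \<le> 10 * norm y"
    using norm_triangle_ineq4[of y "V * y * adj V"] conj[of y] by simp
  then have "norm (c - 1) \<le> 46 * (norm y)\<^sup>2 + 10 * norm y"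
    using 1 norm_triangle_ineq[of "c - 1 - (y - V * y * adj V)" "y - V * y * adj V"] by simp
  then show "norm (c - 1) \<le> 56 * norm y" using y2 by simp
qed

lemma prod_list_comm_uni: "set cs \<subseteq> comm_uni C \<Longrightarrow> prod_list cs \<in> comm_uni C"
  by (induction cs) (auto intro: one_comm_uni mult_comm_uni)

text \<open>Write \<open>z = chart x\<close>, decompose \<open>x\<close> by \<open>spans\<close>,
  and replace \<open>x0\<close> by \<open>chart x0\<close> and each difference by its commutator.
  The deviations from 1 add up to \<open>58 = 2 + 56\<close> times \<open>K * \<epsilon>\<close>.
  The quadratic errors are \<open>3364 = 58 * 58\<close> for the product, \<open>47 = 1 + 46\<close>
  for the factors and 1 for \<open>z\<close>, together 3412; the bound 2 for the adjoint of
  \<open>g * d\<close> gives 6824, rounded up to 11000.\<close>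

lemma factor_first_order:
  assumes H: "star_subalgebra H e'" and span: "spans K H C" and K: "1 \<le> K"
    and z: "z \<in> uni C" and small: "1000 * K * norm (z - 1) \<le> 1"
  obtains g d where "g \<in> uni H" "d \<in> comm_uni C" "norm (g - 1) \<le> 2 * K * norm (z - 1)"
    "norm (z * adj (g * d) - 1) \<le> 11000 * K\<^sup>2 * (norm (z - 1))\<^sup>2"
proof -
  interpret H: star_subalgebra H e' by fact
  define \<epsilon> where "\<epsilon> = norm (z - 1)"
  have K\<epsilon>: "1000 * (K * \<epsilon>) \<le> 1" "0 \<le> \<epsilon>" using small by (simp_all add: \<epsilon>_def mult.assoc)
  have \<epsilon>K: "\<epsilon> \<le> K * \<epsilon>" using K K\<epsilon>(2) mult_right_mono[of 1 K \<epsilon>] by simp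
  have "norm (z - 1) \<le> 1/4" using K\<epsilon> \<epsilon>K by (simp add: \<epsilon>_def)
  then obtain x where x: "x \<in> C" "adj x = - x" "norm x \<le> \<epsilon>" "chart x = z"
    using chart_surj[OF z] unfolding \<epsilon>_def by blast
  have Kx: "K * norm x \<le> K * \<epsilon>" using x(3) K by (intro mult_left_mono) auto
  obtain x0 yVs where x0: "x0 \<in> H" "adj x0 = - x0" "norm x0 \<le> K * norm x"
    and yV: "\<And>y V. (y, V) \<in> set yVs \<Longrightarrow> y \<in> C \<and> adj y = - y \<and> V \<in> uni0 C \<and> norm V \<le> 3"
    and ysum: "sum_list (map (\<lambda>(y, V). norm y) yVs) \<le> K * norm x"
    and xsum: "x = x0 + sum_list (map (\<lambda>(y, V). y - V * y * adj V) yVs)"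
    using span x(1,2) unfolding spans_def by (fastforce simp: case_prod_beta)
  define S where "S = sum_list (map (\<lambda>(y, V). norm y) yVs)"
  have S: "0 \<le> S" "S \<le> K * \<epsilon>"
    using ysum Kx by (auto simp: S_def intro!: sum_list_nonneg)
  have yS: "norm y \<le> S" if "(y, V) \<in> set yVs" for y V
  proof -
    have "norm y \<in> set (map (\<lambda>(y, V). norm y) yVs)" using that by force
    then show ?thesis unfolding S_def by (intro member_le_sum_list) auto
  qed
  define c where "c = (\<lambda>(y, V :: 'a). chart y * V * adj (chart y) * adj V)"
  have cc: "c (y, V) \<in> comm_uni C \<and> norm (c (y, V) - 1 - (y - V * y * adj V)) \<le> 46 * (norm y)\<^sup>2
      \<and> norm (c (y, V) - 1) \<le> 56 * norm y" if "(y, V) \<in> set yVs" for y V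
  proof -
    have "norm y \<le> 1/2" using yS[OF that] S K\<epsilon> by simp
    then show ?thesis using commutator_first_order[of y V] yV[OF that] by (simp add: c_def)
  qed
  define g where "g = chart x0"
  define d where "d = prod_list (map c yVs)"
  have nx0: "norm x0 \<le> K * \<epsilon>" using x0(3) Kx by simp
  have gx0: "g \<in> uni H" "norm (g - 1 - x0) \<le> (norm x0)\<^sup>2"
    using H.chart_props[OF x0(1,2)] nx0 K\<epsilon> by (simp_all add: g_def)
  have sq: "(norm x0)\<^sup>2 \<le> (K * \<epsilon>)\<^sup>2" using nx0 by (intro power_mono) auto
  have "(K * \<epsilon>)\<^sup>2 \<le> K * \<epsilon>"
    using K\<epsilon> \<epsilon>K by (simp add: power2_eq_square mult_left_le)
  then have ng: "norm (g - 1) \<le> 2 * (K * \<epsilon>)"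
    using norm_triangle_ineq[of "g - 1 - x0" x0] gx0(2) sq nx0 by simp
  have dC: "d \<in> comm_uni C" unfolding d_def using cc by (intro prod_list_comm_uni) auto
  define ws where "ws = (g - 1) # map (\<lambda>p. c p - 1) yVs"
  have prod: "prod_list (map (\<lambda>w. 1 + w) ws) = g * d"
    by (simp add: ws_def d_def o_def)
  have "sum_list (map (\<lambda>p. norm (c p - 1)) yVs) \<le> sum_list (map (\<lambda>p. 56 * (\<lambda>(y, V). norm y) p) yVs)"
    using cc by (intro sum_list_mono) auto
  also have "\<dots> = 56 * S" by (simp add: S_def sum_list_const_mult)
  finally have wS: "sum_list (map norm ws) \<le> 58 * (K * \<epsilon>)"
    using ng S by (simp add: ws_def o_def)
  then have "sum_list (map norm ws) \<le> 1" using K\<epsilon> by simp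
  note b = prod_list_one_plus_bound[OF this, unfolded prod]
  have "(sum_list (map norm ws))\<^sup>2 \<le> (58 * (K * \<epsilon>))\<^sup>2"
    using wS by (intro power_mono sum_list_nonneg) auto
  then have b1: "norm (g * d - 1 - sum_list ws) \<le> 3364 * (K * \<epsilon>)\<^sup>2"
    using b by (simp add: power_mult_distrib)
  have b2: "norm (g * d - 1) \<le> 1" using b wS K\<epsilon> by simp
  have "sum_list ws - x = (g - 1 - x0) + sum_list (map (\<lambda>p. c p - 1 - (\<lambda>(y, V). y - V * y * adj V) p) yVs)"
    unfolding sum_list_subtractf by (subst (1) xsum) (simp add: ws_def sum_list_subtractf)
  also have "norm \<dots> \<le> (K * \<epsilon>)\<^sup>2 + sum_list (map (\<lambda>p. 46 * S * (\<lambda>(y, V). norm y) p) yVs)"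
  proof (intro order.trans[OF norm_triangle_ineq] add_mono norm_sum_list_le)
    fix p assume p: "p \<in> set yVs"
    obtain y V where yV: "p = (y, V)" by force
    have "46 * (norm y)\<^sup>2 \<le> 46 * S * norm y"
      using yS[of y V] p yV by (simp add: power2_eq_square mult_right_mono)
    then show "norm (c p - 1 - (\<lambda>(y, V). y - V * y * adj V) p) \<le> 46 * S * (\<lambda>(y, V). norm y) p"
      using cc[of y V] p yV by auto
  qed (use gx0(2) sq in simp)
  also have "\<dots> = (K * \<epsilon>)\<^sup>2 + 46 * S * S" by (simp add: sum_list_const_mult S_def)
  also have "46 * S * S \<le> 46 * (K * \<epsilon>)\<^sup>2"
    using S mult_mono[OF S(2) S(2)] by (simp add: power2_eq_square)
  finally have b3: "norm (sum_list ws - x) \<le> 47 * (K * \<epsilon>)\<^sup>2" by simp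
  have "norm x \<le> 1/2" using x(3) K\<epsilon> \<epsilon>K by simp
  then have "norm (z - 1 - x) \<le> (norm x)\<^sup>2" using chart_props(2)[of x] x by simp
  also have "\<dots> \<le> (K * \<epsilon>)\<^sup>2" using x(3) \<epsilon>K by (intro power_mono) auto
  finally have b4: "norm (z - 1 - x) \<le> (K * \<epsilon>)\<^sup>2" .
  have "z - g * d = (z - 1 - x) - (g * d - 1 - sum_list ws) - (sum_list ws - x)" by simp
  then have b5: "norm (z - g * d) \<le> 3412 * (K * \<epsilon>)\<^sup>2"
    using norm_triangle_ineq4[of "(z - 1 - x) - (g * d - 1 - sum_list ws)" "sum_list ws - x"]
      norm_triangle_ineq4[of "z - 1 - x" "g * d - 1 - sum_list ws"] b1 b3 b4 by simp
  have b6: "norm (adj (g * d)) \<le> 2"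
    using norm_triangle_ineq[of "g * d - 1" 1] b2 unfolding norm_adj by simp
  have "d \<in> uni C" using dC comm_uni_subset uni0_subset by blast
  then have "(g * d) * adj (g * d) = 1"
    using gx0(1) by (simp add: adj_simps mult.assoc uni_cancel uni_adj_right)
  then have "z * adj (g * d) - 1 = (z - g * d) * adj (g * d)" by (simp only: left_diff_distrib)
  also have "norm \<dots> \<le> (3412 * (K * \<epsilon>)\<^sup>2) * 2"
    using b5 b6 by (intro order.trans[OF norm_mult_ineq] mult_mono) auto
  also have "\<dots> \<le> 11000 * K\<^sup>2 * \<epsilon>\<^sup>2" by (simp add: power_mult_distrib)
  finally show ?thesis
    using that[OF gx0(1) dC] ng by (simp add: \<epsilon>_def mult.assoc)
qed

text \<open>
  Newton iteration: the error of the first-order factorization is quadratic, and the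
  errors of the successive steps multiply up to a convergent product because the
  factors from \<open>H\<close> can be moved past those from the normal subgroup \<open>comm_uni C\<close>.
\<close>

lemma factor_near_one:
  assumes H: "star_subalgebra H e'" "H \<subseteq> C" and span: "spans K H C" and K: "1 \<le> K"
    and z: "z \<in> uni C" and small: "22000 * K\<^sup>2 * norm (z - 1) \<le> 1"
  obtains g d where "g \<in> uni0 H" "d \<in> cl_comm_uni C" "norm (g - 1) \<le> 8 * K * norm (z - 1)" "z = g * d"
proof -
  interpret H: star_subalgebra H e' by fact
  define \<epsilon> where "\<epsilon> = norm (z - 1)"
  have \<epsilon>0: "0 \<le> \<epsilon>" by (simp add: \<epsilon>_def)
  have KK: "K \<le> K\<^sup>2" using K by (simp add: power2_eq_square mult_le_cancel_left1)
  define Q where "Q w g d \<longleftrightarrow> g \<in> uni H \<and> d \<in> comm_uni C \<and> norm (g - 1) \<le> 2 * K * norm (w - 1) \<and>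
      norm (w * adj (g * d) - 1) \<le> norm (w - 1) / 2" for w g d
  have step: "\<exists>g d. Q w g d" if w: "w \<in> uni C" "norm (w - 1) \<le> \<epsilon>" for w
  proof -
    have s: "22000 * K\<^sup>2 * norm (w - 1) \<le> 1"
      using small w(2) mult_left_mono[OF w(2), of "22000 * K\<^sup>2"] by (simp add: \<epsilon>_def)
    have "1000 * K * norm (w - 1) \<le> 22000 * K\<^sup>2 * norm (w - 1)"
      using KK K by (intro mult_right_mono) auto
    from order.trans[OF this s] have "1000 * K * norm (w - 1) \<le> 1" .
    then obtain g d where gd: "g \<in> uni H" "d \<in> comm_uni C" "norm (g - 1) \<le> 2 * K * norm (w - 1)"
      "norm (w * adj (g * d) - 1) \<le> 11000 * K\<^sup>2 * (norm (w - 1))\<^sup>2"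
      using factor_first_order[OF H(1) span K w(1)] by blast
    \<comment> \<open>22000 is twice the constant of \<open>factor_first_order\<close>, so each step
      at least halves the distance to 1.\<close>
    have "11000 * K\<^sup>2 * (norm (w - 1))\<^sup>2 = (22000 * K\<^sup>2 * norm (w - 1)) * (norm (w - 1) / 2)"
      by (simp add: power2_eq_square)
    also have "\<dots> \<le> 1 * (norm (w - 1) / 2)" using s by (intro mult_right_mono) auto
    finally have "11000 * K\<^sup>2 * (norm (w - 1))\<^sup>2 \<le> norm (w - 1) / 2" by simp
    from order.trans[OF gd(4) this] show ?thesis using gd unfolding Q_def by blast
  qed
  obtain gf df where Q: "Q w (gf w) (df w)" if "w \<in> uni C" "norm (w - 1) \<le> \<epsilon>" for w
    using step by metis
  note step' = Q[unfolded Q_def]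
  \<comment> \<open>The invariant is \<open>z = Z n * G n * D n\<close>: \<open>Z n\<close> is the
    remaining error and tends to 1, \<open>G n\<close> collects the factors from \<open>H\<close>,
    newest on the left, and \<open>D n\<close>, defined below, collects conjugates of the factors
    from \<open>comm_uni C\<close>.\<close>
  define Z where "Z n = rec_nat z (\<lambda>_ w. w * adj (gf w * df w)) n" for n :: nat
  define G where "G n = rec_nat 1 (\<lambda>n u. gf (Z n) * u) n" for n :: nat
  have Z0: "Z 0 = z" and ZS: "Z (Suc n) = Z n * adj (gf (Z n) * df (Z n))" for n
    by (simp_all add: Z_def)
  have G0: "G 0 = 1" and GS: "G (Suc n) = gf (Z n) * G n" for n
    by (simp_all add: G_def)
  have HC: "uni H \<subseteq> uni C" and HC0: "uni0 H \<subseteq> uni0 C"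
    using uni_mono uni0_mono H(2) by blast+
  have dC: "comm_uni C \<subseteq> uni C" using comm_uni_subset uni0_subset by blast
  have Z: "Z n \<in> uni C \<and> norm (Z n - 1) \<le> \<epsilon> * (1/2)^n" for n
  proof (induction n)
    case 0
    show ?case using z by (simp add: Z0 \<epsilon>_def)
  next
    case (Suc n)
    have "\<epsilon> * (1/2)^n \<le> \<epsilon>" using \<epsilon>0 by (simp add: mult_left_le power_le_one)
    then have "norm (Z n - 1) \<le> \<epsilon>" using Suc by simp
    from step'[OF _ this] Suc show ?case
      using HC dC by (auto simp: ZS intro!: mult_uni adj_uni)
  qed
  have Z\<epsilon>: "norm (Z n - 1) \<le> \<epsilon>" for n
  proof -
    have "\<epsilon> * (1/2)^n \<le> \<epsilon>" using \<epsilon>0 by (simp add: mult_left_le power_le_one)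
    then show ?thesis using Z[of n] by simp
  qed
  have gd: "gf (Z n) \<in> uni H" "df (Z n) \<in> comm_uni C" "norm (gf (Z n) - 1) \<le> 2 * K * (\<epsilon> * (1/2)^n)" for n
  proof -
    have "2 * K * norm (Z n - 1) \<le> 2 * K * (\<epsilon> * (1/2)^n)"
      using Z[of n] K by (intro mult_left_mono) auto
    then show "gf (Z n) \<in> uni H" "df (Z n) \<in> comm_uni C" "norm (gf (Z n) - 1) \<le> 2 * K * (\<epsilon> * (1/2)^n)"
      using step'[of "Z n"] Z[of n] Z\<epsilon>[of n] by auto
  qed
  have GH: "G n \<in> uni H" for n
    by (induction n) (auto simp: G0 GS intro!: H.one_uni H.mult_uni gd)
  \<comment> \<open>Geometric majorant of \<open>norm (G n - 1)\<close>: its increment is the bound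
    \<open>2 * K * (\<epsilon> * (1/2)^n)\<close> for the new factor times the bound 2 for
    \<open>norm (G n)\<close>.\<close>
  define h where "h n = 8 * K * \<epsilon> * (1 - (1/2)^n)" for n :: nat
  have "8 * K * \<epsilon> \<le> 1/4"
  proof -
    have "8 * K * \<epsilon> \<le> 8 * K\<^sup>2 * \<epsilon>" using KK \<epsilon>0 by (intro mult_right_mono) auto
    then show ?thesis using small \<epsilon>0 by (simp add: \<epsilon>_def)
  qed
  then have h_le: "h n \<le> 8 * K * \<epsilon>" "h n \<le> 1/4" for n
  proof -
    show "h n \<le> 8 * K * \<epsilon>" unfolding h_def using K \<epsilon>0 by (intro mult_left_le) auto
    then show "h n \<le> 1/4" using \<open>8 * K * \<epsilon> \<le> 1/4\<close> by linarith
  qed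
  have Gh: "norm (G n - 1) \<le> h n \<and> norm (G (Suc n) - G n) \<le> h (Suc n) - h n" for n
  proof (induction n)
    case 0
    have "0 \<le> K * \<epsilon>" using K \<epsilon>0 by simp
    then show ?case using gd(3)[of 0] by (simp add: G0 GS h_def)
  next
    case (Suc n)
    have 1: "norm (G (Suc n) - 1) \<le> h (Suc n)"
      using norm_triangle_ineq[of "G (Suc n) - G n" "G n - 1"] Suc by simp
    have "norm (G (Suc n)) \<le> 2"
      using norm_triangle_ineq[of "G (Suc n) - 1" 1] 1 h_le(2)[of "Suc n"] by simp
    have "G (Suc (Suc n)) - G (Suc n) = (gf (Z (Suc n)) - 1) * G (Suc n)"
      by (simp only: GS[of "Suc n"] left_diff_distrib mult_1_left)
    also have "norm \<dots> \<le> (2 * K * (\<epsilon> * (1/2)^Suc n)) * 2"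
      using gd(3)[of "Suc n"] \<open>norm (G (Suc n)) \<le> 2\<close>
      by (intro order.trans[OF norm_mult_ineq] mult_mono) (auto simp: K \<epsilon>0 intro: order.trans[OF norm_ge_zero])
    also have "\<dots> = h (Suc (Suc n)) - h (Suc n)" by (simp add: h_def algebra_simps)
    finally show ?case using 1 by simp
  qed
  have "(\<lambda>n. 8 * K * \<epsilon> * (1 - (1/2)^n)) \<longlonglongrightarrow> 8 * K * \<epsilon> * (1 - 0)"
    by (intro tendsto_intros LIMSEQ_realpow_zero) auto
  then have "Cauchy h" unfolding h_def by (rule LIMSEQ_imp_Cauchy)
  moreover have "norm ((G (Suc n) - 1) - (G n - 1)) \<le> h (Suc n) - h n" for n
    using Gh[of n] by simp
  ultimately have "Cauchy (\<lambda>n. G n - 1)" by (rule Cauchy_dominated[rotated])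
  moreover have "G n - 1 \<in> H" for n using GH uni_diff by blast
  ultimately have "\<exists>l\<in>H. (\<lambda>n. G n - 1) \<longlonglongrightarrow> l"
    using H.complete_C[unfolded complete_def, THEN spec, of "\<lambda>n. G n - 1"] by simp
  then obtain l where "(\<lambda>n. G n - 1) \<longlonglongrightarrow> l" ..
  then have "(\<lambda>n. (G n - 1) + 1) \<longlonglongrightarrow> l + 1" by (intro tendsto_intros)
  then obtain g where g: "G \<longlonglongrightarrow> g" by simp
  have gH: "g \<in> uni H"
    by (rule closed_sequentially[OF H.closed_uni GH g])
  have "norm (g - 1) \<le> 8 * K * \<epsilon>"
  proof (rule Lim_bounded)
    show "(\<lambda>n. norm (G n - 1)) \<longlonglongrightarrow> norm (g - 1)" by (intro tendsto_intros g)
    show "\<forall>n\<ge>0. norm (G n - 1) \<le> 8 * K * \<epsilon>" using Gh h_le(1) by (meson order.trans)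
  qed
  have "g \<in> uni0 H"
    using gH \<open>norm (g - 1) \<le> 8 * K * \<epsilon>\<close> \<open>8 * K * \<epsilon> \<le> 1/4\<close> by (intro H.near_one_uni0) auto
  define D where "D n = adj (G n) * adj (Z n) * z" for n
  have GH0: "G n \<in> uni0 H" for n
    using GH Gh[of n] h_le(2)[of n] by (intro H.near_one_uni0) auto
  have DC: "D n \<in> comm_uni C" for n
  proof (induction n)
    case 0
    then show ?case using z one_comm_uni by (simp add: D_def G0 Z0 uni_adj_left)
  next
    case (Suc n)
    let ?g = "gf (Z n)" and ?d = "df (Z n)"
    have "D (Suc n) = adj (G n) * (adj ?g * (?g * (?d * (adj (Z n) * z))))"
      by (simp add: D_def GS ZS adj_simps mult.assoc)
    also have "\<dots> = adj (G n) * ?d * (G n * adj (G n)) * adj (Z n) * z"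
      using uni_cancel[OF gd(1)] uni_adj_right[OF GH] by (simp add: mult.assoc)
    also have "\<dots> = (adj (G n) * ?d * adj (adj (G n))) * D n"
      by (simp add: D_def mult.assoc)
    also have "\<dots> \<in> comm_uni C"
      using GH0 HC0 Suc gd(2) by (intro mult_comm_uni conj_comm_uni adj_uni0) auto
    finally show ?case .
  qed
  have "(\<lambda>n. \<epsilon> * (1/2)^n) \<longlonglongrightarrow> \<epsilon> * 0"
    by (intro tendsto_intros LIMSEQ_realpow_zero) auto
  then have "(\<lambda>n. Z n - 1) \<longlonglongrightarrow> 0"
    using Z by (intro Lim_null_comparison[of "\<lambda>n. Z n - 1"]) auto
  then have "Z \<longlonglongrightarrow> 1" by (simp add: LIM_zero_iff)
  have "D \<longlonglongrightarrow> adj g * adj 1 * z"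
    unfolding D_def by (intro tendsto_intros g \<open>Z \<longlonglongrightarrow> 1\<close>)
  then have "adj g * z \<in> cl_comm_uni C"
    unfolding cl_comm_uni_def closure_sequential using DC by auto
  moreover have "z = g * (adj g * z)" using uni_cancel[OF gH] by simp
  ultimately show ?thesis
    using that \<open>g \<in> uni0 H\<close> \<open>norm (g - 1) \<le> 8 * K * \<epsilon>\<close> by (simp add: \<epsilon>_def)
qed

text \<open>Elements near 1 generate \<open>uni0 C\<close>, and
  \<open>g * d * (g' * d') = (g * g') * ((adj g' * d * g') * d')\<close> keeps the shape of the
  factorization because the closed commutator subgroup is normal.\<close>

corollary factor_uni0:
  assumes H: "star_subalgebra H e'" "H \<subseteq> C" and span: "spans K H C" and K: "1 \<le> K"
    and u: "u \<in> uni0 C"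
  obtains g d where "g \<in> uni0 H" "d \<in> cl_comm_uni C" "u = g * d"
proof -
  interpret H: star_subalgebra H e' by fact
  have "\<exists>g\<in>uni0 H. \<exists>d\<in>cl_comm_uni C. u = g * d"
  proof (rule uni0_induct[OF u, of "1 / (22000 * K\<^sup>2)"])
    show "0 < 1 / (22000 * K\<^sup>2)" using K by simp
    show "\<exists>g\<in>uni0 H. \<exists>d\<in>cl_comm_uni C. 1 = g * d"
      using H.one_uni0 one_cl_comm_uni by force
    fix u v assume "\<exists>g\<in>uni0 H. \<exists>d\<in>cl_comm_uni C. u = g * d"
      and v: "v \<in> uni C" "norm (v - 1) < 1 / (22000 * K\<^sup>2)"
    then obtain g d where u: "g \<in> uni0 H" "d \<in> cl_comm_uni C" "u = g * d" by blast
    have "22000 * K\<^sup>2 * norm (v - 1) \<le> 1"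
      using v(2) K by (simp add: field_simps)
    then obtain g' d' where v': "g' \<in> uni0 H" "d' \<in> cl_comm_uni C" "v = g' * d'"
      using factor_near_one[OF H span K v(1)] by blast
    have g': "g' \<in> uni0 C" "g' \<in> uni C" using v'(1) uni0_mono[OF H(2)] uni0_subset by blast+
    have "u * v = (g * g') * ((adj g' * d * adj (adj g')) * d')"
      using uni_cancel[OF g'(2)] by (simp add: u v' mult.assoc)
    moreover have "g * g' \<in> uni0 H" using u v' by (intro H.mult_uni0)
    moreover have "(adj g' * d * adj (adj g')) * d' \<in> cl_comm_uni C"
      using u v' g' by (intro mult_cl_comm_uni conj_cl_comm_uni adj_uni0)
    ultimately show "\<exists>g\<in>uni0 H. \<exists>d\<in>cl_comm_uni C. u * v = g * d" by blast
  qed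
  then show ?thesis using that by blast
qed

end

section \<open>Contractive star homomorphisms and inductive limits\<close>

text \<open>Contractivity is an assumption because the norm on matrices is not a C*-norm: it is a
  theorem for maps between the base algebras and is inherited by the entrywise maps.\<close>

locale star_map = C: star_subalgebra C e + D: star_subalgebra D e'
  for C :: "'a::star_algebra_1 set" and e and D :: "'b::star_algebra_1 set" and e' +
  fixes F :: "'a \<Rightarrow> 'b"
  assumes F_closed: "x \<in> C \<Longrightarrow> F x \<in> D"
    and F_add: "\<lbrakk>x \<in> C; y \<in> C\<rbrakk> \<Longrightarrow> F (x + y) = F x + F y"
    and F_mult: "\<lbrakk>x \<in> C; y \<in> C\<rbrakk> \<Longrightarrow> F (x * y) = F x * F y"
    and F_scaleR: "x \<in> C \<Longrightarrow> F (r *\<^sub>R x) = r *\<^sub>R F x"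
    and F_adj: "x \<in> C \<Longrightarrow> F (adj x) = adj (F x)"
    and F_contractive: "x \<in> C \<Longrightarrow> norm (F x) \<le> norm x"

text \<open>The unital extension of \<open>F\<close> to the algebra with unit 1 adjoined, restricted
  to the elements that differ from 1 by an element of the domain.\<close>

definition unitize :: "('a::star_algebra_1 \<Rightarrow> 'b::star_algebra_1) \<Rightarrow> 'a \<Rightarrow> 'b" where
  "unitize F u = 1 + F (u - 1)"

context star_map
begin

lemma F_zero: "F 0 = 0"
  using F_scaleR[OF C.zero_closed, of 0] by simp

lemma F_minus: "x \<in> C \<Longrightarrow> F (- x) = - F x"
  using F_scaleR[of x "-1"] by simp

lemma F_diff: "\<lbrakk>x \<in> C; y \<in> C\<rbrakk> \<Longrightarrow> F (x - y) = F x - F y"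
  using F_add[of x "- y"] by (simp add: C.minus_closed F_minus)

lemma unitize_one [simp]: "unitize F 1 = 1"
  by (simp add: unitize_def F_zero)

lemma unitize_mult:
  assumes "u \<in> uni C" "v \<in> uni C"
  shows "unitize F (u * v) = unitize F u * unitize F v"
proof -
  note uv = uni_diff[OF assms(1)] uni_diff[OF assms(2)]
  have "u * v - 1 = (u - 1) * (v - 1) + (u - 1) + (v - 1)" by (simp add: algebra_simps)
  then have "F (u * v - 1) = F (u - 1) * F (v - 1) + F (u - 1) + F (v - 1)"
    using uv by (simp only: F_add F_mult C.closed_rules)
  then show ?thesis by (simp add: unitize_def algebra_simps)
qed

lemma unitize_adj:
  assumes "u \<in> uni C"
  shows "unitize F (adj u) = adj (unitize F u)"
  using F_adj[OF uni_diff[OF assms]] by (simp add: unitize_def adj_simps)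

lemma unitize_uni:
  assumes "u \<in> uni C"
  shows "unitize F u \<in> uni D"
proof -
  have "adj (unitize F u) * unitize F u = 1" "unitize F u * adj (unitize F u) = 1"
    using unitize_mult[OF C.adj_uni[OF assms] assms] unitize_mult[OF assms C.adj_uni[OF assms]]
    by (simp_all add: unitize_adj assms uni_adj_left[OF assms] uni_adj_right[OF assms])
  moreover have "unitize F u - 1 \<in> D"
    using uni_diff[OF assms] F_closed by (simp add: unitize_def)
  ultimately show ?thesis by (simp add: uni_def)
qed

lemma unitize_dist:
  assumes "u \<in> uni C" "v \<in> uni C"
  shows "norm (unitize F u - unitize F v) \<le> norm (u - v)"
proof -
  note uv = uni_diff[OF assms(1)] uni_diff[OF assms(2)]
  have "unitize F u - unitize F v = F ((u - 1) - (v - 1))"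
    using uv by (simp only: F_diff unitize_def) simp
  then show ?thesis
    using F_contractive[OF C.diff_closed[OF uv]] by simp
qed

lemma continuous_unitize: "continuous_on (uni C) (unitize F)"
proof (rule lipschitz_on_continuous_on)
  show "1-lipschitz_on (uni C) (unitize F)"
    by (rule lipschitz_onI) (simp_all add: dist_norm unitize_dist)
qed

lemma unitize_uni0:
  assumes "u \<in> uni0 C"
  shows "unitize F u \<in> uni0 D"
proof (rule D.uni0I)
  show "connected (unitize F ` uni0 C)"
    by (intro connected_continuous_image C.connected_uni0 continuous_on_subset[OF continuous_unitize]
        uni0_subset)
  show "unitize F ` uni0 C \<subseteq> uni D"
    using uni0_subset unitize_uni by blast
  show "1 \<in> unitize F ` uni0 C" by (rule image_eqI[where x = 1]) (simp_all add: C.one_uni0)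
  show "1 \<in> uni0 D" by (rule D.one_uni0)
  show "unitize F u \<in> unitize F ` uni0 C" using assms by (rule imageI)
qed

lemma unitize_comm_uni:
  assumes "u \<in> comm_uni C"
  shows "unitize F u \<in> comm_uni D"
proof -
  have "comm_uni C \<subseteq> {u \<in> uni C. unitize F u \<in> comm_uni D}"
  proof (rule C.comm_uni_minimal)
    fix u v assume "u \<in> uni0 C" "v \<in> uni0 C"
    moreover from this have "u \<in> uni C" "v \<in> uni C" using uni0_subset by blast+
    ultimately show "u * v * adj u * adj v \<in> {u \<in> uni C. unitize F u \<in> comm_uni D}"
      by (auto simp: unitize_mult unitize_adj C.mult_uni C.adj_uni
          intro!: D.commutator_comm_uni unitize_uni0)
  qed (auto simp: C.one_uni D.one_comm_uni unitize_mult intro: C.mult_uni D.mult_comm_uni)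
  then show ?thesis using assms by blast
qed

lemma unitize_cl_comm_uni:
  assumes "u \<in> cl_comm_uni C"
  shows "unitize F u \<in> cl_comm_uni D"
proof -
  obtain f where f: "\<And>n. f n \<in> comm_uni C" "f \<longlonglongrightarrow> u"
    using assms unfolding cl_comm_uni_def closure_sequential by blast
  have "u \<in> uni C" using assms C.cl_comm_uni_subset uni0_subset by blast
  moreover have fu: "f n \<in> uni C" for n using f C.comm_uni_subset uni0_subset by blast
  ultimately have "(\<lambda>n. unitize F (f n)) \<longlonglongrightarrow> unitize F u"
    using continuous_unitize f(2) unfolding continuous_on_sequentially by (auto simp: o_def)
  then show ?thesis
    unfolding cl_comm_uni_def closure_sequential
    by (intro exI[of _ "\<lambda>n. unitize F (f n)"]) (simp add: unitize_comm_uni[OF f(1)])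
qed

text \<open>The image of the root solves the image of the quadratic equation and still has norm at
  most \<open>1/4\<close>, so uniqueness identifies it.\<close>

lemma unitize_chart:
  assumes x: "x \<in> C" "norm x \<le> 1/2"
  shows "unitize F (chart x) = chart (F x)"
proof -
  define w where "w = - (x * x)"
  have w: "w \<in> C" "norm w \<le> 1/4"
    using x C.norm_square_le[OF x(2)] by (auto simp: w_def C.closed_rules)
  note r = C.quad_root_props[OF w]
  have "quad_root (- (F x * F x)) = F (quad_root w)"
  proof (rule quad_root_eqI)
    show "norm (F (quad_root w)) \<le> 1/4" using F_contractive[OF r(1)] r(3) w(2) by linarith
    have "F (quad_root w + quad_root w) = F (w + quad_root w * quad_root w)" using r(2) by simp
    then have "F (quad_root w) + F (quad_root w) = F w + F (quad_root w) * F (quad_root w)"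
      using r(1) w(1) by (simp only: F_add F_mult C.closed_rules)
    moreover have "F w = - (F x * F x)"
      using x by (simp add: w_def F_minus F_mult C.closed_rules)
    ultimately show "F (quad_root w) + F (quad_root w) = - (F x * F x) + F (quad_root w) * F (quad_root w)"
      by simp
  qed
  moreover have "unitize F (chart x) = 1 + (F x - F (quad_root w))"
    using x r(1) by (simp add: unitize_def chart_def w_def flip: F_diff)
  ultimately show ?thesis by (simp add: chart_def)
qed

end

text \<open>\<open>norm_limit\<close> keeps of the limit of norms only what is used: small norm in
  the limit implies small norm at some later stage. The factor \<open>K\<close> allows for matrices,
  where only the norms of entries converge.\<close>

locale limit_system =
  fixes C :: "nat \<Rightarrow> 'a::star_algebra_1 set" and e :: "nat \<Rightarrow> 'a"
    and D :: "'b::star_algebra_1 set" and e' :: 'b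
    and \<Phi> :: "nat \<Rightarrow> nat \<Rightarrow> 'a \<Rightarrow> 'a" and \<Psi> :: "nat \<Rightarrow> 'a \<Rightarrow> 'b" and K :: real
  assumes \<Phi>: "m \<le> l \<Longrightarrow> star_map (C m) (e m) (C l) (e l) (\<Phi> m l)"
    and \<Psi>: "star_map (C m) (e m) D e' (\<Psi> m)"
    and compat: "\<lbrakk>m \<le> l; x \<in> C m\<rbrakk> \<Longrightarrow> \<Psi> l (\<Phi> m l x) = \<Psi> m x"
    and norm_limit: "\<lbrakk>x \<in> C m; norm (\<Psi> m x) < r\<rbrakk> \<Longrightarrow> \<exists>l\<ge>m. norm (\<Phi> m l x) \<le> K * r"
    and dense: "D \<subseteq> closure (\<Union>m. \<Psi> m ` C m)"
    and K: "1 \<le> K"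
begin

lemma star_C: "star_subalgebra (C m) (e m)"
  using \<Psi>[of m] by (simp add: star_map_def)

lemma star_D: "star_subalgebra D e'"
  using \<Psi>[of 0] by (simp add: star_map_def)

lemma unitize_compat:
  "\<lbrakk>m \<le> l; u \<in> uni (C m)\<rbrakk> \<Longrightarrow> unitize (\<Psi> l) (unitize (\<Phi> m l) u) = unitize (\<Psi> m) u"
  using compat[OF _ uni_diff] by (simp add: unitize_def)

text \<open>What is approximated is the skew coordinate \<open>x\<close> with
  \<open>chart x = u\<close>. The skew part of any approximant is again an approximant, and once it
  has been pushed to a stage where its norm is at most \<open>1/2\<close>, \<open>chart\<close>
  turns it into a unitary.\<close>

lemma lift_near_one:
  assumes u: "u \<in> uni D" and near: "norm (u - 1) \<le> 1 / (4 * K)" and \<eta>: "0 < \<eta>"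
  obtains m v where "v \<in> uni0 (C m)" "norm (unitize (\<Psi> m) v - u) < \<eta>"
proof -
  interpret D: star_subalgebra D e' by (rule star_D)
  have K4: "1 / (4 * K) \<le> 1/4" using K by (simp add: divide_simps)
  then obtain x where x: "x \<in> D" "adj x = - x" "norm x \<le> norm (u - 1)" "chart x = u"
    using D.chart_surj[OF u] near by (metis order.trans)
  \<comment> \<open>\<open>\<eta> / 2\<close> because \<open>chart\<close> is 2-Lipschitz;
    \<open>1 / (8 * K)\<close> because, added to \<open>norm x \<le> 1 / (4 * K)\<close>, it stays
    below \<open>1 / (2 * K)\<close>, which \<open>norm_limit\<close> turns into
    \<open>1/2\<close>.\<close>
  define \<theta> where "\<theta> = min (\<eta> / 2) (1 / (8 * K))"
  have \<theta>: "\<theta> > 0" "\<theta> \<le> \<eta> / 2" "\<theta> \<le> 1 / (8 * K)" using \<eta> K by (auto simp: \<theta>_def)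
  obtain m y where y: "y \<in> C m" "dist (\<Psi> m y) x < \<theta>"
    using dense x(1) \<theta>(1) unfolding closure_approachable subset_eq by blast
  interpret \<Psi>: star_map "C m" "e m" D e' "\<Psi> m" by (rule \<Psi>)
  define z where "z = (1/2) *\<^sub>R (y - adj y)"
  have z: "z \<in> C m" "adj z = - z"
    using y by (auto simp: z_def adj_simps algebra_simps intro!: \<Psi>.C.closed_rules)
  have "\<Psi> m z = (1/2) *\<^sub>R (\<Psi> m y - adj (\<Psi> m y))"
    using y by (simp add: z_def \<Psi>.F_scaleR \<Psi>.F_diff \<Psi>.F_adj \<Psi>.C.closed_rules)
  moreover have "(1/2) *\<^sub>R x + (1/2) *\<^sub>R x = x" by (simp flip: scaleR_add_left)
  moreover have "(1/2) *\<^sub>R ((\<Psi> m y - x) - adj (\<Psi> m y - x))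
      = (1/2) *\<^sub>R (\<Psi> m y - adj (\<Psi> m y)) - ((1/2) *\<^sub>R x + (1/2) *\<^sub>R x)"
    using x(2) by (simp add: adj_simps algebra_simps)
  ultimately have "\<Psi> m z - x = (1/2) *\<^sub>R ((\<Psi> m y - x) - adj (\<Psi> m y - x))" by simp
  moreover have "norm ((\<Psi> m y - x) - adj (\<Psi> m y - x)) \<le> 2 * norm (\<Psi> m y - x)"
    using norm_triangle_ineq4[of "\<Psi> m y - x" "adj (\<Psi> m y - x)"] unfolding norm_adj by simp
  ultimately have zx: "norm (\<Psi> m z - x) < \<theta>" using y(2) by (simp add: dist_norm)
  have nz: "norm (\<Psi> m z) < 1 / (2 * K)"
  proof -
    have "norm (\<Psi> m z) \<le> norm (\<Psi> m z - x) + norm x"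
      using norm_triangle_ineq[of "\<Psi> m z - x" x] by simp
    also have "\<dots> < 1 / (8 * K) + 1 / (4 * K)" using zx x(3) near \<theta>(3) by linarith
    also have "\<dots> \<le> 1 / (2 * K)" using K by (simp add: divide_simps)
    finally show ?thesis .
  qed
  obtain l where l: "m \<le> l" "norm (\<Phi> m l z) \<le> K * (1 / (2 * K))"
    using norm_limit[OF z(1) nz] by blast
  interpret \<Phi>: star_map "C m" "e m" "C l" "e l" "\<Phi> m l" by (rule \<Phi>[OF l(1)])
  interpret \<Psi>': star_map "C l" "e l" D e' "\<Psi> l" by (rule \<Psi>)
  define z' where "z' = \<Phi> m l z"
  have z': "z' \<in> C l" "adj z' = - z'" "norm z' \<le> 1/2"
    using z l K by (auto simp: z'_def \<Phi>.F_closed \<Phi>.F_minus simp flip: \<Phi>.F_adj)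
  have "unitize (\<Psi> l) (chart z') = chart (\<Psi> m z)"
    using \<Psi>'.unitize_chart[OF z'(1,3)] compat[OF l(1) z(1)] by (simp add: z'_def)
  moreover have "norm (chart (\<Psi> m z) - chart x) \<le> 2 * norm (\<Psi> m z - x)"
  proof (rule D.chart_lipschitz)
    have "1 / (2 * K) \<le> 1/2" using K by (simp add: divide_simps)
    then show "norm (\<Psi> m z) \<le> 1/2" using nz by linarith
    show "norm x \<le> 1/2" using x(3) near K4 by linarith
  qed (use x z \<Psi>.F_closed in auto)
  ultimately have "norm (unitize (\<Psi> l) (chart z') - u) < \<eta>" using zx \<theta>(2) x(4) by simp
  then show ?thesis using that star_subalgebra.chart_uni0[OF star_C z'] by blast
qed

definition images :: "(nat \<Rightarrow> 'a set) \<Rightarrow> 'b set" where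
  "images S = {unitize (\<Psi> m) u |m u. u \<in> S m}"

lemma images_common:
  assumes S: "\<And>m. S m \<subseteq> uni (C m)"
    and push: "\<And>m l u. \<lbrakk>m \<le> l; u \<in> S m\<rbrakk> \<Longrightarrow> unitize (\<Phi> m l) u \<in> S l"
    and "a \<in> images S" "b \<in> images S"
  obtains m u v where "u \<in> S m" "v \<in> S m" "a = unitize (\<Psi> m) u" "b = unitize (\<Psi> m) v"
proof -
  obtain k l u v where u: "u \<in> S k" "a = unitize (\<Psi> k) u" and v: "v \<in> S l" "b = unitize (\<Psi> l) v"
    using assms(3,4) unfolding images_def by blast
  define m where "m = max k l"
  have "u \<in> uni (C k)" "v \<in> uni (C l)" using u v S by blast+
  then show ?thesis
    using u v push[of k m u] push[of l m v] unitize_compat[of k m u] unitize_compat[of l m v]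
    by (intro that[of "unitize (\<Phi> k m) u" m "unitize (\<Phi> l m) v"]) (auto simp: m_def)
qed

lemma push_uni0: "\<lbrakk>m \<le> l; u \<in> uni0 (C m)\<rbrakk> \<Longrightarrow> unitize (\<Phi> m l) u \<in> uni0 (C l)"
  using star_map.unitize_uni0[OF \<Phi>] .

lemma push_comm_uni: "\<lbrakk>m \<le> l; u \<in> comm_uni (C m)\<rbrakk> \<Longrightarrow> unitize (\<Phi> m l) u \<in> comm_uni (C l)"
  using star_map.unitize_comm_uni[OF \<Phi>] .

lemma comm_uni_sub_uni: "comm_uni (C m) \<subseteq> uni (C m)"
  by (rule order.trans[OF star_subalgebra.comm_uni_subset[OF star_C] uni0_subset])

lemma closure_images_mult:
  assumes S: "\<And>m. S m \<subseteq> uni (C m)"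
    and push: "\<And>m l u. \<lbrakk>m \<le> l; u \<in> S m\<rbrakk> \<Longrightarrow> unitize (\<Phi> m l) u \<in> S l"
    and mult: "\<And>m u v. \<lbrakk>u \<in> S m; v \<in> S m\<rbrakk> \<Longrightarrow> u * v \<in> S m"
    and "a \<in> closure (images S)" "b \<in> closure (images S)"
  shows "a * b \<in> closure (images S)"
proof -
  have im: "a * b \<in> images S" if ab: "a \<in> images S" "b \<in> images S" for a b
  proof -
    obtain m u v where uv: "u \<in> S m" "v \<in> S m" "a = unitize (\<Psi> m) u" "b = unitize (\<Psi> m) v"
      by (rule images_common[where S = S, OF S push ab])
    have "u \<in> uni (C m)" "v \<in> uni (C m)" using uv(1,2) S by blast+
    then have "a * b = unitize (\<Psi> m) (u * v)"
      using star_map.unitize_mult[OF \<Psi>[of m], of u v] uv(3,4) by simp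
    then show ?thesis using mult[OF uv(1,2)] by (auto simp: images_def)
  qed
  obtain f g where "\<And>n. f n \<in> images S" "f \<longlonglongrightarrow> a" "\<And>n. g n \<in> images S" "g \<longlonglongrightarrow> b"
    using assms(4,5) unfolding closure_sequential by blast
  then show ?thesis
    unfolding closure_sequential
    by (intro exI[of _ "\<lambda>n. f n * g n"]) (auto intro!: im tendsto_intros)
qed

text \<open>Unitaries near 1 are approximated by \<open>lift_near_one\<close>. They generate
  \<open>uni0 D\<close>, and the closure of the images is closed under products because two lifts
  can be moved to a common stage.\<close>

lemma uni0_approx: "uni0 D \<subseteq> closure (images (\<lambda>m. uni0 (C m)))"
proof
  interpret D: star_subalgebra D e' by (rule star_D)
  let ?X = "\<lambda>m. uni0 (C m)"
  have pos: "0 < 1 / (4 * K)" using K by simp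
  fix u assume "u \<in> uni0 D"
  from this pos show "u \<in> closure (images ?X)"
  proof (induction rule: D.uni0_induct)
    case one
    have "(1::'b) \<in> images ?X"
      unfolding images_def using star_map.unitize_one[OF \<Psi>[of 0]] star_subalgebra.one_uni0[OF star_C[of 0]]
      by (metis (mono_tags, lifting) mem_Collect_eq)
    then show ?case using closure_subset by blast
  next
    case (mult u v)
    have "v \<in> closure (images ?X)"
      unfolding closure_approachable
    proof (intro allI impI)
      fix r :: real assume "0 < r"
      have "norm (v - 1) \<le> 1 / (4 * K)" using mult.hyps(3) by simp
      then obtain m w where "w \<in> uni0 (C m)" "norm (unitize (\<Psi> m) w - v) < r"
        by (rule lift_near_one[OF mult.hyps(2) _ \<open>0 < r\<close>])
      then show "\<exists>y\<in>images ?X. dist y v < r" by (auto simp: images_def dist_norm)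
    qed
    then show ?case
      using mult.IH star_subalgebra.mult_uni0[OF star_C]
      by (intro closure_images_mult uni0_subset push_uni0)
  qed
qed

lemma comm_uni_approx: "comm_uni D \<subseteq> closure (images (\<lambda>m. comm_uni (C m)))"
proof -
  interpret D: star_subalgebra D e' by (rule star_D)
  let ?X = "\<lambda>m. uni0 (C m)"
  let ?Y = "\<lambda>m. comm_uni (C m)"
  show ?thesis
  proof (rule D.comm_uni_minimal)
    have "(1::'b) \<in> images ?Y"
      unfolding images_def using star_map.unitize_one[OF \<Psi>[of 0]] star_subalgebra.one_comm_uni[OF star_C[of 0]]
      by (metis (mono_tags, lifting) mem_Collect_eq)
    then show "1 \<in> closure (images ?Y)" using closure_subset by blast
    show "u * v \<in> closure (images ?Y)" if "u \<in> closure (images ?Y)" "v \<in> closure (images ?Y)" for u v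
      using that star_subalgebra.mult_comm_uni[OF star_C]
      by (intro closure_images_mult comm_uni_sub_uni push_comm_uni)
    fix a b assume "a \<in> uni0 D" "b \<in> uni0 D"
    then obtain f g where f: "\<And>n. f n \<in> images ?X" "f \<longlonglongrightarrow> a" and g: "\<And>n. g n \<in> images ?X" "g \<longlonglongrightarrow> b"
      using uni0_approx unfolding closure_sequential subset_eq by meson
    have "f n * g n * adj (f n) * adj (g n) \<in> images ?Y" for n
    proof -
      obtain m u v where uv: "u \<in> uni0 (C m)" "v \<in> uni0 (C m)"
        "f n = unitize (\<Psi> m) u" "g n = unitize (\<Psi> m) v"
        by (rule images_common[where S = ?X, OF uni0_subset push_uni0 f(1)[of n] g(1)[of n]])
      interpret \<Psi>: star_map "C m" "e m" D e' "\<Psi> m" by (rule \<Psi>)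
      have "u \<in> uni (C m)" "v \<in> uni (C m)" using uv uni0_subset by blast+
      then have "f n * g n * adj (f n) * adj (g n) = unitize (\<Psi> m) (u * v * adj u * adj v)"
        by (simp add: uv \<Psi>.unitize_mult \<Psi>.unitize_adj \<Psi>.C.mult_uni \<Psi>.C.adj_uni)
      then show ?thesis
        using \<Psi>.C.commutator_comm_uni[OF uv(1,2)] by (auto simp: images_def)
    qed
    moreover have "(\<lambda>n. f n * g n * adj (f n) * adj (g n)) \<longlonglongrightarrow> a * b * adj a * adj b"
      by (intro tendsto_intros f g)
    ultimately show "a * b * adj a * adj b \<in> closure (images ?Y)"
      unfolding closure_sequential by (intro exI[of _ "\<lambda>n. f n * g n * adj (f n) * adj (g n)"]) auto
  qed
qed

end

text \<open>
  If \<open>u\<close> comes from \<open>E\<close> and lies in the closed commutator subgroup over \<open>D\<close>, then at a late stage a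
  lift \<open>v\<close> of \<open>u\<close> is close to a product \<open>c\<close> of commutators. The quotient \<open>vc\<^sup>*\<close> factors as \<open>gd\<close> with \<open>g\<close> close
  to \<open>1\<close>, so \<open>g\<^sup>*v\<close> is a lift close to \<open>u\<close> to which the injectivity at that stage applies.
\<close>

theorem limit_cl_comm_uni:
  assumes sysC: "limit_system C e D e' \<Phi> \<Psi> K" and sysH: "limit_system H f E f' \<Phi> \<Psi> K"
    and HC: "\<And>m. H m \<subseteq> C m" and span: "\<And>m. spans \<kappa> (H m) (C m)" and \<kappa>: "1 \<le> \<kappa>"
    and inj: "\<And>m. uni0 (H m) \<inter> cl_comm_uni (C m) \<subseteq> cl_comm_uni (H m)"
  shows "uni0 E \<inter> cl_comm_uni D \<subseteq> cl_comm_uni E"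
proof
  interpret C: limit_system C e D e' \<Phi> \<Psi> K by fact
  interpret H: limit_system H f E f' \<Phi> \<Psi> K by fact
  fix u assume "u \<in> uni0 E \<inter> cl_comm_uni D"
  then have uE: "u \<in> closure (H.images (\<lambda>m. uni0 (H m)))"
    and uD: "u \<in> closure (C.images (\<lambda>m. comm_uni (C m)))"
    using H.uni0_approx closure_minimal[OF C.comm_uni_approx closed_closure]
    unfolding cl_comm_uni_def by blast+
  define B where "B = norm u + 1"
  have B: "1 \<le> B" by (simp add: B_def)
  have K: "1 \<le> K" by (rule C.K)
  have pos: "0 < \<kappa>" "0 < K" "0 < B" using \<kappa> K B by auto
  have "u \<in> closure (cl_comm_uni E)"
    unfolding closure_approachable
  proof (intro allI impI)
    fix r :: real assume r: "0 < r"
    \<comment> \<open>The bound 1 makes \<open>B\<close> a bound for the lifts of \<open>u\<close>.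
      The second term makes \<open>factor_near_one\<close> applicable, with
      \<open>66000 = 3 * 22000\<close>. The third keeps the final error below \<open>r\<close>, with
      \<open>24 = 8 * 3\<close>.\<close>
    define \<eta> where "\<eta> = min 1 (min (1 / (66000 * \<kappa>\<^sup>2 * K * B)) (r / (2 * (24 * \<kappa> * K * B * B + 1))))"
    have "0 \<le> \<kappa> * K * B * B" using pos by simp
    then have den: "0 < 24 * \<kappa> * K * B * B + 1" by (simp add: mult.assoc)
    have \<eta>0: "\<eta> > 0" using r pos den by (simp add: \<eta>_def)
    have \<eta>1: "\<eta> \<le> 1" by (simp add: \<eta>_def)
    have "\<eta> \<le> 1 / (66000 * \<kappa>\<^sup>2 * K * B)" by (simp add: \<eta>_def)
    then have \<eta>2: "22000 * \<kappa>\<^sup>2 * (K * (3 * \<eta> * B)) \<le> 1" using pos by (simp add: field_simps)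
    have "\<eta> \<le> r / (2 * (24 * \<kappa> * K * B * B + 1))" by (simp add: \<eta>_def)
    then have "\<eta> * (2 * (24 * \<kappa> * K * B * B + 1)) \<le> r" using den by (subst (asm) pos_le_divide_eq) auto
    then have "8 * \<kappa> * (K * (3 * \<eta> * B)) * B + \<eta> \<le> r / 2" by (simp add: algebra_simps)
    then have \<eta>3: "8 * \<kappa> * (K * (3 * \<eta> * B)) * B + \<eta> < r" using r by linarith
    obtain k v1 where v1: "v1 \<in> uni0 (H k)" "norm (unitize (\<Psi> k) v1 - u) < \<eta>"
      using uE \<eta>0 unfolding closure_approachable H.images_def dist_norm by blast
    obtain k' c1 where c1: "c1 \<in> comm_uni (C k')" "norm (unitize (\<Psi> k') c1 - u) < \<eta>"
      using uD \<eta>0 unfolding closure_approachable C.images_def dist_norm by blast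
    define m where "m = max k k'"
    have km: "k \<le> m" "k' \<le> m" by (simp_all add: m_def)
    define v where "v = unitize (\<Phi> k m) v1"
    define c where "c = unitize (\<Phi> k' m) c1"
    have v: "v \<in> uni0 (H m)" and c: "c \<in> comm_uni (C m)"
      using H.push_uni0[OF km(1) v1(1)] C.push_comm_uni[OF km(2) c1(1)] by (simp_all add: v_def c_def)
    have vu: "norm (unitize (\<Psi> m) v - u) < \<eta>"
      using v1 H.unitize_compat[OF km(1)] uni0_subset unfolding v_def by (metis subsetD)
    have cu: "norm (unitize (\<Psi> m) c - u) < \<eta>"
      using c1 C.unitize_compat[OF km(2)] C.comm_uni_sub_uni unfolding c_def by (metis subsetD)
    have vC: "v \<in> uni (C m)" and cC: "c \<in> uni (C m)"
      using v c uni0_subset uni_mono[OF HC] C.comm_uni_sub_uni by blast+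
    interpret \<Psi>m: star_map "C m" "e m" D e' "\<Psi> m" by (rule C.\<Psi>)
    define w where "w = v * adj c"
    have w: "w \<in> uni (C m)" using vC cC by (simp add: w_def \<Psi>m.C.mult_uni \<Psi>m.C.adj_uni)
    let ?tv = "unitize (\<Psi> m) v" and ?tc = "unitize (\<Psi> m) c"
    have "\<Psi> m (w - 1) = unitize (\<Psi> m) w - 1" by (simp add: unitize_def)
    also have "unitize (\<Psi> m) w = ?tv * adj ?tc"
      using vC cC by (simp add: w_def \<Psi>m.unitize_mult \<Psi>m.unitize_adj \<Psi>m.C.adj_uni)
    also have "?tv * adj ?tc - 1 = (?tv - ?tc) * adj ?tc"
      using uni_adj_right[OF \<Psi>m.unitize_uni[OF cC]] by (simp add: left_diff_distrib)
    also have "norm \<dots> \<le> (2 * \<eta>) * B"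
    proof (rule order.trans[OF norm_mult_ineq], rule mult_mono)
      show "norm (?tv - ?tc) \<le> 2 * \<eta>"
        using norm_triangle_ineq4[of "?tv - u" "?tc - u"] vu cu by simp
      show "norm (adj ?tc) \<le> B"
        using norm_triangle_ineq[of "?tc - u" u] cu \<eta>1 by (simp add: B_def)
    qed (use \<eta>0 in auto)
    \<comment> \<open>\<open>norm_limit\<close> asks for a strict bound, hence 3 in place of
      2.\<close>
    also have "\<dots> < 3 * \<eta> * B" using \<eta>0 B by simp
    finally have "norm (\<Psi> m (w - 1)) < 3 * \<eta> * B" .
    then obtain l where l: "m \<le> l" "norm (\<Phi> m l (w - 1)) \<le> K * (3 * \<eta> * B)"
      using C.norm_limit[OF uni_diff[OF w]] by blast
    interpret \<Phi>: star_map "C m" "e m" "C l" "e l" "\<Phi> m l" by (rule C.\<Phi>[OF l(1)])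
    define z where "z = unitize (\<Phi> m l) w"
    have z: "z \<in> uni (C l)" unfolding z_def by (rule \<Phi>.unitize_uni[OF w])
    have nz: "norm (z - 1) \<le> K * (3 * \<eta> * B)" using l(2) by (simp add: z_def unitize_def)
    have "22000 * \<kappa>\<^sup>2 * norm (z - 1) \<le> 22000 * \<kappa>\<^sup>2 * (K * (3 * \<eta> * B))"
      using nz by (intro mult_left_mono) auto
    from order.trans[OF this \<eta>2] have "22000 * \<kappa>\<^sup>2 * norm (z - 1) \<le> 1" .
    then obtain g d where gd: "g \<in> uni0 (H l)" "d \<in> cl_comm_uni (C l)"
        "norm (g - 1) \<le> 8 * \<kappa> * norm (z - 1)" "z = g * d"
      by (rule star_subalgebra.factor_near_one[OF C.star_C H.star_C HC span \<kappa> z])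
    define v' where "v' = unitize (\<Phi> m l) v"
    define c' where "c' = unitize (\<Phi> m l) c"
    have v': "v' \<in> uni0 (H l)" and c': "c' \<in> comm_uni (C l)"
      using H.push_uni0[OF l(1) v] C.push_comm_uni[OF l(1) c] by (simp_all add: v'_def c'_def)
    have cl: "c' \<in> uni (C l)" unfolding c'_def by (rule \<Phi>.unitize_uni[OF cC])
    have gl: "g \<in> uni (C l)" "g \<in> uni (H l)" using gd(1) uni0_subset uni_mono[OF HC] by blast+
    have "z = v' * adj c'"
      using vC cC by (simp add: z_def w_def v'_def c'_def \<Phi>.unitize_mult \<Phi>.unitize_adj \<Psi>m.C.adj_uni)
    then have "v' = g * (d * c')"
      using gd(4) cl by (metis mult.assoc mult.right_neutral uni_adj_left)
    then have gv: "adj g * v' = d * c'" using uni_cancel(1)[OF gl(1)] by simp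
    have "adj g * v' \<in> uni0 (H l)"
      using star_subalgebra.mult_uni0[OF H.star_C star_subalgebra.adj_uni0[OF H.star_C gd(1)] v'] .
    moreover have "adj g * v' \<in> cl_comm_uni (C l)"
      unfolding gv using gd(2) c' star_subalgebra.comm_uni_sub_cl[OF C.star_C]
      by (intro star_subalgebra.mult_cl_comm_uni[OF C.star_C]) auto
    ultimately have "adj g * v' \<in> cl_comm_uni (H l)" using inj by blast
    interpret \<Psi>l: star_map "H l" "f l" E f' "\<Psi> l" by (rule H.\<Psi>)
    define y where "y = unitize (\<Psi> l) (adj g * v')"
    have yE: "y \<in> cl_comm_uni E"
      unfolding y_def by (rule \<Psi>l.unitize_cl_comm_uni) fact
    have "v' \<in> uni (H l)" using v' uni0_subset by blast
    moreover have "unitize (\<Psi> l) v' = ?tv"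
      using C.unitize_compat[OF l(1) vC] by (simp add: v'_def)
    ultimately have "y = adj (unitize (\<Psi> l) g) * ?tv"
      using gl by (simp add: y_def \<Psi>l.unitize_mult \<Psi>l.unitize_adj \<Psi>l.C.adj_uni)
    then have "y - u = adj (unitize (\<Psi> l) g - 1) * ?tv + (?tv - u)"
      by (simp add: adj_simps algebra_simps)
    also have "norm \<dots> \<le> norm (adj (unitize (\<Psi> l) g - 1)) * norm ?tv + norm (?tv - u)"
      by (intro order.trans[OF norm_triangle_ineq] add_mono norm_mult_ineq order.refl)
    also have "\<dots> \<le> 8 * \<kappa> * (K * (3 * \<eta> * B)) * B + \<eta>"
    proof (intro add_mono mult_mono)
      have "norm (unitize (\<Psi> l) g - 1) \<le> norm (g - 1)"
        using \<Psi>l.unitize_dist[OF gl(2) \<Psi>l.C.one_uni] by simp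
      also have "\<dots> \<le> 8 * \<kappa> * (K * (3 * \<eta> * B))"
        using nz \<kappa> by (intro order.trans[OF gd(3)] mult_left_mono) auto
      finally show "norm (adj (unitize (\<Psi> l) g - 1)) \<le> 8 * \<kappa> * (K * (3 * \<eta> * B))" by simp
      show "norm ?tv \<le> B"
        using norm_triangle_ineq[of "?tv - u" u] vu \<eta>1 by (simp add: B_def)
      show "norm (?tv - u) \<le> \<eta>" using vu by simp
      show "0 \<le> 8 * \<kappa> * (K * (3 * \<eta> * B))" using pos \<eta>0 by simp
    qed simp
    finally show "\<exists>y\<in>cl_comm_uni E. dist y u < r"
      using \<eta>3 yE by (intro bexI[of _ y]) (auto simp: dist_norm)
  qed
  then show "u \<in> cl_comm_uni E" by (simp add: cl_comm_uni_def)
qed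

section \<open>Infinite matrices\<close>

lemma adj_eq_0_iff [simp]: "adj x = 0 \<longleftrightarrow> (x::'a::star_algebra_1) = 0"
  by (metis adj_adj adj_zero)

text \<open>The sum runs over the support, so finite rows never lead to infinite series. An infinite
  support would give 0 by convention; \<open>bounded_rows\<close> excludes this case.\<close>

definition row_sum :: "(nat \<Rightarrow> nat \<Rightarrow> 'a::real_normed_vector) \<Rightarrow> nat \<Rightarrow> real" where
  "row_sum F i = (\<Sum>j | F i j \<noteq> 0. norm (F i j))"

definition bounded_rows :: "(nat \<Rightarrow> nat \<Rightarrow> 'a::real_normed_vector) \<Rightarrow> bool" where
  "bounded_rows F \<longleftrightarrow> (\<forall>i. finite {j. F i j \<noteq> 0}) \<and> (\<exists>b. \<forall>i. row_sum F i \<le> b)"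

definition mat_times ::
    "(nat \<Rightarrow> nat \<Rightarrow> 'a::real_normed_algebra) \<Rightarrow> (nat \<Rightarrow> nat \<Rightarrow> 'a) \<Rightarrow> nat \<Rightarrow> nat \<Rightarrow> 'a" where
  "mat_times F G i j = (\<Sum>k | F i k \<noteq> 0. F i k * G k j)"

lemma bounded_rowsD: "bounded_rows F \<Longrightarrow> finite {j. F i j \<noteq> 0}"
  by (simp add: bounded_rows_def)

lemma row_sum_expand:
  assumes "finite A" "{j. F i j \<noteq> 0} \<subseteq> A"
  shows "row_sum F i = (\<Sum>j\<in>A. norm (F i j))"
  unfolding row_sum_def using assms by (intro sum.mono_neutral_left) auto

lemma mat_times_expand:
  assumes "finite A" "{k. F i k \<noteq> 0} \<subseteq> A"
  shows "mat_times F G i j = (\<Sum>k\<in>A. F i k * G k j)"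
  unfolding mat_times_def using assms by (intro sum.mono_neutral_left) auto

lemma row_sum_nonneg: "0 \<le> row_sum F i"
  by (simp add: row_sum_def sum_nonneg)

lemma row_sum_mono:
  fixes F :: "nat \<Rightarrow> nat \<Rightarrow> 'a::real_normed_vector" and G :: "nat \<Rightarrow> nat \<Rightarrow> 'b::real_normed_vector"
  assumes "finite {j. G i j \<noteq> 0}" and le: "\<And>j. norm (F i j) \<le> norm (G i j)"
  shows "row_sum F i \<le> row_sum G i"
proof -
  have "F i j = 0" if "G i j = 0" for j using le[of j] that by simp
  then have "row_sum F i = (\<Sum>j | G i j \<noteq> 0. norm (F i j))"
    using assms(1) by (intro row_sum_expand) auto
  then show ?thesis unfolding row_sum_def using le by (simp add: sum_mono)
qed

lemma row_sum_add:
  assumes F: "finite {j. F i j \<noteq> 0}" and G: "finite {j. G i j \<noteq> 0}"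
  shows "row_sum (\<lambda>i j. F i j + G i j) i \<le> row_sum F i + row_sum G i"
proof -
  define A where "A = {j. F i j \<noteq> 0} \<union> {j. G i j \<noteq> 0}"
  have "row_sum (\<lambda>i j. F i j + G i j) i = (\<Sum>j\<in>A. norm (F i j + G i j))"
    "row_sum F i = (\<Sum>j\<in>A. norm (F i j))" "row_sum G i = (\<Sum>j\<in>A. norm (G i j))"
    using F G by (auto intro!: row_sum_expand simp: A_def)
  then show ?thesis by (simp add: norm_triangle_ineq sum_mono flip: sum.distrib)
qed

lemma bounded_rows_mono:
  fixes F :: "nat \<Rightarrow> nat \<Rightarrow> 'a::real_normed_vector" and G :: "nat \<Rightarrow> nat \<Rightarrow> 'b::real_normed_vector"
  assumes G: "bounded_rows G" and le: "\<And>i j. norm (F i j) \<le> c * norm (G i j)"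
  shows "bounded_rows F"
proof -
  obtain b where b: "\<And>i. row_sum G i \<le> b" using G by (auto simp: bounded_rows_def)
  have fin: "finite {j. G i j \<noteq> 0}" for i using G by (rule bounded_rowsD)
  have F0: "F i j = 0" if "G i j = 0" for i j using le[of i j] that by simp
  then have sub: "{j. F i j \<noteq> 0} \<subseteq> {j. G i j \<noteq> 0}" for i by auto
  have "row_sum F i \<le> \<bar>c\<bar> * b" for i
  proof -
    have "row_sum F i = (\<Sum>j | G i j \<noteq> 0. norm (F i j))"
      using fin sub by (rule row_sum_expand)
    also have "\<dots> \<le> (\<Sum>j | G i j \<noteq> 0. \<bar>c\<bar> * norm (G i j))"
      using le by (intro sum_mono order.trans[OF le] mult_right_mono) auto
    also have "\<dots> = \<bar>c\<bar> * row_sum G i" by (simp add: row_sum_def sum_distrib_left)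
    also have "\<dots> \<le> \<bar>c\<bar> * b" using b by (intro mult_left_mono) auto
    finally show ?thesis .
  qed
  then show ?thesis
    unfolding bounded_rows_def using finite_subset[OF sub fin] by blast
qed

lemma bounded_rows_add:
  assumes F: "bounded_rows F" and G: "bounded_rows G"
  shows "bounded_rows (\<lambda>i j. F i j + G i j)"
proof -
  obtain b c where b: "\<And>i. row_sum F i \<le> b" "\<And>i. row_sum G i \<le> c"
    using F G unfolding bounded_rows_def by blast
  have fin: "finite {j. F i j \<noteq> 0}" "finite {j. G i j \<noteq> 0}" for i
    using F G by (auto simp: bounded_rows_def)
  have "finite {j. F i j + G i j \<noteq> 0}" for i
    by (rule finite_subset[OF _ finite_UnI[OF fin[of i]]]) auto
  moreover have "row_sum (\<lambda>i j. F i j + G i j) i \<le> b + c" for i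
    using row_sum_add[of F i G] fin b[of i] add_mono order.trans by blast
  ultimately show ?thesis unfolding bounded_rows_def by blast
qed

lemma row_sum_mat_times:
  assumes F: "bounded_rows F" and G: "bounded_rows G" and b: "\<And>i. row_sum G i \<le> b"
  shows "row_sum (mat_times F G) i \<le> row_sum F i * b" "finite {j. mat_times F G i j \<noteq> 0}"
proof -
  define A where "A = {k. F i k \<noteq> 0}"
  define B where "B = (\<Union>k\<in>A. {j. G k j \<noteq> 0})"
  have fin: "finite A" "finite B"
    using F G by (auto simp: A_def B_def bounded_rows_def)
  have sub: "{j. mat_times F G i j \<noteq> 0} \<subseteq> B"
  proof
    fix j assume "j \<in> {j. mat_times F G i j \<noteq> 0}"
    then obtain k where "k \<in> A" "F i k * G k j \<noteq> 0"
      unfolding mat_times_def A_def by (metis (mono_tags, lifting) mem_Collect_eq sum.neutral)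
    then have "G k j \<noteq> 0" by auto
    then show "j \<in> B" using \<open>k \<in> A\<close> by (auto simp: B_def)
  qed
  show "finite {j. mat_times F G i j \<noteq> 0}" using sub fin(2) by (rule finite_subset)
  have "row_sum (mat_times F G) i = (\<Sum>j\<in>B. norm (\<Sum>k\<in>A. F i k * G k j))"
    using row_sum_expand[of B "mat_times F G" i] fin(2) sub by (simp add: mat_times_def A_def)
  also have "\<dots> \<le> (\<Sum>j\<in>B. \<Sum>k\<in>A. norm (F i k) * norm (G k j))"
    by (intro sum_mono sum_norm_le norm_mult_ineq)
  also have "\<dots> = (\<Sum>k\<in>A. norm (F i k) * (\<Sum>j\<in>B. norm (G k j)))"
    by (subst sum.swap) (simp add: sum_distrib_left)
  also have "\<dots> = (\<Sum>k\<in>A. norm (F i k) * row_sum G k)"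
    using fin by (intro sum.cong refl arg_cong2[where f = "(*)"] row_sum_expand[symmetric])
      (auto simp: B_def)
  also have "\<dots> \<le> (\<Sum>k\<in>A. norm (F i k) * b)"
    using b by (intro sum_mono mult_left_mono) auto
  also have "\<dots> = row_sum F i * b" by (simp add: row_sum_def A_def sum_distrib_right)
  finally show "row_sum (mat_times F G) i \<le> row_sum F i * b" .
qed

lemma bounded_rows_mat_times:
  assumes F: "bounded_rows F" and G: "bounded_rows G"
  shows "bounded_rows (mat_times F G)"
proof -
  obtain b c where b: "\<And>i. row_sum F i \<le> b" "\<And>i. row_sum G i \<le> c"
    using F G unfolding bounded_rows_def by blast
  have "0 \<le> c" using row_sum_nonneg[of G 0] b(2)[of 0] by simp
  then have "row_sum (mat_times F G) i \<le> b * c" for i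
    using row_sum_mat_times(1)[OF F G b(2), of i] mult_right_mono[OF b(1)[of i], of c] by linarith
  then show ?thesis
    unfolding bounded_rows_def using row_sum_mat_times(2)[OF F G b(2)] by blast
qed

lemma adj_mat_times:
  assumes "finite {k. F i k \<noteq> 0}" "finite {k. G k j \<noteq> 0}"
  shows "adj (mat_times F G i j) = mat_times (\<lambda>i j. adj (G j i)) (\<lambda>i j. adj (F j i)) j i"
proof -
  define A where "A = {k. F i k \<noteq> 0} \<union> {k. G k j \<noteq> 0}"
  have "mat_times F G i j = (\<Sum>k\<in>A. F i k * G k j)"
    using assms by (intro mat_times_expand) (auto simp: A_def)
  moreover have "mat_times (\<lambda>i j. adj (G j i)) (\<lambda>i j. adj (F j i)) j i
      = (\<Sum>k\<in>A. adj (G k j) * adj (F i k))"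
    using assms by (intro mat_times_expand) (auto simp: A_def)
  ultimately show ?thesis by (simp add: adj_sum adj_mult)
qed

lemma mat_times_assoc:
  assumes F: "bounded_rows F" and G: "bounded_rows G"
  shows "mat_times (mat_times F G) H i j = mat_times F (mat_times G H) i j"
proof -
  define A where "A = {k. F i k \<noteq> 0}"
  define B where "B = {l. mat_times F G i l \<noteq> 0} \<union> (\<Union>k\<in>A. {l. G k l \<noteq> 0})"
  have fin: "finite A" "finite B"
    using F G bounded_rows_mat_times[OF F G] by (auto simp: A_def B_def bounded_rows_def)
  have "mat_times (mat_times F G) H i j = (\<Sum>l\<in>B. (\<Sum>k\<in>A. F i k * G k l) * H l j)"
    using fin by (subst mat_times_expand[of B]) (auto simp: B_def A_def mat_times_def)
  also have "\<dots> = (\<Sum>k\<in>A. F i k * (\<Sum>l\<in>B. G k l * H l j))"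
    unfolding sum_distrib_left sum_distrib_right by (subst sum.swap) (simp add: mult.assoc)
  also have "\<dots> = (\<Sum>k\<in>A. F i k * mat_times G H k j)"
    using fin by (intro sum.cong refl arg_cong2[where f = "(*)"] mat_times_expand[symmetric])
      (auto simp: B_def)
  also have "\<dots> = mat_times F (mat_times G H) i j"
    by (simp add: mat_times_def A_def)
  finally show ?thesis .
qed

text \<open>
  Matrices with finite rows and columns and with bounded row and column sums. All the \<open>M\<^sub>n(C)\<close>
  live in this algebra, \<open>M\<^sub>m(C)\<close> being a corner of \<open>M\<^sub>n(C)\<close> for \<open>m \<le> n\<close>.
\<close>

typedef (overloaded) 'a imat = "{F :: nat \<Rightarrow> nat \<Rightarrow> 'a::real_normed_vector.
    bounded_rows F \<and> bounded_rows (\<lambda>i j. F j i)}"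
  morphisms entry Abs_imat
proof -
  have "bounded_rows (\<lambda>(i::nat) (j::nat). 0 :: 'a)"
    by (auto simp: bounded_rows_def row_sum_def)
  then show ?thesis by blast
qed

setup_lifting type_definition_imat

lemma imat_eqI: "(\<And>i j. entry S i j = entry T i j) \<Longrightarrow> S = T"
  by (metis entry_inject ext)

lemma entry_rows: "bounded_rows (entry T)"
  and entry_cols: "bounded_rows (\<lambda>i j. entry T j i)"
  using entry[of T] by auto

lemma finite_entry: "finite {j. entry T i j \<noteq> 0}" "finite {i. entry T i j \<noteq> 0}"
  using bounded_rowsD[OF entry_rows] bounded_rowsD[OF entry_cols] by fastforce+

instantiation imat :: (star_algebra_1) star_algebra_1
begin

lift_definition zero_imat :: "'a imat" is "\<lambda>i j. 0"
  by (auto simp: bounded_rows_def row_sum_def)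

lift_definition one_imat :: "'a imat" is "\<lambda>i j. if i = j then 1 else 0"
proof -
  have "bounded_rows (\<lambda>i j. if i = j then (1::'a) else 0)"
    unfolding bounded_rows_def row_sum_def by (auto intro!: exI[of _ 1])
  moreover have "(\<lambda>i j. if j = i then (1::'a) else 0) = (\<lambda>(i::nat) j. if i = j then 1 else 0)"
    by (auto simp: fun_eq_iff)
  ultimately show "bounded_rows (\<lambda>i j. if i = j then (1::'a) else 0) \<and>
      bounded_rows (\<lambda>i j. if j = i then (1::'a) else 0)" by simp
qed

lift_definition plus_imat :: "'a imat \<Rightarrow> 'a imat \<Rightarrow> 'a imat" is "\<lambda>F G i j. F i j + G i j"
  by (simp add: bounded_rows_add)

lift_definition scaleR_imat :: "real \<Rightarrow> 'a imat \<Rightarrow> 'a imat" is "\<lambda>r F i j. r *\<^sub>R F i j"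
  by (auto intro: bounded_rows_mono)

lift_definition uminus_imat :: "'a imat \<Rightarrow> 'a imat" is "\<lambda>F i j. - F i j"
  by (auto intro: bounded_rows_mono[where c = 1])

lift_definition adj_imat :: "'a imat \<Rightarrow> 'a imat" is "\<lambda>F i j. adj (F j i)"
  by (auto intro: bounded_rows_mono[where c = 1])

lift_definition itimes_imat :: "'a imat \<Rightarrow> 'a imat" is "\<lambda>F i j. itimes (F i j)"
  by (auto intro: bounded_rows_mono[where c = 1])

lift_definition times_imat :: "'a imat \<Rightarrow> 'a imat \<Rightarrow> 'a imat" is mat_times
proof -
  fix F G :: "nat \<Rightarrow> nat \<Rightarrow> 'a"
  assume F: "bounded_rows F \<and> bounded_rows (\<lambda>i j. F j i)"
    and G: "bounded_rows G \<and> bounded_rows (\<lambda>i j. G j i)"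
  have F': "bounded_rows (\<lambda>i j. adj (F j i))" and G': "bounded_rows (\<lambda>i j. adj (G j i))"
    using F G by (auto intro: bounded_rows_mono[where c = 1])
  have "finite {k. F i k \<noteq> 0}" "finite {k. G k j \<noteq> 0}" for i j
    using F G bounded_rowsD by fastforce+
  \<comment> \<open>The columns of the product are, up to \<open>adj\<close>, the rows of the
    product of the adjoints in reverse order, so the row bound applies to them.\<close>
  then have "norm (mat_times F G j i)
      \<le> 1 * norm (mat_times (\<lambda>i j. adj (G j i)) (\<lambda>i j. adj (F j i)) i j)" for i j
    by (subst adj_mat_times[symmetric]) simp_all
  then have "bounded_rows (\<lambda>i j. mat_times F G j i)"
    by (rule bounded_rows_mono[OF bounded_rows_mat_times[OF G' F']])
  then show "bounded_rows (mat_times F G) \<and> bounded_rows (\<lambda>i j. mat_times F G j i)"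
    using F G bounded_rows_mat_times by blast
qed

definition minus_imat :: "'a imat \<Rightarrow> 'a imat \<Rightarrow> 'a imat" where
  "minus_imat S T = S + (- T)"

text \<open>Either half is submultiplicative by itself; the maximum of row and column sums makes the
  adjoint isometric.\<close>

definition norm_imat :: "'a imat \<Rightarrow> real" where
  "norm_imat T = (SUP i. max (row_sum (entry T) i) (row_sum (\<lambda>i j. entry T j i) i))"

definition sgn_imat :: "'a imat \<Rightarrow> 'a imat" where
  "sgn_imat T = scaleR (inverse (norm T)) T"

definition dist_imat :: "'a imat \<Rightarrow> 'a imat \<Rightarrow> real" where
  "dist_imat S T = norm (S - T)"

definition uniformity_imat :: "('a imat \<times> 'a imat) filter" where
  "uniformity_imat = (INF e\<in>{0<..}. principal {(x, y). dist x y < e})"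

definition open_imat :: "'a imat set \<Rightarrow> bool" where
  "open_imat U \<longleftrightarrow> (\<forall>x\<in>U. \<forall>\<^sub>F (x', y) in uniformity. x' = x \<longrightarrow> y \<in> U)"

lemma row_sum_le_norm: "row_sum (entry T) i \<le> norm T" "row_sum (\<lambda>i j. entry T j i) i \<le> norm T"
  for T :: "'a imat"
proof -
  obtain b c where "\<And>i. row_sum (entry T) i \<le> b" "\<And>i. row_sum (\<lambda>i j. entry T j i) i \<le> c"
    using entry_rows[of T] entry_cols[of T] unfolding bounded_rows_def by blast
  then have "bdd_above (range (\<lambda>i. max (row_sum (entry T) i) (row_sum (\<lambda>i j. entry T j i) i)))"
    by (intro bdd_aboveI[of _ "max b c"]) (auto intro: max.mono)
  then have "max (row_sum (entry T) i) (row_sum (\<lambda>i j. entry T j i) i) \<le> norm T"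
    unfolding norm_imat_def by (intro cSUP_upper) auto
  then show "row_sum (entry T) i \<le> norm T" "row_sum (\<lambda>i j. entry T j i) i \<le> norm T" by simp_all
qed

lemma norm_imat_le:
  fixes T :: "'a imat"
  assumes "\<And>i. row_sum (entry T) i \<le> b" "\<And>i. row_sum (\<lambda>i j. entry T j i) i \<le> b"
  shows "norm T \<le> b"
  unfolding norm_imat_def using assms by (intro cSUP_least) auto

lemma norm_adj_imat: "norm (adj T) = norm T" for T :: "'a imat"
proof -
  have "row_sum (\<lambda>i j. adj (F i j)) i = row_sum F i" for F :: "nat \<Rightarrow> nat \<Rightarrow> 'a" and i
    by (simp add: row_sum_def)
  then show ?thesis by (simp add: norm_imat_def adj_imat.rep_eq max.commute)
qed

lemma adj_times_imat: "adj (S * T) = adj T * adj S" for S T :: "'a imat"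
  by (rule imat_eqI)
    (simp add: adj_imat.rep_eq times_imat.rep_eq adj_mat_times finite_entry)

lemma norm_times_imat: "norm (S * T) \<le> norm S * norm T" for S T :: "'a imat"
proof (rule norm_imat_le)
  have *: "row_sum (entry (S * T)) i \<le> norm S * norm T" for S T :: "'a imat" and i
  proof -
    have "0 \<le> norm T" using row_sum_nonneg row_sum_le_norm(1)[of T 0] order.trans by blast
    then show ?thesis
      using row_sum_mat_times(1)[OF entry_rows entry_rows row_sum_le_norm(1), of S T i]
        mult_right_mono[OF row_sum_le_norm(1)[of S i], of "norm T"]
      by (simp add: times_imat.rep_eq)
  qed
  then show "row_sum (entry (S * T)) i \<le> norm S * norm T" for i .
  have "row_sum (\<lambda>i j. entry (S * T) j i) i = row_sum (entry (adj (S * T))) i" for i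
    by (simp add: row_sum_def adj_imat.rep_eq)
  then show "row_sum (\<lambda>i j. entry (S * T) j i) i \<le> norm S * norm T" for i
    using *[of "adj T" "adj S" i] by (simp add: adj_times_imat norm_adj_imat mult.commute)
qed

lemma mat_times_add_left:
  assumes "bounded_rows F" "bounded_rows G"
  shows "mat_times (\<lambda>i j. F i j + G i j) H i j = mat_times F H i j + mat_times G H i j"
proof -
  define A where "A = {k. F i k \<noteq> 0} \<union> {k. G i k \<noteq> 0}"
  have "finite A" using assms by (simp add: A_def bounded_rows_def)
  then have "mat_times (\<lambda>i j. F i j + G i j) H i j = (\<Sum>k\<in>A. (F i k + G i k) * H k j)"
    "mat_times F H i j = (\<Sum>k\<in>A. F i k * H k j)" "mat_times G H i j = (\<Sum>k\<in>A. G i k * H k j)"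
    by (auto intro!: mat_times_expand simp: A_def)
  then show ?thesis by (simp add: distrib_right sum.distrib)
qed

lemma mat_times_one:
  "mat_times (\<lambda>i j. if i = j then 1 else 0) F i j = F i j"
  "finite {k. F i k \<noteq> 0} \<Longrightarrow> mat_times F (\<lambda>i j. if i = j then 1 else 0) i j = F i j"
  for F :: "nat \<Rightarrow> nat \<Rightarrow> 'a"
proof -
  have "mat_times (\<lambda>i j. if i = j then 1 else 0) F i j = (\<Sum>k\<in>{i}. (if i = k then 1 else 0) * F k j)"
    by (rule mat_times_expand) auto
  then show "mat_times (\<lambda>i j. if i = j then 1 else 0) F i j = F i j" by simp
  assume fin: "finite {k. F i k \<noteq> 0}"
  have "mat_times F (\<lambda>i j. if i = j then 1 else 0) i j
      = (\<Sum>k\<in>insert j {k. F i k \<noteq> 0}. F i k * (if k = j then 1 else 0))"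
    using fin by (intro mat_times_expand) auto
  also have "\<dots> = (\<Sum>k\<in>insert j {k. F i k \<noteq> 0}. if k = j then F i k else 0)"
    by (intro sum.cong) auto
  also have "\<dots> = F i j" using fin by (subst sum.delta) auto
  finally show "mat_times F (\<lambda>i j. if i = j then 1 else 0) i j = F i j" .
qed

instance
proof
  fix a b c :: "'a imat" and r s :: real
  note rep = plus_imat.rep_eq zero_imat.rep_eq uminus_imat.rep_eq scaleR_imat.rep_eq
    times_imat.rep_eq one_imat.rep_eq adj_imat.rep_eq itimes_imat.rep_eq
  show "a + b + c = a + (b + c)" "a + b = b + a" "0 + a = a" "- a + a = 0"
    by (auto intro!: imat_eqI simp: rep add.assoc add.commute)
  show "a - b = a + - b" by (rule minus_imat_def)
  show "r *\<^sub>R (a + b) = r *\<^sub>R a + r *\<^sub>R b" "(r + s) *\<^sub>R a = r *\<^sub>R a + s *\<^sub>R a"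
    "r *\<^sub>R s *\<^sub>R a = (r * s) *\<^sub>R a" "1 *\<^sub>R a = a"
    by (auto intro!: imat_eqI simp: rep algebra_simps)
  show "a * b * c = a * (b * c)"
    by (rule imat_eqI) (simp add: rep mat_times_assoc entry_rows)
  show "(a + b) * c = a * c + b * c"
    by (rule imat_eqI) (simp add: rep mat_times_add_left entry_rows)
  show "a * (b + c) = a * b + a * c"
    by (rule imat_eqI) (simp add: rep mat_times_def distrib_left sum.distrib)
  show "r *\<^sub>R a * b = r *\<^sub>R (a * b)"
  proof (rule imat_eqI)
    fix i j
    have "mat_times (\<lambda>i j. r *\<^sub>R entry a i j) (entry b) i j
        = (\<Sum>k | entry a i k \<noteq> 0. (r *\<^sub>R entry a i k) * entry b k j)"
      by (rule mat_times_expand) (auto simp: finite_entry)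
    then show "entry (r *\<^sub>R a * b) i j = entry (r *\<^sub>R (a * b)) i j"
      by (simp add: rep mat_times_def scaleR_sum_right)
  qed
  show "a * r *\<^sub>R b = r *\<^sub>R (a * b)"
    by (rule imat_eqI) (simp add: rep mat_times_def scaleR_sum_right)
  show "1 * a = a" "a * 1 = a"
    by (auto intro!: imat_eqI simp: rep mat_times_one finite_entry)
  have "entry (0::'a imat) 0 0 \<noteq> entry (1::'a imat) 0 0" by (simp add: rep)
  then show "(0::'a imat) \<noteq> 1" by metis
  show "dist a b = norm (a - b)" by (simp add: dist_imat_def)
  show "sgn a = inverse (norm a) *\<^sub>R a" by (simp add: sgn_imat_def)
  show "uniformity = (INF e\<in>{0<..}. principal {(x, y). dist x (y::'a imat) < e})"
    by (simp add: uniformity_imat_def)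
  show "open U = (\<forall>x\<in>U. \<forall>\<^sub>F (x', y) in uniformity. x' = x \<longrightarrow> y \<in> U)" for U :: "'a imat set"
    by (simp add: open_imat_def)
  show "norm a = 0 \<longleftrightarrow> a = 0"
  proof
    assume a: "norm a = 0"
    show "a = 0"
    proof (rule imat_eqI)
      fix i j
      have "norm (entry a i j) \<le> row_sum (entry a) i" if "entry a i j \<noteq> 0"
        unfolding row_sum_def using that by (intro member_le_sum) (auto simp: finite_entry)
      then have "norm (entry a i j) \<le> 0" if "entry a i j \<noteq> 0"
        using row_sum_le_norm(1)[of a i] a that by linarith
      then show "entry a i j = entry 0 i j" by (auto simp: rep)
    qed
  next
    assume "a = 0"
    then show "norm a = 0" by (simp add: norm_imat_def rep row_sum_def)
  qed
  show "norm (a + b) \<le> norm a + norm b"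
  proof (rule norm_imat_le)
    fix i
    show "row_sum (entry (a + b)) i \<le> norm a + norm b"
      using row_sum_add[of "entry a" i "entry b"] row_sum_le_norm(1)[of a i] row_sum_le_norm(1)[of b i]
      by (simp add: rep finite_entry)
    show "row_sum (\<lambda>i j. entry (a + b) j i) i \<le> norm a + norm b"
      using row_sum_add[of "\<lambda>i j. entry a j i" i "\<lambda>i j. entry b j i"]
        row_sum_le_norm(2)[of a i] row_sum_le_norm(2)[of b i]
      by (simp add: rep finite_entry)
  qed
  have scale: "norm (r *\<^sub>R a) \<le> \<bar>r\<bar> * norm a" for r and a :: "'a imat"
  proof -
    have *: "row_sum (\<lambda>i j. r *\<^sub>R F i j) i = \<bar>r\<bar> * row_sum F i"
      if "finite {j. F i j \<noteq> 0}" for F :: "nat \<Rightarrow> nat \<Rightarrow> 'a" and i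
      using row_sum_expand[OF that, of "\<lambda>i j. r *\<^sub>R F i j" i]
      by (simp add: row_sum_def sum_distrib_left subset_iff)
    show ?thesis
      by (rule norm_imat_le)
        (simp_all add: rep * finite_entry row_sum_le_norm mult_left_mono)
  qed
  show "norm (r *\<^sub>R a) = \<bar>r\<bar> * norm a"
  proof (cases "r = 0")
    case True
    have "norm ((0::real) *\<^sub>R a) = 0"
      by (simp add: norm_imat_def rep row_sum_def)
    then show ?thesis using True by simp
  next
    case False
    have "(1/r) *\<^sub>R r *\<^sub>R a = a" using False by (intro imat_eqI) (simp add: rep)
    then have "norm a \<le> \<bar>1/r\<bar> * norm (r *\<^sub>R a)" using scale[of "1/r" "r *\<^sub>R a"] by simp
    then have "\<bar>r\<bar> * norm a \<le> norm (r *\<^sub>R a)" using False by (simp add: field_simps)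
    then show ?thesis using scale[of r a] by simp
  qed
  show "norm (a * b) \<le> norm a * norm b" by (rule norm_times_imat)
  have "row_sum (\<lambda>i j. if i = j then (1::'a) else 0) i = 1"
    "row_sum (\<lambda>i j. if j = i then (1::'a) else 0) i = 1" for i :: nat
    by (simp_all add: row_sum_def)
  then show "norm (1::'a imat) = 1" by (simp add: norm_imat_def rep)
  show "adj (a + b) = adj a + adj b" "adj (adj a) = a" "adj (r *\<^sub>R a) = r *\<^sub>R adj a"
    by (auto intro!: imat_eqI simp: rep adj_add adj_scaleR)
  show "adj (a * b) = adj b * adj a" by (rule adj_times_imat)
  show "norm (adj a) = norm a" by (rule norm_adj_imat)
  have i0: "itimes x = 0 \<longleftrightarrow> x = 0" for x :: 'a
    by (metis norm_itimes norm_eq_zero)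
  show "itimes (a + b) = itimes a + itimes b" "itimes (r *\<^sub>R a) = r *\<^sub>R itimes a"
    "itimes (itimes a) = - a" "adj (itimes a) = - itimes (adj a)"
    by (auto intro!: imat_eqI simp: rep itimes_simps adj_itimes)
  have isum: "itimes (sum f A) = (\<Sum>i\<in>A. itimes (f i))" for f :: "nat \<Rightarrow> 'a" and A
    using i0[of 0] by (induction A rule: infinite_finite_induct) (simp_all add: itimes_add)
  show "itimes a * b = itimes (a * b)" "a * itimes b = itimes (a * b)"
    by (auto intro!: imat_eqI simp: rep mat_times_def i0 isum itimes_mult_left itimes_mult_right)
  show "norm (itimes a) = norm a"
    by (simp add: norm_imat_def rep row_sum_def i0)
qed

end

lemmas entry_simps = plus_imat.rep_eq zero_imat.rep_eq uminus_imat.rep_eq scaleR_imat.rep_eq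
  one_imat.rep_eq adj_imat.rep_eq itimes_imat.rep_eq

lemma entry_diff [simp]: "entry (S - T) i j = entry S i j - entry T i j"
  by (simp only: minus_imat_def plus_imat.rep_eq uminus_imat.rep_eq) simp

text \<open>The norm depends monotonically on the norms of the entries. For this reason entrywise
  contractions are contractive, without any notion of complete contractivity.\<close>

lemma norm_imat_mono:
  fixes S :: "'a::star_algebra_1 imat" and T :: "'b::star_algebra_1 imat"
  assumes "\<And>i j. norm (entry S i j) \<le> norm (entry T i j)"
  shows "norm S \<le> norm T"
proof (rule norm_imat_le)
  fix i
  show "row_sum (entry S) i \<le> norm T"
    by (rule order.trans[OF row_sum_mono row_sum_le_norm(1)]) (simp_all add: finite_entry assms)
  show "row_sum (\<lambda>i j. entry S j i) i \<le> norm T"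
    by (rule order.trans[OF row_sum_mono row_sum_le_norm(2)]) (simp_all add: finite_entry assms)
qed

lemma norm_entry_le: "norm (entry T i j) \<le> norm (T :: 'a::star_algebra_1 imat)"
proof (cases "entry T i j = 0")
  case False
  then have "norm (entry T i j) \<le> row_sum (entry T) i"
    unfolding row_sum_def by (intro member_le_sum) (auto simp: finite_entry)
  then show ?thesis using row_sum_le_norm(1)[of T i] by simp
qed simp

section \<open>Matrix algebras over a star subalgebra\<close>

definition mat_over :: "nat \<Rightarrow> 'a::star_algebra_1 set \<Rightarrow> 'a imat set" where
  "mat_over n C = {T. \<forall>i j. if i < n \<and> j < n then entry T i j \<in> C else entry T i j = 0}"

definition mk_mat :: "nat \<Rightarrow> (nat \<Rightarrow> nat \<Rightarrow> 'a::star_algebra_1) \<Rightarrow> 'a imat" where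
  "mk_mat n f = Abs_imat (\<lambda>i j. if i < n \<and> j < n then f i j else 0)"

lemma bounded_rows_corner: "bounded_rows (\<lambda>i j. if i < n \<and> j < n then f i j else (0::'a::star_algebra_1))"
proof -
  let ?F = "\<lambda>i j. if i < n \<and> j < n then f i j else (0::'a)"
  have sub: "{j. ?F i j \<noteq> 0} \<subseteq> {..<n}" for i by (auto split: if_splits)
  have "row_sum ?F i \<le> (\<Sum>i<n. \<Sum>j<n. norm (f i j))" for i
  proof -
    have "row_sum ?F i = (\<Sum>j<n. norm (?F i j))"
      using sub by (intro row_sum_expand) auto
    also have "\<dots> \<le> (\<Sum>i<n. \<Sum>j<n. norm (f i j))"
    proof (cases "i < n")
      case True
      then have "(\<Sum>j<n. norm (?F i j)) = (\<Sum>j<n. norm (f i j))" by simp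
      also have "\<dots> \<le> (\<Sum>i<n. \<Sum>j<n. norm (f i j))"
        using True by (intro member_le_sum[of i "{..<n}" "\<lambda>i. \<Sum>j<n. norm (f i j)"]) (auto intro: sum_nonneg)
      finally show ?thesis .
    qed (simp add: sum_nonneg)
    finally show ?thesis .
  qed
  then show ?thesis
    unfolding bounded_rows_def using finite_subset[OF sub] by blast
qed

lemma entry_mk_mat [simp]: "entry (mk_mat n f) i j = (if i < n \<and> j < n then f i j else 0)"
proof -
  have "bounded_rows (\<lambda>i j. if j < n \<and> i < n then f j i else 0)"
    using bounded_rows_corner[of n "\<lambda>i j. f j i"] by (simp add: conj_commute)
  then show ?thesis
    unfolding mk_mat_def by (subst Abs_imat_inverse) (auto simp: bounded_rows_corner)
qed

lemma mat_over_entry: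
  assumes "T \<in> mat_over n C"
  shows "\<lbrakk>i < n; j < n\<rbrakk> \<Longrightarrow> entry T i j \<in> C" "\<not> (i < n \<and> j < n) \<Longrightarrow> entry T i j = 0"
  using assms unfolding mat_over_def by (auto split: if_splits)

lemma mk_mat_over: "(\<And>i j. \<lbrakk>i < n; j < n\<rbrakk> \<Longrightarrow> f i j \<in> C) \<Longrightarrow> mk_mat n f \<in> mat_over n C"
  by (auto simp: mat_over_def)

lemma mat_over_eqI:
  assumes "S \<in> mat_over n C" "T \<in> mat_over n D"
    and "\<And>i j. \<lbrakk>i < n; j < n\<rbrakk> \<Longrightarrow> entry S i j = entry T i j"
  shows "S = T"
  using assms mat_over_entry(2) by (metis imat_eqI)

lemma entry_times:
  assumes "T \<in> mat_over n C"
  shows "entry (T * S) i j = (\<Sum>k<n. entry T i k * entry S k j)"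
  unfolding times_imat.rep_eq
  using mat_over_entry(2)[OF assms] by (intro mat_times_expand) (auto simp: not_less intro: leI)

lemma entry_times_right:
  assumes "S \<in> mat_over n C"
  shows "entry (T * S) i j = (\<Sum>k<n. entry T i k * entry S k j)"
proof -
  define A where "A = {k. entry T i k \<noteq> 0} \<union> {..<n}"
  have "entry (T * S) i j = (\<Sum>k\<in>A. entry T i k * entry S k j)"
    unfolding times_imat.rep_eq by (intro mat_times_expand) (auto simp: A_def finite_entry)
  also have "\<dots> = (\<Sum>k<n. entry T i k * entry S k j)"
    using mat_over_entry(2)[OF assms] by (intro sum.mono_neutral_right) (auto simp: A_def finite_entry)
  finally show ?thesis .
qed

lemma norm_mat_over_le:
  assumes "T \<in> mat_over n C"
  shows "norm T \<le> (\<Sum>i<n. \<Sum>j<n. norm (entry T i j))"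
proof (rule norm_imat_le)
  fix i
  let ?s = "\<Sum>i<n. \<Sum>j<n. norm (entry T i j)"
  have z: "entry T i j = 0" if "\<not> (i < n \<and> j < n)" for i j using mat_over_entry(2)[OF assms that] .
  have "row_sum (entry T) i = (\<Sum>j<n. norm (entry T i j))"
    using z by (intro row_sum_expand) (auto intro: leI)
  also have "\<dots> \<le> ?s"
  proof (cases "i < n")
    case True
    then show ?thesis
      by (intro member_le_sum[of i "{..<n}" "\<lambda>i. \<Sum>j<n. norm (entry T i j)"]) (auto intro: sum_nonneg)
  qed (use z in \<open>simp add: sum_nonneg\<close>)
  finally show "row_sum (entry T) i \<le> ?s" .
  have "row_sum (\<lambda>i j. entry T j i) i = (\<Sum>j<n. norm (entry T j i))"
    using z by (intro row_sum_expand) (auto intro: leI)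
  also have "\<dots> \<le> ?s"
  proof (cases "i < n")
    case True
    then show ?thesis
      by (subst sum.swap)
        (intro member_le_sum[of i "{..<n}" "\<lambda>j. \<Sum>i<n. norm (entry T i j)"], auto intro: sum_nonneg)
  qed (use z in \<open>simp add: sum_nonneg\<close>)
  finally show "row_sum (\<lambda>i j. entry T j i) i \<le> ?s" .
qed

text \<open>\<open>T\<close> has at most one nonzero entry in each row and each column. This covers
  the units of the matrix algebras and the signed permutations below.\<close>

lemma norm_monomial_le:
  assumes "\<And>i j. entry T i j \<noteq> 0 \<Longrightarrow> j = \<sigma> i \<and> i = \<sigma> j" "\<And>i j. norm (entry T i j) \<le> 1"
  shows "norm (T :: 'a::star_algebra_1 imat) \<le> 1"
proof (rule norm_imat_le)
  fix i
  have "row_sum (entry T) i = (\<Sum>j\<in>{\<sigma> i}. norm (entry T i j))"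
    using assms(1) by (intro row_sum_expand) auto
  then show "row_sum (entry T) i \<le> 1" using assms(2) by simp
  have "row_sum (\<lambda>i j. entry T j i) i = (\<Sum>j\<in>{\<sigma> i}. norm (entry T j i))"
    using assms(1) by (intro row_sum_expand) auto
  then show "row_sum (\<lambda>i j. entry T j i) i \<le> 1" using assms(2) by simp
qed

definition unit_mat :: "nat \<Rightarrow> 'a::star_algebra_1 \<Rightarrow> 'a imat" where
  "unit_mat n e = mk_mat n (\<lambda>i j. if i = j then e else 0)"

lemma entry_sum: "entry (sum f A) i j = (\<Sum>x\<in>A. entry (f x :: 'a::star_algebra_1 imat) i j)"
  by (induction A rule: infinite_finite_induct) (simp_all add: entry_simps)

context star_subalgebra
begin

lemma mat_over_star_subalgebra: "star_subalgebra (mat_over n C) (unit_mat n e)"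
proof
  note m = mat_over_entry
  fix S T :: "'a imat" and r :: real
  assume S: "S \<in> mat_over n C"
  show "r *\<^sub>R S \<in> mat_over n C" "adj S \<in> mat_over n C" "itimes S \<in> mat_over n C"
    using m[OF S] itimes_closed[OF zero_closed] itimes_scaleR[of 0 "0::'a"]
    by (auto simp: mat_over_def entry_simps intro!: closed_rules)
  have SC: "entry S i j \<in> C" for i j
    using m[OF S, of i j] zero_closed by metis
  show "unit_mat n e * S = S"
  proof (rule imat_eqI)
    fix i j
    have "entry (unit_mat n e * S) i j = (\<Sum>k<n. if k = i then entry S k j else 0)"
      unfolding entry_times_right[OF S] using m(2)[OF S] SC
      by (intro sum.cong refl) (auto simp: unit_mat_def unit_left)
    also have "\<dots> = entry S i j" using m(2)[OF S, of i j] by (cases "i < n") auto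
    finally show "entry (unit_mat n e * S) i j = entry S i j" .
  qed
  show "S * unit_mat n e = S"
  proof (rule imat_eqI)
    fix i j
    have "entry (S * unit_mat n e) i j = (\<Sum>k<n. if k = j then entry S i k else 0)"
      unfolding entry_times[OF S] using m(2)[OF S] SC
      by (intro sum.cong refl) (auto simp: unit_mat_def unit_right)
    also have "\<dots> = entry S i j" using m(2)[OF S, of i j] by (cases "j < n") auto
    finally show "entry (S * unit_mat n e) i j = entry S i j" .
  qed
  assume T: "T \<in> mat_over n C"
  show "S + T \<in> mat_over n C"
    using m[OF S] m[OF T] by (auto simp: mat_over_def entry_simps intro!: closed_rules)
  show "S * T \<in> mat_over n C"
    unfolding mat_over_def mem_Collect_eq
  proof (intro allI)
    fix i j
    show "if i < n \<and> j < n then entry (S * T) i j \<in> C else entry (S * T) i j = 0"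
      unfolding entry_times[OF S] using m[OF S] m[OF T]
      by (auto intro!: closed_rules sum.neutral)
  qed
next
  show "unit_mat n e \<in> mat_over n C"
    unfolding unit_mat_def by (intro mk_mat_over) (auto intro: closed_rules)
  \<comment> \<open>Completeness is checked entrywise: the norm of a matrix bounds each entry and is
    bounded by the sum over the entries.\<close>
  show "complete (mat_over n C)"
    unfolding complete_def
  proof (intro allI impI)
    fix T :: "nat \<Rightarrow> 'a imat" assume "(\<forall>k. T k \<in> mat_over n C) \<and> Cauchy T"
    then have T: "\<And>k. T k \<in> mat_over n C" and cau: "Cauchy T" by auto
    have "\<exists>l\<in>C. (\<lambda>k. entry (T k) i j) \<longlonglongrightarrow> l" if ij: "i < n" "j < n" for i j
    proof -
      have "Cauchy (\<lambda>k. entry (T k) i j)"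
      proof (rule CauchyI)
        fix \<epsilon> :: real assume "0 < \<epsilon>"
        then obtain M where "\<And>k l. \<lbrakk>k \<ge> M; l \<ge> M\<rbrakk> \<Longrightarrow> norm (T k - T l) < \<epsilon>"
          using CauchyD[OF cau] by blast
        then show "\<exists>M. \<forall>k\<ge>M. \<forall>l\<ge>M. norm (entry (T k) i j - entry (T l) i j) < \<epsilon>"
          using norm_entry_le[of "T k - T l" i j for k l] by (metis entry_diff order.strict_trans1)
      qed
      then show ?thesis
        using complete_C[unfolded complete_def, THEN spec, of "\<lambda>k. entry (T k) i j"]
          mat_over_entry(1)[OF T ij] by simp
    qed
    then obtain l where l: "\<And>i j. \<lbrakk>i < n; j < n\<rbrakk> \<Longrightarrow> l i j \<in> C \<and> (\<lambda>k. entry (T k) i j) \<longlonglongrightarrow> l i j"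
      by metis
    define L where "L = mk_mat n l"
    have L: "L \<in> mat_over n C" using l by (simp add: L_def mk_mat_over)
    have "(\<lambda>k. \<Sum>i<n. \<Sum>j<n. norm (entry (T k) i j - l i j)) \<longlonglongrightarrow> (\<Sum>i<n. \<Sum>j<n. norm (l i j - l i j))"
      using l by (intro tendsto_intros) auto
    moreover have "norm (T k - L) \<le> (\<Sum>i<n. \<Sum>j<n. norm (entry (T k) i j - l i j))" for k
    proof -
      have "T k - L \<in> mat_over n UNIV"
        using mat_over_entry(2)[OF T] mat_over_entry(2)[OF L] by (auto simp: mat_over_def)
      from norm_mat_over_le[OF this] show ?thesis by (simp add: L_def)
    qed
    ultimately have "(\<lambda>k. T k - L) \<longlonglongrightarrow> 0"
      by (intro Lim_null_comparison[of "\<lambda>k. T k - L"]) auto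
    then show "\<exists>L\<in>mat_over n C. T \<longlonglongrightarrow> L" using L by (auto simp: LIM_zero_iff)
  qed
qed

lemma mat_over_mono: "m \<le> n \<Longrightarrow> mat_over m C \<subseteq> mat_over n C"
  by (auto simp: mat_over_def zero_closed split: if_splits) (metis order.strict_trans2 zero_closed)+

text \<open>Conjugation by a selfadjoint unitary \<open>J\<close> of \<open>C\<close> agrees with conjugation by \<open>iJ\<close>, which is connected to \<open>1\<close>.\<close>

lemma symmetry_uni0:
  assumes J: "J \<in> C" "adj J = J" "J * J = e" and nJ: "norm J \<le> 1" and ne: "norm e \<le> 1"
  defines "V \<equiv> 1 - e + itimes J"
  shows "V \<in> uni0 C" "norm V \<le> 3" "y \<in> C \<Longrightarrow> V * y * adj V = J * y * J"
proof -
  note u = unit_left[OF J(1)] unit_right[OF J(1)]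
  \<comment> \<open>Since \<open>J * J = e\<close>, the path is the exponential of \<open>t\<close>
    times \<open>itimes J\<close>, completed by \<open>1 - e\<close>. It runs from 1 at
    \<open>t = 0\<close> to \<open>V\<close> at \<open>t = pi/2\<close>.\<close>
  define p where "p t = 1 - e + (cos t *\<^sub>R e + sin t *\<^sub>R itimes J)" for t
  have adjp: "adj (p t) = 1 - e + (cos t *\<^sub>R e - sin t *\<^sub>R itimes J)" for t
    by (simp add: p_def adj_simps J)
  have "(cos t * cos t) *\<^sub>R e + (sin t * sin t) *\<^sub>R e = e" for t
    by (simp flip: scaleR_add_left power2_eq_square)
  then have pp: "adj (p t) * p t = 1" "p t * adj (p t) = 1" for t
    unfolding adjp unfolding p_def
    by (simp_all add: algebra_simps u itimes_simps J(3))
  have "p (pi/2) \<in> uni0 C"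
  proof (rule path_uni0)
    show "continuous_on {0..pi/2} p" unfolding p_def by (intro continuous_intros)
    show "p ` {0..pi/2} \<subseteq> uni C"
      using J by (auto simp: uni_def pp) (auto simp: p_def intro!: closed_rules)
  qed (simp_all add: p_def)
  then show "V \<in> uni0 C" by (simp add: p_def V_def)
  have "norm V \<le> norm (1 - e) + norm (itimes J)" unfolding V_def by (rule norm_triangle_ineq)
  also have "\<dots> \<le> (norm (1::'a) + norm e) + norm J"
    using norm_triangle_ineq4[of 1 e] by simp
  finally show "norm V \<le> 3" using nJ ne by simp
  assume y: "y \<in> C"
  have "V * y = itimes (J * y)"
    using unit_left[OF y] by (simp add: V_def algebra_simps itimes_simps)
  moreover have "J * y * adj V = - itimes (J * y * J)"
    using unit_right[OF mult_closed[OF J(1) y]] by (simp add: V_def adj_simps J algebra_simps itimes_simps)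
  ultimately show "V * y * adj V = J * y * J" by (simp add: itimes_simps)
qed

text \<open>
  The off-diagonal part of \<open>x\<close> is moved to \<open>0\<close> by the symmetries \<open>1 - 2e\<^sub>i\<^sub>i\<close>, which change the sign of
  the \<open>i\<close>-th row and column; the diagonal is moved to the corner by transpositions.
\<close>

lemma monomial_symmetry:
  assumes ne: "norm e \<le> 1"
    and \<sigma>: "\<And>k. k < n \<Longrightarrow> \<sigma> k < n" "\<And>k. \<sigma> (\<sigma> k) = k"
    and s: "\<And>k. s k * s k = (1::real)" "\<And>k. s (\<sigma> k) = s k"
  obtains V where "V \<in> uni0 (mat_over n C)" "norm V \<le> 3"
    "\<And>y k l. \<lbrakk>y \<in> mat_over n C; k < n; l < n\<rbrakk> \<Longrightarrow>
      entry (V * y * adj V) k l = (s k * s l) *\<^sub>R entry y (\<sigma> k) (\<sigma> l)"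
proof -
  interpret M: star_subalgebra "mat_over n C" "unit_mat n e" by (rule mat_over_star_subalgebra)
  \<comment> \<open>A signed permutation matrix; it is selfadjoint with square the unit because
    \<open>\<sigma>\<close> is an involution and \<open>s\<close> is a
    \<open>\<sigma>\<close>-invariant sign.\<close>
  define J where "J = mk_mat n (\<lambda>k l. if l = \<sigma> k then s k *\<^sub>R e else 0)"
  have J: "J \<in> mat_over n C"
    unfolding J_def by (intro mk_mat_over) (auto intro: closed_rules)
  have \<sigma>_iff: "l = \<sigma> k \<longleftrightarrow> k = \<sigma> l" for k l using \<sigma>(2) by metis
  have adjJ: "adj J = J"
    by (rule imat_eqI) (auto simp: J_def entry_simps adj_simps \<sigma>(2) s(2))
  have left: "entry (J * y) k l = s k *\<^sub>R entry y (\<sigma> k) l" if y: "y \<in> mat_over n C" and kl: "k < n" "l < n" for y k l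
  proof -
    have "entry (J * y) k l = (\<Sum>m<n. if m = \<sigma> k then s k *\<^sub>R entry y m l else 0)"
      unfolding entry_times[OF J] using kl mat_over_entry(1)[OF y]
      by (intro sum.cong refl) (auto simp: J_def unit_left)
    then show ?thesis using \<sigma>(1) kl by simp
  qed
  have right: "entry (y * J) k l = s l *\<^sub>R entry y k (\<sigma> l)" if y: "y \<in> mat_over n C" and kl: "k < n" "l < n" for y k l
  proof -
    have "entry (y * J) k l = (\<Sum>m<n. if m = \<sigma> l then s l *\<^sub>R entry y k m else 0)"
      unfolding entry_times[OF y] using kl mat_over_entry(1)[OF y]
      by (intro sum.cong refl) (auto simp: J_def unit_right \<sigma>(2) s(2) \<sigma>_iff[of l])
    then show ?thesis using \<sigma>(1) kl by simp
  qed
  have JJ: "J * J = unit_mat n e"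
  proof (rule mat_over_eqI[OF M.mult_closed[OF J J] M.unit_closed])
    fix k l assume "k < n" "l < n"
    then show "entry (J * J) k l = entry (unit_mat n e) k l"
      using left[OF J] \<sigma> s by (auto simp: J_def unit_mat_def)
  qed
  have "\<bar>s k\<bar> = 1" for k using s(1)[of k] by (metis abs_mult_self_eq abs_one power2_eq_square real_sqrt_abs real_sqrt_one)
  then have nJ: "norm J \<le> 1"
    using ne by (intro norm_monomial_le[of _ \<sigma>]) (auto simp: J_def \<sigma>(2) split: if_splits)
  have nE: "norm (unit_mat n e) \<le> 1"
    using ne by (intro norm_monomial_le[of _ id]) (auto simp: unit_mat_def split: if_splits)
  define V where "V = 1 - unit_mat n e + itimes J"
  note V = M.symmetry_uni0[OF J adjJ JJ nJ nE, folded V_def]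
  show ?thesis
  proof (rule that[OF V(1,2)])
    fix y k l assume y: "y \<in> mat_over n C" and kl: "k < n" "l < n"
    then show "entry (V * y * adj V) k l = (s k * s l) *\<^sub>R entry y (\<sigma> k) (\<sigma> l)"
      using \<sigma>(1) by (simp add: V(3) right[OF M.mult_closed[OF J y]] left mult.commute)
  qed
qed

text \<open>The constant counts \<open>n\<close> off-diagonal and \<open>n\<close> diagonal pieces,
  each of norm at most \<open>norm x\<close>. It depends on \<open>n\<close> only, which makes the
  factorization uniform along an inductive system.\<close>

lemma spans_mat_over:
  assumes ne: "norm e \<le> 1" and r: "1 \<le> r" "r \<le> n"
  shows "spans (2 * real n) (mat_over r C) (mat_over n C)"
  unfolding spans_def
proof (intro ballI impI)
  interpret M: star_subalgebra "mat_over n C" "unit_mat n e" by (rule mat_over_star_subalgebra)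
  fix x assume x: "x \<in> mat_over n C" and skew: "adj x = - x"
  note xC = mat_over_entry(1)[OF x]
  have sk: "adj (entry x i j) = - entry x j i" for i j
    using arg_cong[OF skew, of "\<lambda>T. entry T j i"] by (simp add: entry_simps)
  \<comment> \<open>Moving every diagonal entry to position \<open>(0, 0)\<close> leaves exactly the
    trace there, which fits into a corner of any size \<open>r \<ge> 1\<close>.\<close>
  define tr where "tr = (\<Sum>i<n. entry x i i)"
  define x0 where "x0 = mk_mat r (\<lambda>i j. if i = 0 \<and> j = 0 then tr else 0)"
  have trC: "tr \<in> C" unfolding tr_def using xC by (intro closed_rules) auto
  have x0: "x0 \<in> mat_over r C" unfolding x0_def using trC by (intro mk_mat_over) (auto intro: closed_rules)
  have adj_tr: "adj tr = - tr" by (simp add: tr_def adj_sum sk sum_negf)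
  have x0_skew: "adj x0 = - x0"
    by (rule imat_eqI) (auto simp: x0_def entry_simps adj_tr)
  have "norm tr \<le> real n * norm x"
    unfolding tr_def using sum_bounded_above[of "{..<n}" "\<lambda>i. norm (entry x i i)" "norm x"]
    by (intro order.trans[OF norm_sum]) (simp add: norm_entry_le)
  have nx0: "norm x0 \<le> 2 * real n * norm x"
  proof -
    have "norm x0 \<le> (\<Sum>i<r. \<Sum>j<r. if i = 0 \<and> j = 0 then norm tr else 0)"
      by (rule order.trans[OF norm_mat_over_le[OF x0]]) (intro sum_mono, auto simp: x0_def)
    also have "\<dots> = (\<Sum>i<r. if i = 0 then norm tr else 0)"
      using r by (intro sum.cong refl) auto
    also have "\<dots> = norm tr" using r by simp
    also have "\<dots> \<le> 2 * real n * norm x"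
      using \<open>norm tr \<le> real n * norm x\<close> mult_nonneg_nonneg[OF of_nat_0_le_iff norm_ge_zero, of n x]
      unfolding mult.assoc by linarith
    finally show ?thesis .
  qed
  \<comment> \<open>An off-diagonal position \<open>(k, l)\<close> is assigned to
    \<open>i = min k l\<close>. Exactly one of \<open>k\<close> and \<open>l\<close> is
    \<open>i\<close>, so the symmetry \<open>D i\<close> changes the sign of the entry, and the
    factor \<open>1/2\<close> compensates for the doubling.\<close>
  define Y where "Y i = mk_mat n (\<lambda>k l. if k \<noteq> l \<and> min k l = i then (1/2) *\<^sub>R entry x k l else 0)" for i
  define W where "W j = mk_mat n (\<lambda>k l. if k = j \<and> l = j then entry x j j else 0)" for j
  have YC: "Y i \<in> mat_over n C" and WC: "W i \<in> mat_over n C" for i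
    unfolding Y_def W_def using xC by (auto intro!: mk_mat_over closed_rules)
  have Y_skew: "adj (Y i) = - Y i" and W_skew: "adj (W i) = - W i" for i
    by (auto intro!: imat_eqI simp: Y_def W_def entry_simps adj_simps sk min.commute)
  have nY: "norm (Y i) \<le> norm x" and nW: "norm (W i) \<le> norm x" for i
    by (rule norm_imat_mono, simp add: Y_def W_def)+
  have "\<exists>V. V \<in> uni0 (mat_over n C) \<and> norm V \<le> 3 \<and> (\<forall>y k l. y \<in> mat_over n C \<longrightarrow> k < n \<longrightarrow> l < n \<longrightarrow>
      entry (V * y * adj V) k l = ((if k = i then - 1 else 1) * (if l = i then - 1 else 1)) *\<^sub>R entry y k l)" for i
    by (rule monomial_symmetry[OF ne, of n "\<lambda>k. k" "\<lambda>k. if k = i then - 1 else 1"]) auto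
  then obtain D where D: "\<And>i. D i \<in> uni0 (mat_over n C)" "\<And>i. norm (D i) \<le> 3"
    "\<And>i y k l. \<lbrakk>y \<in> mat_over n C; k < n; l < n\<rbrakk> \<Longrightarrow> entry (D i * y * adj (D i)) k l
      = ((if k = i then - 1 else 1) * (if l = i then - 1 else 1)) *\<^sub>R entry y k l"
    by metis
  have "\<exists>V. V \<in> uni0 (mat_over n C) \<and> norm V \<le> 3 \<and> (\<forall>y k l. y \<in> mat_over n C \<longrightarrow> k < n \<longrightarrow> l < n \<longrightarrow>
      entry (V * y * adj V) k l = entry y (Transposition.transpose 0 j k) (Transposition.transpose 0 j l))" if "j < n" for j
    by (rule monomial_symmetry[OF ne, of n "Transposition.transpose 0 j" "\<lambda>k. 1"])
      (use that in \<open>auto simp: Transposition.transpose_def\<close>)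
  then obtain S where S: "\<And>j. j < n \<Longrightarrow> S j \<in> uni0 (mat_over n C)" "\<And>j. j < n \<Longrightarrow> norm (S j) \<le> 3"
    "\<And>j y k l. \<lbrakk>j < n; y \<in> mat_over n C; k < n; l < n\<rbrakk> \<Longrightarrow> entry (S j * y * adj (S j)) k l
      = entry y (Transposition.transpose 0 j k) (Transposition.transpose 0 j l)"
    by metis
  define yVs where "yVs = map (\<lambda>i. (Y i, D i)) [0..<n] @ map (\<lambda>j. (W j, S j)) [0..<n]"
  define conj where "conj = (\<lambda>(y, V). y - V * y * adj V :: 'a imat)"
  have conj_closed: "conj (y, V) \<in> mat_over n C" if "y \<in> mat_over n C" "V \<in> uni0 (mat_over n C)" for y V
  proof -
    have V: "V - 1 \<in> mat_over n C" using that(2) uni0_subset uni_diff by blast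
    have "y - V * y * adj V = - ((V - 1) * y + y * adj (V - 1) + (V - 1) * y * adj (V - 1))"
      by (simp add: adj_simps algebra_simps)
    then show ?thesis
      unfolding conj_def using V that(1) by (auto intro!: M.closed_rules)
  qed
  have sum: "sum_list (map conj yVs) = (\<Sum>i<n. conj (Y i, D i)) + (\<Sum>j<n. conj (W j, S j))"
    unfolding yVs_def
    by (simp add: interv_sum_list_conv_sum_set_nat o_def lessThan_atLeast0 del: upt_Suc)
  have "x = x0 + sum_list (map conj yVs)"
  proof (rule mat_over_eqI[OF x])
    have "x0 \<in> mat_over n C" using x0 mat_over_mono[OF r(2)] by blast
    then show "x0 + sum_list (map conj yVs) \<in> mat_over n C"
      unfolding sum using D S YC WC conj_closed by (intro M.closed_rules) auto
    fix k l assume kl: "k < n" "l < n"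
    have "entry (conj (Y i, D i)) k l = (if i = min k l \<and> k \<noteq> l then entry x k l else 0)" for i
    proof -
      have half: "(1/2) *\<^sub>R a + (1/2) *\<^sub>R a = a" for a :: 'a by (simp flip: scaleR_add_left)
      show ?thesis
        using D(3)[OF YC kl, of i i] kl by (auto simp: conj_def Y_def half min_def)
    qed
    then have 1: "entry (\<Sum>i<n. conj (Y i, D i)) k l = (if k \<noteq> l then entry x k l else 0)"
      using kl by (simp add: entry_sum min_def)
    have "entry (conj (W j, S j)) k l
        = (if j = k then if k = l then entry x k k else 0 else 0) - (if k = 0 \<and> l = 0 then entry x j j else 0)"
      if "j < n" for j
      using S(3)[OF that WC kl, of j] kl that
      by (auto simp: conj_def W_def Transposition.transpose_def split: if_splits)
    then have 2: "entry (\<Sum>j<n. conj (W j, S j)) k l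
        = (if k = l then entry x k k else 0) - (if k = 0 \<and> l = 0 then tr else 0)"
      using kl by (simp add: entry_sum sum_subtractf tr_def)
    show "entry x k l = entry (x0 + sum_list (map conj yVs)) k l"
      unfolding sum using kl r by (simp add: entry_simps 1 2 x0_def)
  qed
  moreover have "\<forall>(y, V)\<in>set yVs. y \<in> mat_over n C \<and> adj y = - y \<and> V \<in> uni0 (mat_over n C) \<and> norm V \<le> 3"
    using YC WC Y_skew W_skew D S by (auto simp: yVs_def)
  moreover have "sum_list (map (\<lambda>(y, V). norm y) yVs) \<le> 2 * real n * norm x"
  proof -
    have "sum_list (map (\<lambda>(y, V). norm y) yVs) = (\<Sum>i<n. norm (Y i)) + (\<Sum>j<n. norm (W j))"
      unfolding yVs_def
      by (simp add: interv_sum_list_conv_sum_set_nat o_def lessThan_atLeast0 del: upt_Suc)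
    also have "\<dots> \<le> real n * norm x + real n * norm x"
      using sum_bounded_above[of "{..<n}" "\<lambda>i. norm (Y i)" "norm x"]
        sum_bounded_above[of "{..<n}" "\<lambda>i. norm (W i)" "norm x"] nY nW
      by (intro add_mono) simp_all
    finally show ?thesis by simp
  qed
  ultimately show "\<exists>x0\<in>mat_over r C. \<exists>yVs. adj x0 = - x0 \<and> norm x0 \<le> 2 * real n * norm x \<and>
      (\<forall>(y, V)\<in>set yVs. y \<in> mat_over n C \<and> adj y = - y \<and> V \<in> uni0 (mat_over n C) \<and> norm V \<le> 3) \<and>
      sum_list (map (\<lambda>(y, V). norm y) yVs) \<le> 2 * real n * norm x \<and>
      x = x0 + sum_list (map (\<lambda>(y, V). y - V * y * adj V) yVs)"
    using x0 x0_skew nx0 unfolding conj_def by blast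
qed

end

section \<open>Embedding C*-algebra records into a type\<close>

context normed_star_algebra
begin

lemma scale_closed: "x \<in> carrier B \<Longrightarrow> c \<odot> x \<in> carrier B"
  using smult_closed[of c x] by (simp add: complex_field_def)

lemma scale_add_left: "x \<in> carrier B \<Longrightarrow> (c + d) \<odot> x = c \<odot> x \<oplus> d \<odot> x"
  using smult_l_distr[of c d x] by (simp add: complex_field_def)

lemma scale_add_right: "\<lbrakk>x \<in> carrier B; y \<in> carrier B\<rbrakk> \<Longrightarrow> c \<odot> (x \<oplus> y) = c \<odot> x \<oplus> c \<odot> y"
  using smult_r_distr[of c x y] by (simp add: complex_field_def)

lemma scale_scale: "x \<in> carrier B \<Longrightarrow> c \<odot> (d \<odot> x) = (c * d) \<odot> x"
  using smult_assoc1[of c d x] by (simp add: complex_field_def)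

lemma scale_one: "x \<in> carrier B \<Longrightarrow> 1 \<odot> x = x"
  using smult_one[of x] by (simp add: complex_field_def)

lemma scale_minus_one: "x \<in> carrier B \<Longrightarrow> (- 1) \<odot> x = \<ominus> x"
proof -
  assume x: "x \<in> carrier B"
  have "(- 1) \<odot> x \<oplus> x = (- 1 + 1) \<odot> x"
    using x by (simp only: scale_add_left scale_one)
  also have "\<dots> = \<zero>" using smult_l_null[OF x] by (simp add: complex_field_def)
  finally show ?thesis using x by (intro minus_equality[symmetric]) (auto simp: scale_closed)
qed

lemma cnorm_uminus: "x \<in> carrier B \<Longrightarrow> cnorm B (\<ominus> x) = cnorm B x"
  using cnorm_smult[of x "- 1"] scale_minus_one[of x] by simp

lemma cnorm_zero: "cnorm B \<zero> = 0"
  using cnorm_eq_0_iff by simp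

lemma star_one: "star B \<one> = \<one>"
  by (metis l_one one_closed r_one star_closed star_mult star_star)

lemma star_zero: "star B \<zero> = \<zero>"
proof -
  have "star B \<zero> \<oplus> star B \<zero> = star B \<zero>"
    using star_add[of \<zero> \<zero>] by simp
  then show ?thesis using star_closed[OF zero_closed] by (metis add.l_cancel_one)
qed

end

context unital_cstar_algebra
begin

lemma cnorm_star:
  assumes x: "x \<in> carrier B"
  shows "cnorm B (star B x) = cnorm B x"
proof -
  have le: "cnorm B x \<le> cnorm B (star B x)" if x: "x \<in> carrier B" for x
  proof (cases "cnorm B x = 0")
    case True
    then show ?thesis using cnorm_nonneg[OF star_closed[OF x]] by simp
  next
    case False
    have "cnorm B x * cnorm B x \<le> cnorm B (star B x) * cnorm B x"
      using cstar_identity[OF x] cnorm_mult[OF star_closed[OF x] x] by (simp add: power2_eq_square)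
    then show ?thesis using False cnorm_nonneg[OF x] by (simp add: mult_le_cancel_right)
  qed
  show ?thesis using le[OF x] le[OF star_closed[OF x]] star_star[OF x] by simp
qed

lemma cnorm_one: "cnorm B \<one> \<le> 1"
proof -
  have "(cnorm B \<one>)\<^sup>2 = cnorm B \<one>" using cstar_identity[OF one_closed] by (simp add: star_one)
  then show ?thesis by (cases "cnorm B \<one> = 0") (auto simp: power2_eq_square)
qed

end

text \<open>
  The bounded families indexed by all C*-algebra structures on the type \<open>'a\<close>, with an additional complex
  coordinate that keeps \<open>0\<close> and \<open>1\<close> apart. Every such structure is a corner of this algebra.
\<close>

typedef 'a cstar_prod = "{p :: complex \<times> ('a cstar \<Rightarrow> 'a).
    (\<forall>B. if unital_cstar_algebra B then snd p B \<in> carrier B else snd p B = undefined) \<and>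
    (\<exists>b. \<forall>B. unital_cstar_algebra B \<longrightarrow> cnorm B (snd p B) \<le> b)}"
  morphisms Rep_prod Abs_prod
proof
  have "\<zero>\<^bsub>B\<^esub> \<in> carrier B \<and> cnorm B \<zero>\<^bsub>B\<^esub> \<le> 0" if "unital_cstar_algebra B" for B :: "'a cstar"
  proof -
    interpret unital_cstar_algebra B by fact
    show ?thesis by (simp add: cnorm_zero)
  qed
  then show "(0, \<lambda>B. if unital_cstar_algebra B then \<zero>\<^bsub>B\<^esub> else undefined) \<in> {p :: complex \<times> ('a cstar \<Rightarrow> 'a).
      (\<forall>B. if unital_cstar_algebra B then snd p B \<in> carrier B else snd p B = undefined) \<and>
      (\<exists>b. \<forall>B. unital_cstar_algebra B \<longrightarrow> cnorm B (snd p B) \<le> b)}"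
    by (auto intro!: exI[of _ 0])
qed

definition scal :: "'a cstar_prod \<Rightarrow> complex" where
  "scal T = fst (Rep_prod T)"

definition coord :: "'a cstar_prod \<Rightarrow> 'a cstar \<Rightarrow> 'a" where
  "coord T = snd (Rep_prod T)"

definition mk_prod :: "complex \<Rightarrow> ('a cstar \<Rightarrow> 'a) \<Rightarrow> 'a cstar_prod" where
  "mk_prod z f = Abs_prod (z, \<lambda>B. if unital_cstar_algebra B then f B else undefined)"

lemma coord_closed: "unital_cstar_algebra B \<Longrightarrow> coord T B \<in> carrier B"
  using Rep_prod[of T] unfolding coord_def mem_Collect_eq by metis

lemma coord_bounded: "\<exists>b. \<forall>B. unital_cstar_algebra B \<longrightarrow> cnorm B (coord T B) \<le> b"
  using Rep_prod[of T] unfolding coord_def by auto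

lemma prod_eqI:
  assumes "scal S = scal T" "\<And>B. unital_cstar_algebra B \<Longrightarrow> coord S B = coord T B"
  shows "S = T"
proof -
  have "coord S B = coord T B" for B
  proof (cases "unital_cstar_algebra B")
    case False
    then have "coord U B = undefined" for U :: "'a cstar_prod"
      using Rep_prod[of U] by (auto simp: coord_def)
    then show ?thesis by simp
  qed (rule assms(2))
  then have "Rep_prod S = Rep_prod T"
    using assms(1) unfolding scal_def coord_def by (simp add: prod_eq_iff fun_eq_iff)
  then show ?thesis by (simp add: Rep_prod_inject)
qed

lemma
  assumes "\<And>B. unital_cstar_algebra B \<Longrightarrow> f B \<in> carrier B \<and> cnorm B (f B) \<le> b"
  shows scal_mk_prod: "scal (mk_prod z f) = z"
    and coord_mk_prod: "unital_cstar_algebra B \<Longrightarrow> coord (mk_prod z f) B = f B"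
proof -
  have "Rep_prod (mk_prod z f) = (z, \<lambda>B. if unital_cstar_algebra B then f B else undefined)"
    unfolding mk_prod_def using assms by (subst Abs_prod_inverse) auto
  then show "scal (mk_prod z f) = z" "unital_cstar_algebra B \<Longrightarrow> coord (mk_prod z f) B = f B"
    by (simp_all add: scal_def coord_def)
qed

instantiation cstar_prod :: (type) star_algebra_1
begin

definition zero_cstar_prod :: "'a cstar_prod" where
  "zero_cstar_prod = mk_prod 0 (\<lambda>B. \<zero>\<^bsub>B\<^esub>)"

definition one_cstar_prod :: "'a cstar_prod" where
  "one_cstar_prod = mk_prod 1 (\<lambda>B. \<one>\<^bsub>B\<^esub>)"

definition plus_cstar_prod :: "'a cstar_prod \<Rightarrow> 'a cstar_prod \<Rightarrow> 'a cstar_prod" where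
  "plus_cstar_prod S T = mk_prod (scal S + scal T) (\<lambda>B. coord S B \<oplus>\<^bsub>B\<^esub> coord T B)"

definition times_cstar_prod :: "'a cstar_prod \<Rightarrow> 'a cstar_prod \<Rightarrow> 'a cstar_prod" where
  "times_cstar_prod S T = mk_prod (scal S * scal T) (\<lambda>B. coord S B \<otimes>\<^bsub>B\<^esub> coord T B)"

definition uminus_cstar_prod :: "'a cstar_prod \<Rightarrow> 'a cstar_prod" where
  "uminus_cstar_prod T = mk_prod (- scal T) (\<lambda>B. \<ominus>\<^bsub>B\<^esub> coord T B)"

definition minus_cstar_prod :: "'a cstar_prod \<Rightarrow> 'a cstar_prod \<Rightarrow> 'a cstar_prod" where
  "minus_cstar_prod S T = S + (- T)"

definition scaleR_cstar_prod :: "real \<Rightarrow> 'a cstar_prod \<Rightarrow> 'a cstar_prod" where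
  "scaleR_cstar_prod r T = mk_prod (of_real r * scal T) (\<lambda>B. of_real r \<odot>\<^bsub>B\<^esub> coord T B)"

definition adj_cstar_prod :: "'a cstar_prod \<Rightarrow> 'a cstar_prod" where
  "adj_cstar_prod T = mk_prod (cnj (scal T)) (\<lambda>B. star B (coord T B))"

definition itimes_cstar_prod :: "'a cstar_prod \<Rightarrow> 'a cstar_prod" where
  "itimes_cstar_prod T = mk_prod (\<i> * scal T) (\<lambda>B. \<i> \<odot>\<^bsub>B\<^esub> coord T B)"

definition norm_cstar_prod :: "'a cstar_prod \<Rightarrow> real" where
  "norm_cstar_prod T = Sup (insert (cmod (scal T)) {cnorm B (coord T B) |B. unital_cstar_algebra B})"

definition sgn_cstar_prod :: "'a cstar_prod \<Rightarrow> 'a cstar_prod" where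
  "sgn_cstar_prod T = scaleR (inverse (norm T)) T"

definition dist_cstar_prod :: "'a cstar_prod \<Rightarrow> 'a cstar_prod \<Rightarrow> real" where
  "dist_cstar_prod S T = norm (S - T)"

definition uniformity_cstar_prod :: "('a cstar_prod \<times> 'a cstar_prod) filter" where
  "uniformity_cstar_prod = (INF e\<in>{0<..}. principal {(x, y). dist x y < e})"

definition open_cstar_prod :: "'a cstar_prod set \<Rightarrow> bool" where
  "open_cstar_prod U \<longleftrightarrow> (\<forall>x\<in>U. \<forall>\<^sub>F (x', y) in uniformity. x' = x \<longrightarrow> y \<in> U)"

lemma norm_prod_bdd:
  "bdd_above (insert (cmod (scal T)) {cnorm B (coord T B) |B. unital_cstar_algebra B})"
proof -
  obtain b where "\<And>B. unital_cstar_algebra B \<Longrightarrow> cnorm B (coord T B) \<le> b"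
    using coord_bounded[of T] by blast
  then show ?thesis
    by (intro bdd_aboveI[of _ "max (cmod (scal T)) b"]) (auto simp: le_max_iff_disj)
qed

lemma norm_scal_le: "cmod (scal T) \<le> norm T"
  unfolding norm_cstar_prod_def using norm_prod_bdd by (intro cSup_upper) auto

lemma norm_coord_le: "unital_cstar_algebra B \<Longrightarrow> cnorm B (coord T B) \<le> norm T"
  unfolding norm_cstar_prod_def using norm_prod_bdd by (intro cSup_upper) auto

lemma norm_prod_le:
  assumes "cmod (scal T) \<le> b" "\<And>B. unital_cstar_algebra B \<Longrightarrow> cnorm B (coord T B) \<le> b"
  shows "norm T \<le> b"
  unfolding norm_cstar_prod_def using assms by (intro cSup_least) auto

lemma norm_prod_nonneg: "0 \<le> norm (T :: 'a cstar_prod)"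
  by (rule order.trans[OF norm_ge_zero norm_scal_le])

lemma scal_zero: "scal (0 :: 'a cstar_prod) = 0"
  and coord_zero: "unital_cstar_algebra B \<Longrightarrow> coord 0 B = \<zero>\<^bsub>B\<^esub>"
proof -
  have *: "\<zero>\<^bsub>B\<^esub> \<in> carrier B \<and> cnorm B \<zero>\<^bsub>B\<^esub> \<le> 0" if "unital_cstar_algebra B" for B :: "'a cstar"
  proof -
    interpret unital_cstar_algebra B by fact
    show ?thesis by (simp add: cnorm_zero)
  qed
  show "scal (0 :: 'a cstar_prod) = 0" "unital_cstar_algebra B \<Longrightarrow> coord 0 B = \<zero>\<^bsub>B\<^esub>"
    unfolding zero_cstar_prod_def by (rule scal_mk_prod[OF *] coord_mk_prod[OF *]; assumption)+
qed

lemma scal_one: "scal (1 :: 'a cstar_prod) = 1"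
  and coord_one: "unital_cstar_algebra B \<Longrightarrow> coord 1 B = \<one>\<^bsub>B\<^esub>"
proof -
  have *: "\<one>\<^bsub>B\<^esub> \<in> carrier B \<and> cnorm B \<one>\<^bsub>B\<^esub> \<le> 1" if "unital_cstar_algebra B" for B :: "'a cstar"
  proof -
    interpret unital_cstar_algebra B by fact
    show ?thesis by (simp add: cnorm_one)
  qed
  show "scal (1 :: 'a cstar_prod) = 1" "unital_cstar_algebra B \<Longrightarrow> coord 1 B = \<one>\<^bsub>B\<^esub>"
    unfolding one_cstar_prod_def by (rule scal_mk_prod[OF *] coord_mk_prod[OF *]; assumption)+
qed

lemma scal_plus: "scal (S + T) = scal S + scal T"
  and coord_plus: "unital_cstar_algebra B \<Longrightarrow> coord (S + T) B = coord S B \<oplus>\<^bsub>B\<^esub> coord T B"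
  for S T :: "'a cstar_prod"
proof -
  have *: "coord S B \<oplus>\<^bsub>B\<^esub> coord T B \<in> carrier B \<and> cnorm B (coord S B \<oplus>\<^bsub>B\<^esub> coord T B) \<le> norm S + norm T"
    if B: "unital_cstar_algebra B" for B
  proof -
    interpret unital_cstar_algebra B by fact
    show ?thesis
      using cnorm_triangle[OF coord_closed[OF B] coord_closed[OF B], of S T]
        norm_coord_le[OF B, of S] norm_coord_le[OF B, of T] by (simp add: coord_closed[OF B])
  qed
  show "scal (S + T) = scal S + scal T"
    "unital_cstar_algebra B \<Longrightarrow> coord (S + T) B = coord S B \<oplus>\<^bsub>B\<^esub> coord T B"
    unfolding plus_cstar_prod_def by (rule scal_mk_prod[OF *] coord_mk_prod[OF *]; assumption)+
qed

lemma scal_times: "scal (S * T) = scal S * scal T"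
  and coord_times: "unital_cstar_algebra B \<Longrightarrow> coord (S * T) B = coord S B \<otimes>\<^bsub>B\<^esub> coord T B"
  for S T :: "'a cstar_prod"
proof -
  have *: "coord S B \<otimes>\<^bsub>B\<^esub> coord T B \<in> carrier B \<and> cnorm B (coord S B \<otimes>\<^bsub>B\<^esub> coord T B) \<le> norm S * norm T"
    if B: "unital_cstar_algebra B" for B
  proof -
    interpret unital_cstar_algebra B by fact
    show ?thesis
      using cnorm_mult[OF coord_closed[OF B] coord_closed[OF B], of S T]
        mult_mono[OF norm_coord_le[OF B, of S] norm_coord_le[OF B, of T] norm_prod_nonneg
          cnorm_nonneg[OF coord_closed[OF B]]]
      by (simp add: coord_closed[OF B])
  qed
  show "scal (S * T) = scal S * scal T"
    "unital_cstar_algebra B \<Longrightarrow> coord (S * T) B = coord S B \<otimes>\<^bsub>B\<^esub> coord T B"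
    unfolding times_cstar_prod_def by (rule scal_mk_prod[OF *] coord_mk_prod[OF *]; assumption)+
qed

lemma scal_uminus: "scal (- T) = - scal T"
  and coord_uminus: "unital_cstar_algebra B \<Longrightarrow> coord (- T) B = \<ominus>\<^bsub>B\<^esub> coord T B"
  for T :: "'a cstar_prod"
proof -
  have *: "\<ominus>\<^bsub>B\<^esub> coord T B \<in> carrier B \<and> cnorm B (\<ominus>\<^bsub>B\<^esub> coord T B) \<le> norm T"
    if B: "unital_cstar_algebra B" for B
  proof -
    interpret unital_cstar_algebra B by fact
    show ?thesis by (simp add: coord_closed[OF B] cnorm_uminus norm_coord_le[OF B])
  qed
  show "scal (- T) = - scal T"
    "unital_cstar_algebra B \<Longrightarrow> coord (- T) B = \<ominus>\<^bsub>B\<^esub> coord T B"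
    unfolding uminus_cstar_prod_def by (rule scal_mk_prod[OF *] coord_mk_prod[OF *]; assumption)+
qed

lemma scale_bound:
  assumes B: "unital_cstar_algebra B"
  shows "c \<odot>\<^bsub>B\<^esub> coord T B \<in> carrier B \<and> cnorm B (c \<odot>\<^bsub>B\<^esub> coord T B) \<le> cmod c * norm T"
proof -
  interpret unital_cstar_algebra B by fact
  show ?thesis
    by (simp add: coord_closed[OF B] scale_closed cnorm_smult norm_coord_le[OF B] mult_left_mono)
qed

lemma scal_scaleR: "scal (r *\<^sub>R T) = of_real r * scal T"
  and coord_scaleR: "unital_cstar_algebra B \<Longrightarrow> coord (r *\<^sub>R T) B = of_real r \<odot>\<^bsub>B\<^esub> coord T B"
  for T :: "'a cstar_prod"
  unfolding scaleR_cstar_prod_def by (rule scal_mk_prod[OF scale_bound] coord_mk_prod[OF scale_bound]; assumption)+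

lemma scal_itimes: "scal (itimes T) = \<i> * scal T"
  and coord_itimes: "unital_cstar_algebra B \<Longrightarrow> coord (itimes T) B = \<i> \<odot>\<^bsub>B\<^esub> coord T B"
  for T :: "'a cstar_prod"
  unfolding itimes_cstar_prod_def by (rule scal_mk_prod[OF scale_bound] coord_mk_prod[OF scale_bound]; assumption)+

lemma scal_adj: "scal (adj T) = cnj (scal T)"
  and coord_adj: "unital_cstar_algebra B \<Longrightarrow> coord (adj T) B = star B (coord T B)"
  for T :: "'a cstar_prod"
proof -
  have *: "star B (coord T B) \<in> carrier B \<and> cnorm B (star B (coord T B)) \<le> norm T"
    if B: "unital_cstar_algebra B" for B
  proof -
    interpret unital_cstar_algebra B by fact
    show ?thesis by (simp add: coord_closed[OF B] star_closed cnorm_star norm_coord_le[OF B])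
  qed
  show "scal (adj T) = cnj (scal T)"
    "unital_cstar_algebra B \<Longrightarrow> coord (adj T) B = star B (coord T B)"
    unfolding adj_cstar_prod_def by (rule scal_mk_prod[OF *] coord_mk_prod[OF *]; assumption)+
qed

lemmas scal_simps = scal_zero scal_one scal_plus scal_times scal_uminus scal_scaleR scal_itimes scal_adj
lemmas coord_simps = coord_zero coord_one coord_plus coord_times coord_uminus coord_scaleR
  coord_itimes coord_adj

instance
proof
  fix a b c :: "'a cstar_prod" and r s :: real
  have coords:
    "coord (a + b + c) B = coord (a + (b + c)) B" "coord (a + b) B = coord (b + a) B"
    "coord (0 + a) B = coord a B" "coord (- a + a) B = coord 0 B"
    "coord (r *\<^sub>R (a + b)) B = coord (r *\<^sub>R a + r *\<^sub>R b) B"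
    "coord ((r + s) *\<^sub>R a) B = coord (r *\<^sub>R a + s *\<^sub>R a) B"
    "coord (r *\<^sub>R s *\<^sub>R a) B = coord ((r * s) *\<^sub>R a) B" "coord (1 *\<^sub>R a) B = coord a B"
    "coord (a * b * c) B = coord (a * (b * c)) B"
    "coord ((a + b) * c) B = coord (a * c + b * c) B" "coord (a * (b + c)) B = coord (a * b + a * c) B"
    "coord (r *\<^sub>R a * b) B = coord (r *\<^sub>R (a * b)) B" "coord (a * r *\<^sub>R b) B = coord (r *\<^sub>R (a * b)) B"
    "coord (1 * a) B = coord a B" "coord (a * 1) B = coord a B"
    "coord (adj (a + b)) B = coord (adj a + adj b) B" "coord (adj (adj a)) B = coord a B"
    "coord (adj (r *\<^sub>R a)) B = coord (r *\<^sub>R adj a) B" "coord (adj (a * b)) B = coord (adj b * adj a) B"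
    "coord (itimes (a + b)) B = coord (itimes a + itimes b) B"
    "coord (itimes (r *\<^sub>R a)) B = coord (r *\<^sub>R itimes a) B"
    "coord (itimes (itimes a)) B = coord (- a) B" "coord (adj (itimes a)) B = coord (- itimes (adj a)) B"
    "coord (itimes a * b) B = coord (itimes (a * b)) B" "coord (a * itimes b) B = coord (itimes (a * b)) B"
    if B: "unital_cstar_algebra B" for B
  proof -
    interpret unital_cstar_algebra B by fact
    have cl: "coord a B \<in> carrier B" "coord b B \<in> carrier B" "coord c B \<in> carrier B"
      by (simp_all add: coord_closed[OF B])
    have "- \<i> = (- 1) * \<i>" by simp
    then have mi: "(- \<i>) \<odot>\<^bsub>B\<^esub> x = \<ominus>\<^bsub>B\<^esub> (\<i> \<odot>\<^bsub>B\<^esub> x)" if "x \<in> carrier B" for x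
      using that by (simp only: flip: scale_scale scale_minus_one[OF scale_closed[OF that]])
    note simps = coord_simps[OF B] cl scale_closed star_closed
    show "coord (a + b + c) B = coord (a + (b + c)) B" "coord (a + b) B = coord (b + a) B"
      "coord (0 + a) B = coord a B" "coord (- a + a) B = coord 0 B"
      by (simp_all add: simps a_ac l_neg r_neg)
    show "coord (r *\<^sub>R (a + b)) B = coord (r *\<^sub>R a + r *\<^sub>R b) B"
      "coord ((r + s) *\<^sub>R a) B = coord (r *\<^sub>R a + s *\<^sub>R a) B"
      "coord (r *\<^sub>R s *\<^sub>R a) B = coord ((r * s) *\<^sub>R a) B" "coord (1 *\<^sub>R a) B = coord a B"
      by (simp_all add: simps scale_add_left scale_add_right scale_scale scale_one)
    show "coord (a * b * c) B = coord (a * (b * c)) B"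
      "coord ((a + b) * c) B = coord (a * c + b * c) B" "coord (a * (b + c)) B = coord (a * b + a * c) B"
      by (simp_all add: simps m_assoc l_distr r_distr)
    show "coord (r *\<^sub>R a * b) B = coord (r *\<^sub>R (a * b)) B" "coord (a * r *\<^sub>R b) B = coord (r *\<^sub>R (a * b)) B"
      "coord (1 * a) B = coord a B" "coord (a * 1) B = coord a B"
      by (simp_all add: simps smult_mult_left smult_mult_right)
    show "coord (adj (a + b)) B = coord (adj a + adj b) B" "coord (adj (adj a)) B = coord a B"
      "coord (adj (r *\<^sub>R a)) B = coord (r *\<^sub>R adj a) B" "coord (adj (a * b)) B = coord (adj b * adj a) B"
      by (simp_all add: simps star_add star_star star_smult star_mult)
    show "coord (itimes (a + b)) B = coord (itimes a + itimes b) B"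
      "coord (itimes (r *\<^sub>R a)) B = coord (r *\<^sub>R itimes a) B"
      "coord (itimes (itimes a)) B = coord (- a) B" "coord (adj (itimes a)) B = coord (- itimes (adj a)) B"
      by (simp_all add: simps scale_add_right scale_scale mult.commute scale_minus_one star_smult mi)
    show "coord (itimes a * b) B = coord (itimes (a * b)) B" "coord (a * itimes b) B = coord (itimes (a * b)) B"
      by (simp_all add: simps smult_mult_left smult_mult_right)
  qed
  show "a + b + c = a + (b + c)" "a + b = b + a" "0 + a = a" "- a + a = 0"
    "r *\<^sub>R (a + b) = r *\<^sub>R a + r *\<^sub>R b" "(r + s) *\<^sub>R a = r *\<^sub>R a + s *\<^sub>R a"
    "r *\<^sub>R s *\<^sub>R a = (r * s) *\<^sub>R a" "1 *\<^sub>R a = a"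
    "a * b * c = a * (b * c)" "(a + b) * c = a * c + b * c" "a * (b + c) = a * b + a * c"
    "r *\<^sub>R a * b = r *\<^sub>R (a * b)" "a * r *\<^sub>R b = r *\<^sub>R (a * b)" "1 * a = a" "a * 1 = a"
    "adj (a + b) = adj a + adj b" "adj (adj a) = a"
    "adj (r *\<^sub>R a) = r *\<^sub>R adj a" "adj (a * b) = adj b * adj a"
    "itimes (a + b) = itimes a + itimes b" "itimes (r *\<^sub>R a) = r *\<^sub>R itimes a"
    "itimes (itimes a) = - a" "adj (itimes a) = - itimes (adj a)"
    "itimes a * b = itimes (a * b)" "a * itimes b = itimes (a * b)"
    by (rule prod_eqI; (rule coords; assumption)?; simp add: scal_simps algebra_simps)+
  show "a - b = a + - b" by (rule minus_cstar_prod_def)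
  have "scal (0 :: 'a cstar_prod) \<noteq> scal 1" by (simp add: scal_simps)
  then show "(0 :: 'a cstar_prod) \<noteq> 1" by metis
  show "dist a b = norm (a - b)" by (rule dist_cstar_prod_def)
  show "sgn a = inverse (norm a) *\<^sub>R a" by (rule sgn_cstar_prod_def)
  show "uniformity = (INF e\<in>{0<..}. principal {(x, y). dist x (y::'a cstar_prod) < e})"
    by (rule uniformity_cstar_prod_def)
  show "open U = (\<forall>x\<in>U. \<forall>\<^sub>F (x', y) in uniformity. x' = x \<longrightarrow> y \<in> U)" for U :: "'a cstar_prod set"
    by (rule open_cstar_prod_def)
  show "norm a = 0 \<longleftrightarrow> a = 0"
  proof
    assume a: "norm a = 0"
    show "a = 0"
    proof (rule prod_eqI)
      show "scal a = scal 0" using norm_scal_le[of a] a by (simp add: scal_simps)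
      fix B :: "'a cstar" assume B: "unital_cstar_algebra B"
      then interpret unital_cstar_algebra B .
      have "cnorm B (coord a B) = 0"
        using norm_coord_le[OF B, of a] cnorm_nonneg[OF coord_closed[OF B, of a]] a by simp
      then show "coord a B = coord 0 B"
        by (simp add: coord_simps[OF B] cnorm_eq_0_iff coord_closed[OF B])
    qed
  next
    assume a: "a = 0"
    have "norm a \<le> 0"
    proof (rule norm_prod_le)
      fix B :: "'a cstar" assume B: "unital_cstar_algebra B"
      then interpret unital_cstar_algebra B .
      show "cnorm B (coord a B) \<le> 0" by (simp add: a coord_simps[OF B] cnorm_zero)
    qed (simp add: a scal_simps)
    then show "norm a = 0" using norm_prod_nonneg[of a] by simp
  qed
  show "norm (a + b) \<le> norm a + norm b"
  proof (rule norm_prod_le)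
    show "cmod (scal (a + b)) \<le> norm a + norm b"
      using norm_scal_le[of a] norm_scal_le[of b] norm_triangle_ineq[of "scal a" "scal b"]
      by (simp add: scal_simps)
    fix B :: "'a cstar" assume B: "unital_cstar_algebra B"
    then interpret unital_cstar_algebra B .
    show "cnorm B (coord (a + b) B) \<le> norm a + norm b"
      using cnorm_triangle[OF coord_closed[OF B] coord_closed[OF B], of a b]
        norm_coord_le[OF B, of a] norm_coord_le[OF B, of b] by (simp add: coord_simps[OF B])
  qed
  show "norm (a * b) \<le> norm a * norm b"
  proof (rule norm_prod_le)
    show "cmod (scal (a * b)) \<le> norm a * norm b"
      using mult_mono[OF norm_scal_le[of a] norm_scal_le[of b] norm_prod_nonneg norm_ge_zero]
      by (simp add: scal_simps norm_mult)
    fix B :: "'a cstar" assume B: "unital_cstar_algebra B"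
    then interpret unital_cstar_algebra B .
    show "cnorm B (coord (a * b) B) \<le> norm a * norm b"
      using cnorm_mult[OF coord_closed[OF B] coord_closed[OF B], of a b]
        mult_mono[OF norm_coord_le[OF B, of a] norm_coord_le[OF B, of b] norm_prod_nonneg
          cnorm_nonneg[OF coord_closed[OF B]]]
      by (simp add: coord_simps[OF B])
  qed
  have scale: "norm (r *\<^sub>R a) \<le> \<bar>r\<bar> * norm a" for r and a :: "'a cstar_prod"
    using scale_bound[of _ "of_real r" a] norm_scal_le[of a]
    by (intro norm_prod_le) (simp_all add: scal_simps coord_simps norm_mult mult_left_mono)
  show "norm (r *\<^sub>R a) = \<bar>r\<bar> * norm a"
  proof (cases "r = 0")
    case True
    then show ?thesis using scale[of r a] norm_prod_nonneg[of "r *\<^sub>R a"] by simp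
  next
    case False
    have "(1/r) *\<^sub>R r *\<^sub>R a = a"
    proof (rule prod_eqI)
      fix B :: "'a cstar" assume B: "unital_cstar_algebra B"
      then interpret unital_cstar_algebra B .
      show "coord ((1/r) *\<^sub>R r *\<^sub>R a) B = coord a B"
        using False by (simp add: coord_simps[OF B] scale_scale coord_closed[OF B] scale_one)
    qed (use False in \<open>simp add: scal_simps\<close>)
    then have "norm a \<le> \<bar>1/r\<bar> * norm (r *\<^sub>R a)" using scale[of "1/r" "r *\<^sub>R a"] by simp
    then have "\<bar>r\<bar> * norm a \<le> norm (r *\<^sub>R a)" using False by (simp add: field_simps)
    then show ?thesis using scale[of r a] by simp
  qed
  have "norm (1 :: 'a cstar_prod) \<le> 1"
  proof (rule norm_prod_le)
    fix B :: "'a cstar" assume B: "unital_cstar_algebra B"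
    then interpret unital_cstar_algebra B .
    show "cnorm B (coord 1 B) \<le> 1" by (simp add: coord_simps[OF B] cnorm_one)
  qed (simp add: scal_simps)
  then show "norm (1 :: 'a cstar_prod) = 1"
    using norm_scal_le[of "1 :: 'a cstar_prod"] by (simp add: scal_simps)
  have le: "norm (adj a) \<le> norm a" "norm (itimes a) \<le> norm a" for a :: "'a cstar_prod"
  proof -
    show "norm (adj a) \<le> norm a"
    proof (rule norm_prod_le)
      fix B :: "'a cstar" assume B: "unital_cstar_algebra B"
      then interpret unital_cstar_algebra B .
      show "cnorm B (coord (adj a) B) \<le> norm a"
        by (simp add: coord_simps[OF B] cnorm_star coord_closed[OF B] norm_coord_le[OF B])
    qed (simp add: scal_simps norm_scal_le)
    show "norm (itimes a) \<le> norm a"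
      using scale_bound[of _ "\<i>" a] norm_scal_le[of a]
      by (intro norm_prod_le) (simp_all add: scal_simps coord_simps norm_mult)
  qed
  show "norm (adj a) = norm a"
    using le(1)[of a] le(1)[of "adj a"] \<open>adj (adj a) = a\<close> by simp
  have "norm (- a) \<ge> norm a"
  proof (rule norm_prod_le)
    show "cmod (scal a) \<le> norm (- a)" using norm_scal_le[of "- a"] by (simp add: scal_simps)
    fix B :: "'a cstar" assume B: "unital_cstar_algebra B"
    then interpret unital_cstar_algebra B .
    show "cnorm B (coord a B) \<le> norm (- a)"
      using norm_coord_le[OF B, of "- a"] by (simp add: coord_simps[OF B] cnorm_uminus coord_closed[OF B])
  qed
  then show "norm (itimes a) = norm a"
    using le(2)[of a] le(2)[of "itimes a"] \<open>itimes (itimes a) = - a\<close> by simp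
qed

end

text \<open>The scalar coordinate 0 keeps the image of the unit of \<open>B\<close> different from
  \<open>1\<close>, so \<open>1\<close> always acts as an adjoined unit.\<close>

definition emb :: "'a cstar \<Rightarrow> 'a \<Rightarrow> 'a cstar_prod" where
  "emb B x = mk_prod 0 (\<lambda>B'. if B' = B then x else \<zero>\<^bsub>B'\<^esub>)"

lemma
  assumes B: "unital_cstar_algebra B" and x: "x \<in> carrier B"
  shows scal_emb: "scal (emb B x) = 0"
    and coord_emb: "unital_cstar_algebra B' \<Longrightarrow> coord (emb B x) B' = (if B' = B then x else \<zero>\<^bsub>B'\<^esub>)"
proof -
  have *: "(if B' = B then x else \<zero>\<^bsub>B'\<^esub>) \<in> carrier B' \<and> cnorm B' (if B' = B then x else \<zero>\<^bsub>B'\<^esub>) \<le> cnorm B x"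
    if "unital_cstar_algebra B'" for B'
  proof -
    interpret B: unital_cstar_algebra B by fact
    interpret B': unital_cstar_algebra B' by fact
    show ?thesis using x by (simp add: B'.cnorm_zero B.cnorm_nonneg)
  qed
  show "scal (emb B x) = 0"
    "unital_cstar_algebra B' \<Longrightarrow> coord (emb B x) B' = (if B' = B then x else \<zero>\<^bsub>B'\<^esub>)"
    unfolding emb_def by (rule scal_mk_prod[OF *] coord_mk_prod[OF *]; assumption)+
qed

lemma (in unital_cstar_algebra) scale_zero: "c \<odot> \<zero> = \<zero>"
  using smult_r_null[of c] by (simp add: complex_field_def)

section \<open>The embedding of a single C*-algebra record\<close>

context
  fixes B :: "'a cstar"
  assumes B: "unital_cstar_algebra B"
begin

interpretation B: unital_cstar_algebra B by (rule B)

lemma emb_add: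
  assumes "x \<in> carrier B" "y \<in> carrier B"
  shows "emb B (x \<oplus>\<^bsub>B\<^esub> y) = emb B x + emb B y"
proof (rule prod_eqI)
  fix B' :: "'a cstar" assume B': "unital_cstar_algebra B'"
  then interpret B': unital_cstar_algebra B' .
  show "coord (emb B (x \<oplus>\<^bsub>B\<^esub> y)) B' = coord (emb B x + emb B y) B'"
    using assms by (simp add: coord_simps[OF B'] coord_emb[OF B _ B'])
qed (use assms in \<open>simp add: scal_simps scal_emb[OF B]\<close>)

lemma emb_mult:
  assumes "x \<in> carrier B" "y \<in> carrier B"
  shows "emb B (x \<otimes>\<^bsub>B\<^esub> y) = emb B x * emb B y"
proof (rule prod_eqI)
  fix B' :: "'a cstar" assume B': "unital_cstar_algebra B'"
  then interpret B': unital_cstar_algebra B' .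
  show "coord (emb B (x \<otimes>\<^bsub>B\<^esub> y)) B' = coord (emb B x * emb B y) B'"
    using assms by (simp add: coord_simps[OF B'] coord_emb[OF B _ B'])
qed (use assms in \<open>simp add: scal_simps scal_emb[OF B]\<close>)

lemma emb_star:
  assumes "x \<in> carrier B"
  shows "emb B (star B x) = adj (emb B x)"
proof (rule prod_eqI)
  fix B' :: "'a cstar" assume B': "unital_cstar_algebra B'"
  then interpret B': unital_cstar_algebra B' .
  show "coord (emb B (star B x)) B' = coord (adj (emb B x)) B'"
    using assms by (simp add: coord_simps[OF B'] coord_emb[OF B _ B'] B.star_closed B'.star_zero)
qed (use assms in \<open>simp add: scal_simps scal_emb[OF B] B.star_closed\<close>)

lemma emb_scaleR:
  assumes "x \<in> carrier B"
  shows "emb B (of_real r \<odot>\<^bsub>B\<^esub> x) = r *\<^sub>R emb B x"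
proof (rule prod_eqI)
  fix B' :: "'a cstar" assume B': "unital_cstar_algebra B'"
  then interpret B': unital_cstar_algebra B' .
  show "coord (emb B (of_real r \<odot>\<^bsub>B\<^esub> x)) B' = coord (r *\<^sub>R emb B x) B'"
    using assms by (simp add: coord_simps[OF B'] coord_emb[OF B _ B'] B.scale_closed B'.scale_zero)
qed (use assms in \<open>simp add: scal_simps scal_emb[OF B] B.scale_closed\<close>)

lemma emb_itimes:
  assumes "x \<in> carrier B"
  shows "emb B (\<i> \<odot>\<^bsub>B\<^esub> x) = itimes (emb B x)"
proof (rule prod_eqI)
  fix B' :: "'a cstar" assume B': "unital_cstar_algebra B'"
  then interpret B': unital_cstar_algebra B' .
  show "coord (emb B (\<i> \<odot>\<^bsub>B\<^esub> x)) B' = coord (itimes (emb B x)) B'"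
    using assms by (simp add: coord_simps[OF B'] coord_emb[OF B _ B'] B.scale_closed B'.scale_zero)
qed (use assms in \<open>simp add: scal_simps scal_emb[OF B] B.scale_closed\<close>)

lemma norm_emb:
  assumes "x \<in> carrier B"
  shows "norm (emb B x) = cnorm B x"
proof (rule antisym)
  show "norm (emb B x) \<le> cnorm B x"
  proof (rule norm_prod_le)
    fix B' :: "'a cstar" assume B': "unital_cstar_algebra B'"
    then interpret B': unital_cstar_algebra B' .
    show "cnorm B' (coord (emb B x) B') \<le> cnorm B x"
      using assms by (simp add: coord_emb[OF B _ B'] B'.cnorm_zero B.cnorm_nonneg)
  qed (use assms in \<open>simp add: scal_emb[OF B] B.cnorm_nonneg\<close>)
  show "cnorm B x \<le> norm (emb B x)"
    using norm_coord_le[OF B, of "emb B x"] assms by (simp add: coord_emb[OF B _ B])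
qed

lemma emb_inject:
  assumes "x \<in> carrier B" "y \<in> carrier B" "emb B x = emb B y"
  shows "x = y"
proof -
  have "x = coord (emb B x) B" using assms(1) by (simp add: coord_emb[OF B _ B])
  also have "\<dots> = coord (emb B y) B" by (simp only: assms(3))
  also have "\<dots> = y" using assms(2) by (simp add: coord_emb[OF B _ B])
  finally show ?thesis .
qed

lemma emb_zero: "emb B \<zero>\<^bsub>B\<^esub> = 0"
  using emb_scaleR[OF B.zero_closed, of 0] by (simp add: B.scale_zero)

lemma emb_uminus:
  assumes x: "x \<in> carrier B"
  shows "emb B (\<ominus>\<^bsub>B\<^esub> x) = - emb B x"
proof -
  have "emb B (\<ominus>\<^bsub>B\<^esub> x) = emb B (of_real (- 1) \<odot>\<^bsub>B\<^esub> x)"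
    using B.scale_minus_one[OF x] by simp
  also have "\<dots> = - emb B x" unfolding emb_scaleR[OF x] by simp
  finally show ?thesis .
qed

lemma emb_diff:
  assumes "x \<in> carrier B" "y \<in> carrier B"
  shows "emb B (x \<ominus>\<^bsub>B\<^esub> y) = emb B x - emb B y"
  unfolding a_minus_def emb_add[OF assms(1) B.a_inv_closed[OF assms(2)]] emb_uminus[OF assms(2)]
  by simp

lemma dist_emb: "\<lbrakk>x \<in> carrier B; y \<in> carrier B\<rbrakk> \<Longrightarrow> dist (emb B x) (emb B y) = cdist B x y"
  by (simp add: dist_norm cdist_def norm_emb emb_diff[symmetric])

lemma emb_finsum:
  assumes "finite I" "\<And>i. i \<in> I \<Longrightarrow> f i \<in> carrier B"
  shows "emb B (\<Oplus>\<^bsub>B\<^esub>i\<in>I. f i) = (\<Sum>i\<in>I. emb B (f i))"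
  using assms
proof (induction I rule: finite_induct)
  case (insert i I)
  then have "emb B (\<Oplus>\<^bsub>B\<^esub>i\<in>insert i I. f i) = emb B (f i \<oplus>\<^bsub>B\<^esub> (\<Oplus>\<^bsub>B\<^esub>i\<in>I. f i))"
    by (subst B.finsum_insert) auto
  then show ?case using insert by (simp add: emb_add B.finsum_closed)
qed (simp add: emb_zero)

lemma emb_cstar_subalgebra: "cstar_subalgebra (emb B ` carrier B) (emb B \<one>\<^bsub>B\<^esub>)"
proof
  fix x y assume "x \<in> emb B ` carrier B" "y \<in> emb B ` carrier B"
  then obtain a b where ab: "a \<in> carrier B" "b \<in> carrier B" "x = emb B a" "y = emb B b" by blast
  show "x + y \<in> emb B ` carrier B" "x * y \<in> emb B ` carrier B"
    using ab by (auto simp flip: emb_add emb_mult)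
next
  fix x and r assume "x \<in> emb B ` carrier B"
  then obtain a where a: "a \<in> carrier B" "x = emb B a" by blast
  show "r *\<^sub>R x \<in> emb B ` carrier B" "adj x \<in> emb B ` carrier B" "itimes x \<in> emb B ` carrier B"
    using a by (auto simp: B.scale_closed B.star_closed simp flip: emb_scaleR emb_star emb_itimes)
  show "emb B \<one>\<^bsub>B\<^esub> * x = x" "x * emb B \<one>\<^bsub>B\<^esub> = x"
    using a by (simp_all flip: emb_mult)
  show "norm (adj x * x) = (norm x)\<^sup>2"
    using a B.cstar_identity[of a] by (simp add: norm_emb B.star_closed flip: emb_mult emb_star)
next
  show "emb B \<one>\<^bsub>B\<^esub> \<in> emb B ` carrier B" by simp
  show "complete (emb B ` carrier B)"
    unfolding complete_def
  proof (intro allI impI)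
    fix T assume T: "(\<forall>k. T k \<in> emb B ` carrier B) \<and> Cauchy T"
    then obtain x where x: "\<And>k. x k \<in> carrier B" "\<And>k. T k = emb B (x k)"
      unfolding image_iff by metis
    have "B.metric.MCauchy x"
      unfolding B.metric.MCauchy_def
    proof (intro conjI allI impI)
      fix \<epsilon> :: real assume "0 < \<epsilon>"
      then obtain N where "\<And>m n. \<lbrakk>m \<ge> N; n \<ge> N\<rbrakk> \<Longrightarrow> dist (T m) (T n) < \<epsilon>"
        using T unfolding Cauchy_def by blast
      then show "\<exists>N. \<forall>n n'. N \<le> n \<longrightarrow> N \<le> n' \<longrightarrow> cdist B (x n) (x n') < \<epsilon>"
        using x by (auto simp: dist_emb)
    qed (use x in auto)
    then obtain l where "limitin B.metric.mtopology x l sequentially"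
      using B.complete unfolding B.metric.mcomplete_def by blast
    then have l: "l \<in> carrier B" "\<And>\<epsilon>. \<epsilon> > 0 \<Longrightarrow> \<exists>N. \<forall>n\<ge>N. cdist B (x n) l < \<epsilon>"
      unfolding B.metric.limit_metric_sequentially by blast+
    have "T \<longlonglongrightarrow> emb B l"
      unfolding lim_sequentially using l x by (simp add: dist_emb)
    then show "\<exists>l\<in>emb B ` carrier B. T \<longlonglongrightarrow> l" using l(1) by blast
  qed
qed

end

section \<open>The operator norm on matrices\<close>

definition col_norm :: "nat \<Rightarrow> (nat \<Rightarrow> 'a::star_algebra_1) \<Rightarrow> real" where
  "col_norm n x = sqrt (norm (\<Sum>i<n. adj (x i) * x i))"

definition mat_apply :: "nat \<Rightarrow> 'a::star_algebra_1 imat \<Rightarrow> (nat \<Rightarrow> 'a) \<Rightarrow> nat \<Rightarrow> 'a" where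
  "mat_apply n T x i = (\<Sum>j<n. entry T i j * x j)"

definition op_norm :: "nat \<Rightarrow> 'a::star_algebra_1 set \<Rightarrow> 'a imat \<Rightarrow> real" where
  "op_norm n C T = Sup {col_norm n (mat_apply n T x) |x. (\<forall>j<n. x j \<in> C) \<and> col_norm n x \<le> 1}"

context cstar_subalgebra
begin

lemma norm_le_col_norm:
  assumes "\<And>j. j < n \<Longrightarrow> x j \<in> C" "i < n"
  shows "norm (x i) \<le> col_norm n x"
  unfolding col_norm_def using norm_sum_adj_mult_mono[of "{..<n}" i x] assms
  by (intro real_le_rsqrt) auto

lemma col_norm_le_sum: "col_norm n x \<le> (\<Sum>i<n. norm (x i))"
proof -
  have "norm (\<Sum>i<n. adj (x i) * x i) \<le> (\<Sum>i<n. (norm (x i))\<^sup>2)"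
  proof (rule sum_norm_le)
    fix i show "norm (adj (x i) * x i) \<le> (norm (x i))\<^sup>2"
      using norm_mult_ineq[of "adj (x i)" "x i"] by (simp add: power2_eq_square)
  qed
  also have "\<dots> \<le> (\<Sum>i<n. norm (x i))\<^sup>2"
    unfolding power2_eq_square sum_distrib_right
    by (intro sum_mono mult_left_mono member_le_sum) auto
  finally show ?thesis
    unfolding col_norm_def by (intro real_le_lsqrt) (auto intro: sum_nonneg)
qed

lemma mat_apply_closed:
  "\<lbrakk>T \<in> mat_over n C; \<And>j. j < n \<Longrightarrow> x j \<in> C; i < n\<rbrakk> \<Longrightarrow> mat_apply n T x i \<in> C"
  unfolding mat_apply_def by (intro closed_rules) (auto intro: mat_over_entry(1))

lemma col_norm_mat_apply_le:
  assumes T: "T \<in> mat_over n C" and x: "\<And>j. j < n \<Longrightarrow> x j \<in> C" "col_norm n x \<le> 1"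
  shows "col_norm n (mat_apply n T x) \<le> (\<Sum>i<n. \<Sum>j<n. norm (entry T i j))"
proof (rule order.trans[OF col_norm_le_sum], rule sum_mono)
  fix i
  have "norm (entry T i j * x j) \<le> norm (entry T i j)" if "j < n" for j
    using norm_mult_ineq[of "entry T i j" "x j"] norm_le_col_norm[of n x j] x that
      mult_left_le[of "norm (x j)" "norm (entry T i j)"] by fastforce
  then show "norm (mat_apply n T x i) \<le> (\<Sum>j<n. norm (entry T i j))"
    unfolding mat_apply_def by (intro sum_norm_le) auto
qed

lemma op_norm_bdd:
  assumes T: "T \<in> mat_over n C"
  shows "bdd_above {col_norm n (mat_apply n T x) |x. (\<forall>j<n. x j \<in> C) \<and> col_norm n x \<le> 1}"
  using col_norm_mat_apply_le[OF T] by (intro bdd_aboveI) blast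

lemma op_norm_upper:
  assumes "T \<in> mat_over n C" "\<And>j. j < n \<Longrightarrow> x j \<in> C" "col_norm n x \<le> 1"
  shows "col_norm n (mat_apply n T x) \<le> op_norm n C T"
  unfolding op_norm_def using op_norm_bdd[OF assms(1)] assms(2,3) by (intro cSup_upper) auto

lemma op_norm_least:
  assumes "\<And>x. \<lbrakk>\<And>j. j < n \<Longrightarrow> x j \<in> C; col_norm n x \<le> 1\<rbrakk> \<Longrightarrow> col_norm n (mat_apply n T x) \<le> b"
  shows "op_norm n C T \<le> b"
  unfolding op_norm_def
proof (rule cSup_least)
  have "(\<forall>j<n. (0::'a) \<in> C) \<and> col_norm n (\<lambda>j. 0 :: 'a) \<le> 1"
    by (simp add: col_norm_def zero_closed)
  then show "{col_norm n (mat_apply n T x) |x. (\<forall>j<n. x j \<in> C) \<and> col_norm n x \<le> 1} \<noteq> {}"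
    by (auto intro!: exI[of _ "\<lambda>j. 0"])
qed (use assms in auto)

lemma op_norm_le_sum:
  "T \<in> mat_over n C \<Longrightarrow> op_norm n C T \<le> (\<Sum>i<n. \<Sum>j<n. norm (entry T i j))"
  by (intro op_norm_least col_norm_mat_apply_le)

text \<open>Apply \<open>T\<close> to the column with the unit in place \<open>j\<close> and 0
  elsewhere. Together with \<open>op_norm_le_sum\<close> this makes the operator norm equivalent to
  the norm of \<open>imat\<close>.\<close>

lemma norm_entry_le_op_norm:
  assumes T: "T \<in> mat_over n C" and ij: "i < n" "j < n"
  shows "norm (entry T i j) \<le> op_norm n C T"
proof -
  define x where "x k = (if k = j then e else 0)" for k
  have x: "x k \<in> C" for k by (simp add: x_def closed_rules)
  have "(\<Sum>k<n. adj (x k) * x k) = (\<Sum>k<n. if k = j then e else 0)"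
    by (intro sum.cong) (auto simp: x_def)
  then have "col_norm n x = sqrt (norm e)" using ij by (simp add: col_norm_def)
  then have nx: "col_norm n x \<le> 1" using norm_unit_le by (simp add: real_le_lsqrt)
  have Tx: "mat_apply n T x k = entry T k j" if "k < n" for k
  proof -
    have "mat_apply n T x k = (\<Sum>l<n. if l = j then entry T k l else 0)"
      unfolding mat_apply_def using mat_over_entry(1)[OF T that]
      by (intro sum.cong) (auto simp: x_def unit_right)
    then show ?thesis using ij by simp
  qed
  have "norm (entry T i j) = norm (mat_apply n T x i)" by (simp add: Tx ij)
  also have "\<dots> \<le> col_norm n (mat_apply n T x)"
    using mat_apply_closed[OF T x] ij by (intro norm_le_col_norm)
  also have "\<dots> \<le> op_norm n C T" using x nx by (intro op_norm_upper[OF T])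
  finally show ?thesis .
qed

lemma op_norm_nonneg:
  assumes "T \<in> mat_over n C"
  shows "0 \<le> op_norm n C T"
proof -
  have "0 \<le> col_norm n (mat_apply n T (\<lambda>_. 0))" by (simp add: col_norm_def)
  also have "\<dots> \<le> op_norm n C T"
    by (rule op_norm_upper[OF assms]) (simp_all add: zero_closed col_norm_def)
  finally show ?thesis .
qed

text \<open>Needed for \<open>cdist\<close> of the matrix record to be a metric; it rests on the
  triangle inequality for columns.\<close>

lemma op_norm_add:
  assumes S: "S \<in> mat_over n C" and T: "T \<in> mat_over n C"
  shows "op_norm n C (S + T) \<le> op_norm n C S + op_norm n C T"
proof (rule op_norm_least)
  fix x assume x: "\<And>j. j < n \<Longrightarrow> x j \<in> C" "col_norm n x \<le> 1"
  have "col_norm n (mat_apply n (S + T) x)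
      = col_norm n (\<lambda>i. mat_apply n S x i + mat_apply n T x i)"
    by (simp add: col_norm_def mat_apply_def entry_simps distrib_right sum.distrib)
  also have "\<dots> \<le> col_norm n (mat_apply n S x) + col_norm n (mat_apply n T x)"
    unfolding col_norm_def using mat_apply_closed[OF S x(1)] mat_apply_closed[OF T x(1)]
    by (intro column_triangle) auto
  also have "\<dots> \<le> op_norm n C S + op_norm n C T"
    by (intro add_mono op_norm_upper S T x)
  finally show "col_norm n (mat_apply n (S + T) x) \<le> op_norm n C S + op_norm n C T" .
qed

end

lemma op_norm_minus: "op_norm n C (- T) = op_norm n C T"
proof -
  have "col_norm n (mat_apply n (- T) x) = col_norm n (mat_apply n T x)" for x
    by (simp add: col_norm_def mat_apply_def entry_simps sum_negf adj_minus)
  then show ?thesis by (simp add: op_norm_def)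
qed

text \<open>Components and closures depend on the topology only, so two-sided Lipschitz bounds
  suffice to replace the C*-norm of matrices by the norm of \<open>imat\<close>.\<close>

lemma (in Metric_space) bilipschitz_homeomorphic_map:
  fixes f :: "'a \<Rightarrow> 'b::metric_space"
  assumes K: "0 < K" and le: "\<And>x y. \<lbrakk>x \<in> M; y \<in> M\<rbrakk> \<Longrightarrow> dist (f x) (f y) \<le> K * d x y"
    and ge: "\<And>x y. \<lbrakk>x \<in> M; y \<in> M\<rbrakk> \<Longrightarrow> d x y \<le> K * dist (f x) (f y)"
  shows "homeomorphic_map mtopology (top_of_set (f ` M)) f"
proof (rule bijective_open_imp_homeomorphic_map)
  show "continuous_map mtopology (top_of_set (f ` M)) f"
    unfolding continuous_map_from_metric
  proof (intro conjI ballI allI impI)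
    fix a U assume a: "a \<in> M" and U: "openin (top_of_set (f ` M)) U \<and> f a \<in> U"
    then obtain r where r: "r > 0" "\<And>x. \<lbrakk>x \<in> f ` M; dist x (f a) < r\<rbrakk> \<Longrightarrow> x \<in> U"
      unfolding openin_euclidean_subtopology_iff by blast
    have "f x \<in> U" if "x \<in> M" "d a x < r / K" for x
    proof (rule r(2))
      show "dist (f x) (f a) < r"
        using le[OF a that(1)] that(2) K by (simp add: field_simps dist_commute)
    qed (use that in simp)
    then show "\<exists>r>0. \<forall>x. x \<in> M \<and> d a x < r \<longrightarrow> f x \<in> U"
      using r(1) K by (intro exI[of _ "r / K"]) auto
  qed auto
  show "open_map mtopology (top_of_set (f ` M)) f"
    unfolding open_map_def
  proof (intro allI impI)
    fix U assume U: "openin mtopology U"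
    show "openin (top_of_set (f ` M)) (f ` U)"
      unfolding openin_euclidean_subtopology_iff
    proof (intro conjI ballI)
      show "f ` U \<subseteq> f ` M" using U openin_mtopology by blast
      fix y assume "y \<in> f ` U"
      then obtain a where a: "a \<in> U" "y = f a" by blast
      then obtain r where r: "r > 0" "mball a r \<subseteq> U" using U unfolding openin_mtopology by blast
      have aM: "a \<in> M" using U a openin_mtopology by blast
      have "x' \<in> f ` U" if x': "x' \<in> f ` M" "dist x' y < r / K" for x'
      proof -
        obtain x where x: "x \<in> M" "x' = f x" using x' by blast
        have "d a x \<le> K * dist (f a) (f x)" by (rule ge[OF aM x(1)])
        also have "\<dots> < r" using x'(2) K a x by (simp add: field_simps dist_commute)
        finally have "x \<in> mball a r" using aM x by (simp add: in_mball)
        then show ?thesis using r(2) x by blast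
      qed
      then show "\<exists>e>0. \<forall>x'\<in>f ` M. dist x' y < e \<longrightarrow> x' \<in> f ` U"
        using r(1) K by (intro exI[of _ "r / K"]) auto
    qed
  qed
  show "inj_on f (topspace mtopology)"
  proof (rule inj_onI)
    fix x y assume "x \<in> topspace mtopology" "y \<in> topspace mtopology" "f x = f y"
    then have "x \<in> M" "y \<in> M" "d x y \<le> 0" using ge[of x y] by auto
    then show "x = y" using nonneg[of x y] by (simp add: zero order.antisym)
  qed
qed simp

section \<open>Transfer to matrix algebras of records\<close>

abbreviation alg :: "'a cstar \<Rightarrow> 'a cstar_prod set" where
  "alg B \<equiv> emb B ` carrier B"

definition emb_mat :: "nat \<Rightarrow> 'a cstar \<Rightarrow> (nat \<times> nat \<Rightarrow> 'a) \<Rightarrow> 'a cstar_prod imat" where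
  "emb_mat n B T = mk_mat n (\<lambda>i j. emb B (T (i, j)))"

abbreviation mat_unit :: "nat \<Rightarrow> 'a cstar \<Rightarrow> 'a cstar_prod imat" where
  "mat_unit n B \<equiv> unit_mat n (emb B \<one>\<^bsub>B\<^esub>)"

text \<open>The isomorphism of the unitary group of \<open>M\<^sub>n(B)\<close> with \<^term>\<open>uni (mat_over n (alg B))\<close>.\<close>

definition emb_uni :: "nat \<Rightarrow> 'a cstar \<Rightarrow> (nat \<times> nat \<Rightarrow> 'a) \<Rightarrow> 'a cstar_prod imat" where
  "emb_uni n B u = 1 + (emb_mat n B u - mat_unit n B)"

context
  fixes B :: "'a cstar" and n :: nat
  assumes B: "unital_cstar_algebra B"
begin

interpretation B: unital_cstar_algebra B by (rule B)
interpretation C: cstar_subalgebra "alg B" "emb B \<one>\<^bsub>B\<^esub>" by (rule emb_cstar_subalgebra[OF B])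
interpretation M: star_subalgebra "mat_over n (alg B)" "mat_unit n B"
  by (rule C.mat_over_star_subalgebra)

abbreviation (input) "R \<equiv> matrix_algebra n B"

lemma carrier_mat: "carrier R = {..<n} \<times> {..<n} \<rightarrow>\<^sub>E carrier B"
  by (simp add: matrix_algebra_def)

lemma mat_app_closed: "\<lbrakk>T \<in> carrier R; i < n; j < n\<rbrakk> \<Longrightarrow> T (i, j) \<in> carrier B"
  using PiE_mem[of T "{..<n} \<times> {..<n}" "\<lambda>_. carrier B" "(i, j)"] by (simp add: carrier_mat)

lemma emb_mat_closed: "T \<in> carrier R \<Longrightarrow> emb_mat n B T \<in> mat_over n (alg B)"
  unfolding emb_mat_def by (intro mk_mat_over) (auto intro: mat_app_closed)

lemma emb_mat_inject:
  assumes "S \<in> carrier R" "T \<in> carrier R" "emb_mat n B S = emb_mat n B T"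
  shows "S = T"
proof (rule PiE_ext[OF assms(1,2)[unfolded carrier_mat]])
  fix p assume "p \<in> {..<n} \<times> {..<n}"
  then obtain i j where p: "p = (i, j)" "i < n" "j < n" by blast
  have "entry (emb_mat n B S) i j = entry (emb_mat n B T) i j" using assms(3) by simp
  then show "S p = T p"
    using emb_inject[OF B mat_app_closed[OF assms(1)] mat_app_closed[OF assms(2)]] p
    by (simp add: emb_mat_def)
qed

lemma emb_mat_surj:
  assumes "M \<in> mat_over n (alg B)"
  obtains T where "T \<in> carrier R" "emb_mat n B T = M"
proof
  define T where "T = (\<lambda>(i, j)\<in>{..<n} \<times> {..<n}. inv_into (carrier B) (emb B) (entry M i j))"
  have inv: "inv_into (carrier B) (emb B) (entry M i j) \<in> carrier B"
    "emb B (inv_into (carrier B) (emb B) (entry M i j)) = entry M i j" if "i < n" "j < n" for i j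
    using mat_over_entry(1)[OF assms that] by (auto intro: inv_into_into f_inv_into_f)
  show "T \<in> carrier R" unfolding carrier_mat T_def by (auto intro: inv(1))
  show "emb_mat n B T = M"
    using mat_over_entry(2)[OF assms]
    by (intro imat_eqI) (auto simp: emb_mat_def T_def inv(2))
qed

lemma emb_mat_zero: "emb_mat n B \<zero>\<^bsub>R\<^esub> = 0"
  by (rule imat_eqI) (simp add: emb_mat_def matrix_algebra_def emb_zero[OF B] entry_simps)

lemma emb_mat_one: "emb_mat n B \<one>\<^bsub>R\<^esub> = mat_unit n B"
  by (rule imat_eqI) (auto simp: emb_mat_def unit_mat_def matrix_algebra_def emb_zero[OF B])

lemma emb_mat_add:
  assumes "S \<in> carrier R" "T \<in> carrier R"
  shows "emb_mat n B (S \<oplus>\<^bsub>R\<^esub> T) = emb_mat n B S + emb_mat n B T"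
proof (rule imat_eqI)
  fix i j
  have "emb B ((S \<oplus>\<^bsub>R\<^esub> T) (i, j)) = emb B (S (i, j)) + emb B (T (i, j))" if "i < n" "j < n"
    unfolding emb_add[OF B mat_app_closed[OF assms(1) that] mat_app_closed[OF assms(2) that], symmetric]
    using that by (simp add: matrix_algebra_def)
  then show "entry (emb_mat n B (S \<oplus>\<^bsub>R\<^esub> T)) i j = entry (emb_mat n B S + emb_mat n B T) i j"
    by (simp add: emb_mat_def entry_simps)
qed

lemma emb_mat_star:
  assumes "T \<in> carrier R"
  shows "emb_mat n B (star R T) = adj (emb_mat n B T)"
proof (rule imat_eqI)
  fix i j
  have "emb B (star R T (i, j)) = adj (emb B (T (j, i)))" if "i < n" "j < n"
    unfolding emb_star[OF B mat_app_closed[OF assms that(2,1)], symmetric]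
    using that by (simp add: matrix_algebra_def)
  then show "entry (emb_mat n B (star R T)) i j = entry (adj (emb_mat n B T)) i j"
    by (simp add: emb_mat_def entry_simps)
qed

lemma emb_mat_mult:
  assumes S: "S \<in> carrier R" and T: "T \<in> carrier R"
  shows "emb_mat n B (S \<otimes>\<^bsub>R\<^esub> T) = emb_mat n B S * emb_mat n B T"
proof (rule imat_eqI)
  fix i j
  show "entry (emb_mat n B (S \<otimes>\<^bsub>R\<^esub> T)) i j = entry (emb_mat n B S * emb_mat n B T) i j"
  proof (cases "i < n \<and> j < n")
    case True
    have cl: "S (i, k) \<otimes>\<^bsub>B\<^esub> T (k, j) \<in> carrier B" if "k < n" for k
      using True that S T by (auto intro: mat_app_closed)
    have "entry (emb_mat n B (S \<otimes>\<^bsub>R\<^esub> T)) i j = emb B (\<Oplus>\<^bsub>B\<^esub>k\<in>{..<n}. S (i, k) \<otimes>\<^bsub>B\<^esub> T (k, j))"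
      using True by (simp add: emb_mat_def matrix_algebra_def)
    also have "\<dots> = (\<Sum>k<n. emb B (S (i, k)) * emb B (T (k, j)))"
      using True cl S T by (subst emb_finsum[OF B]) (auto simp: emb_mult[OF B] mat_app_closed)
    also have "\<dots> = entry (emb_mat n B S * emb_mat n B T) i j"
      unfolding entry_times[OF emb_mat_closed[OF S]] using True by (simp add: emb_mat_def)
    finally show ?thesis .
  next
    case False
    have "entry (emb_mat n B S * emb_mat n B T) i j = 0"
      by (rule mat_over_entry(2)[OF M.mult_closed[OF emb_mat_closed[OF S] emb_mat_closed[OF T]] False])
    moreover have "entry (emb_mat n B (S \<otimes>\<^bsub>R\<^esub> T)) i j = 0"
      using False by (auto simp: emb_mat_def)
    ultimately show ?thesis by simp
  qed
qed

lemma mat_add_closed: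
  assumes "S \<in> carrier R" "T \<in> carrier R"
  shows "S \<oplus>\<^bsub>R\<^esub> T \<in> carrier R"
proof -
  have "S (i, j) \<oplus>\<^bsub>B\<^esub> T (i, j) \<in> carrier B" if "i < n" "j < n" for i j
    using assms that by (simp add: mat_app_closed)
  then show ?thesis
    unfolding carrier_mat by (simp add: matrix_algebra_def restrict_PiE_iff) auto
qed

lemma mat_mult_closed:
  assumes "S \<in> carrier R" "T \<in> carrier R"
  shows "S \<otimes>\<^bsub>R\<^esub> T \<in> carrier R"
proof -
  have "(\<Oplus>\<^bsub>B\<^esub>k\<in>{..<n}. S (i, k) \<otimes>\<^bsub>B\<^esub> T (k, j)) \<in> carrier B" if "i < n" "j < n" for i j
    using assms that by (intro B.finsum_closed) (auto simp: mat_app_closed)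
  then show ?thesis
    unfolding carrier_mat by (simp add: matrix_algebra_def restrict_PiE_iff) auto
qed

lemma mat_star_closed:
  assumes "T \<in> carrier R"
  shows "star R T \<in> carrier R"
proof -
  have "star B (T (j, i)) \<in> carrier B" if "i < n" "j < n" for i j
    using assms that by (simp add: mat_app_closed B.star_closed)
  then show ?thesis
    unfolding carrier_mat by (simp add: matrix_algebra_def restrict_PiE_iff) auto
qed

lemma mat_zero_closed: "\<zero>\<^bsub>R\<^esub> \<in> carrier R"
  unfolding carrier_mat by (simp add: matrix_algebra_def restrict_PiE_iff)

lemma mat_one_closed: "\<one>\<^bsub>R\<^esub> \<in> carrier R"
  unfolding carrier_mat by (simp add: matrix_algebra_def restrict_PiE_iff) auto

lemma abelian_group_mat: "abelian_group R"
proof (rule abelian_groupI)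
  fix S T U assume STU: "S \<in> carrier R" "T \<in> carrier R" "U \<in> carrier R"
  show "S \<oplus>\<^bsub>R\<^esub> T \<oplus>\<^bsub>R\<^esub> U = S \<oplus>\<^bsub>R\<^esub> (T \<oplus>\<^bsub>R\<^esub> U)"
    using STU by (intro emb_mat_inject) (auto simp: emb_mat_add mat_add_closed add.assoc)
  show "S \<oplus>\<^bsub>R\<^esub> T = T \<oplus>\<^bsub>R\<^esub> S"
    using STU by (intro emb_mat_inject) (auto simp: emb_mat_add mat_add_closed add.commute)
next
  fix T assume T: "T \<in> carrier R"
  show "\<zero>\<^bsub>R\<^esub> \<oplus>\<^bsub>R\<^esub> T = T"
    using T by (intro emb_mat_inject) (auto simp: emb_mat_add mat_add_closed mat_zero_closed emb_mat_zero)
  obtain S where S: "S \<in> carrier R" "emb_mat n B S = - emb_mat n B T"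
    using emb_mat_surj[OF M.minus_closed[OF emb_mat_closed[OF T]]] by blast
  then have "S \<oplus>\<^bsub>R\<^esub> T = \<zero>\<^bsub>R\<^esub>"
    using T by (intro emb_mat_inject) (auto simp: emb_mat_add mat_add_closed mat_zero_closed emb_mat_zero)
  then show "\<exists>S\<in>carrier R. S \<oplus>\<^bsub>R\<^esub> T = \<zero>\<^bsub>R\<^esub>" using S by blast
qed (auto simp: mat_add_closed mat_zero_closed)

interpretation R: abelian_group R by (rule abelian_group_mat)

lemma emb_mat_diff:
  assumes S: "S \<in> carrier R" and T: "T \<in> carrier R"
  shows "emb_mat n B (S \<ominus>\<^bsub>R\<^esub> T) = emb_mat n B S - emb_mat n B T"
proof -
  have "emb_mat n B (S \<ominus>\<^bsub>R\<^esub> T) + emb_mat n B T = emb_mat n B (S \<ominus>\<^bsub>R\<^esub> T \<oplus>\<^bsub>R\<^esub> T)"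
    using S T by (simp add: emb_mat_add)
  also have "S \<ominus>\<^bsub>R\<^esub> T \<oplus>\<^bsub>R\<^esub> T = S"
    using S T by (simp add: a_minus_def R.a_assoc R.l_neg)
  finally show ?thesis by (simp add: eq_diff_eq)
qed

lemma matrix_norm_eq:
  assumes T: "T \<in> carrier R"
  shows "matrix_norm n B T = op_norm n (alg B) (emb_mat n B T)"
proof -
  have cn: "column_norm n B y = col_norm n (\<lambda>i. emb B (y i))" if "\<And>i. i < n \<Longrightarrow> y i \<in> carrier B" for y
  proof -
    have "emb B (\<Oplus>\<^bsub>B\<^esub>i\<in>{..<n}. star B (y i) \<otimes>\<^bsub>B\<^esub> y i) = (\<Sum>i<n. adj (emb B (y i)) * emb B (y i))"
      using that by (subst emb_finsum[OF B]) (auto simp: emb_mult[OF B] emb_star[OF B] B.star_closed)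
    moreover have "(\<Oplus>\<^bsub>B\<^esub>i\<in>{..<n}. star B (y i) \<otimes>\<^bsub>B\<^esub> y i) \<in> carrier B"
      using that by (intro B.finsum_closed) (auto simp: B.star_closed)
    ultimately show ?thesis
      unfolding column_norm_def col_norm_def by (simp flip: norm_emb[OF B])
  qed
  have ap: "emb B (\<Oplus>\<^bsub>B\<^esub>j\<in>{..<n}. T (i, j) \<otimes>\<^bsub>B\<^esub> x j) = mat_apply n (emb_mat n B T) (\<lambda>j. emb B (x j)) i"
    "(\<Oplus>\<^bsub>B\<^esub>j\<in>{..<n}. T (i, j) \<otimes>\<^bsub>B\<^esub> x j) \<in> carrier B"
    if x: "\<And>j. j < n \<Longrightarrow> x j \<in> carrier B" and i: "i < n" for x i
  proof -
    have cl: "T (i, j) \<otimes>\<^bsub>B\<^esub> x j \<in> carrier B" if "j < n" for j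
      using x i that T by (auto intro: mat_app_closed)
    show "emb B (\<Oplus>\<^bsub>B\<^esub>j\<in>{..<n}. T (i, j) \<otimes>\<^bsub>B\<^esub> x j) = mat_apply n (emb_mat n B T) (\<lambda>j. emb B (x j)) i"
      using x i T cl unfolding mat_apply_def
      by (subst emb_finsum[OF B]) (auto simp: emb_mult[OF B] mat_app_closed emb_mat_def)
    show "(\<Oplus>\<^bsub>B\<^esub>j\<in>{..<n}. T (i, j) \<otimes>\<^bsub>B\<^esub> x j) \<in> carrier B"
      using cl by (intro B.finsum_closed) auto
  qed
  have cn_ap: "column_norm n B (\<lambda>i. \<Oplus>\<^bsub>B\<^esub>j\<in>{..<n}. T (i, j) \<otimes>\<^bsub>B\<^esub> x j)
      = col_norm n (mat_apply n (emb_mat n B T) (\<lambda>j. emb B (x j)))"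
    if x: "\<And>j. j < n \<Longrightarrow> x j \<in> carrier B" for x
    using ap[OF x] by (subst cn) (auto simp: col_norm_def)
  have "{column_norm n B (\<lambda>i. \<Oplus>\<^bsub>B\<^esub>j\<in>{..<n}. T (i, j) \<otimes>\<^bsub>B\<^esub> x j) |x.
          x \<in> {..<n} \<rightarrow>\<^sub>E carrier B \<and> column_norm n B x \<le> 1}
      = {col_norm n (mat_apply n (emb_mat n B T) x) |x. (\<forall>j<n. x j \<in> alg B) \<and> col_norm n x \<le> 1}"
    (is "?L = ?R")
  proof (intro equalityI subsetI)
    fix r assume "r \<in> ?L"
    then obtain x where x: "x \<in> {..<n} \<rightarrow>\<^sub>E carrier B" "column_norm n B x \<le> 1"
      "r = column_norm n B (\<lambda>i. \<Oplus>\<^bsub>B\<^esub>j\<in>{..<n}. T (i, j) \<otimes>\<^bsub>B\<^esub> x j)" by blast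
    have xc: "\<And>j. j < n \<Longrightarrow> x j \<in> carrier B" using x(1) by auto
    have "r = col_norm n (mat_apply n (emb_mat n B T) (\<lambda>j. emb B (x j)))"
      "col_norm n (\<lambda>j. emb B (x j)) \<le> 1" "\<forall>j<n. emb B (x j) \<in> alg B"
      using x(2,3) xc cn_ap[of x] cn[of x] by simp_all
    then show "r \<in> ?R" by blast
  next
    fix r assume "r \<in> ?R"
    then obtain y where y: "\<forall>j<n. y j \<in> alg B" "col_norm n y \<le> 1"
      "r = col_norm n (mat_apply n (emb_mat n B T) y)" by blast
    then have "\<forall>j. \<exists>a. j < n \<longrightarrow> a \<in> carrier B \<and> y j = emb B a" by blast
    then obtain a where a: "\<And>j. j < n \<Longrightarrow> a j \<in> carrier B \<and> y j = emb B (a j)" by metis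
    define x where "x = restrict a {..<n}"
    have xc: "\<And>j. j < n \<Longrightarrow> x j \<in> carrier B" and xy: "\<And>j. j < n \<Longrightarrow> emb B (x j) = y j"
      using a by (auto simp: x_def)
    have 1: "col_norm n (\<lambda>j. emb B (x j)) = col_norm n y"
      using xy by (simp add: col_norm_def)
    have "mat_apply n (emb_mat n B T) (\<lambda>j. emb B (x j)) = mat_apply n (emb_mat n B T) y"
      using xy by (intro ext) (simp add: mat_apply_def)
    then have "r = column_norm n B (\<lambda>i. \<Oplus>\<^bsub>B\<^esub>j\<in>{..<n}. T (i, j) \<otimes>\<^bsub>B\<^esub> x j)"
      using y(3) cn_ap[OF xc] by simp
    moreover have "x \<in> {..<n} \<rightarrow>\<^sub>E carrier B" using a by (auto simp: x_def)
    moreover have "column_norm n B x \<le> 1" using cn[OF xc] 1 y(2) by simp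
    ultimately show "r \<in> ?L" by blast
  qed
  then show ?thesis by (simp add: matrix_norm_def op_norm_def)
qed

lemma cdist_mat:
  assumes "S \<in> carrier R" "T \<in> carrier R"
  shows "cdist R S T = op_norm n (alg B) (emb_mat n B S - emb_mat n B T)"
proof -
  have "S \<ominus>\<^bsub>R\<^esub> T \<in> carrier R" using assms by simp
  moreover have "cnorm R = matrix_norm n B" by (simp add: matrix_algebra_def)
  ultimately show ?thesis
    using assms by (simp add: cdist_def matrix_norm_eq emb_mat_diff)
qed

lemma op_norm_eq_0:
  assumes T: "T \<in> mat_over n (alg B)" and "op_norm n (alg B) T = 0"
  shows "T = 0"
proof (rule imat_eqI)
  fix i j
  show "entry T i j = entry 0 i j"
    using C.norm_entry_le_op_norm[OF T, of i j] mat_over_entry(2)[OF T, of i j] assms(2)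
    by (cases "i < n \<and> j < n") (auto simp: entry_simps)
qed

text \<open>Opens the facts about \<open>mtopology\<close> for the matrix record, whose metric is
  read off from the operator norm of the embedded matrices.\<close>

lemma metric_space_mat: "Metric_space (carrier R) (cdist R)"
proof
  note cl = emb_mat_closed M.diff_closed
  have nn: "0 \<le> cdist R S T" for S T
  proof (cases "S \<in> carrier R \<and> T \<in> carrier R")
    case True
    then show ?thesis by (simp add: cdist_mat C.op_norm_nonneg cl)
  qed (auto simp: cdist_def)
  then show "0 \<le> cdist R S T" for S T .
  show "cdist R S T = cdist R T S" for S T
  proof (cases "S \<in> carrier R \<and> T \<in> carrier R")
    case True
    then show ?thesis
      using op_norm_minus[of n "alg B" "emb_mat n B S - emb_mat n B T"] by (simp add: cdist_mat)
  qed (auto simp: cdist_def)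
  show "cdist R S T = 0 \<longleftrightarrow> S = T" if ST: "S \<in> carrier R" "T \<in> carrier R" for S T
  proof
    assume "cdist R S T = 0"
    then have "emb_mat n B S - emb_mat n B T = 0"
      using ST by (intro op_norm_eq_0) (auto simp: cdist_mat cl)
    then show "S = T" using ST by (intro emb_mat_inject) auto
  next
    assume "S = T"
    moreover have "op_norm n (alg B) 0 \<le> 0"
      using C.op_norm_le_sum[OF M.zero_closed] by (simp add: entry_simps)
    ultimately show "cdist R S T = 0" using ST nn[of S T] by (simp add: cdist_mat)
  qed
  show "cdist R S U \<le> cdist R S T + cdist R T U"
    if "S \<in> carrier R" "T \<in> carrier R" "U \<in> carrier R" for S T U
    using that C.op_norm_add[OF cl(2)[OF cl(1)[of S] cl(1)[of T]] cl(2)[OF cl(1)[of T] cl(1)[of U]]]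
    by (simp add: cdist_mat)
qed

lemma homeomorphic_emb_uni:
  "homeomorphic_map (norm_topology R) (top_of_set (emb_uni n B ` carrier R)) (emb_uni n B)"
proof -
  interpret m: Metric_space "carrier R" "cdist R" by (rule metric_space_mat)
  \<comment> \<open>Both comparisons pass through the \<open>n * n\<close> entries; the summand 1
    keeps \<open>K\<close> positive for \<open>n = 0\<close>.\<close>
  define K where "K = real n * real n + 1"
  have dist: "dist (emb_uni n B S) (emb_uni n B T) = norm (emb_mat n B S - emb_mat n B T)" for S T
    by (simp add: dist_norm emb_uni_def)
  have sum_le: "(\<Sum>i<n. \<Sum>j<n. norm (entry T i j)) \<le> real n * real n * b"
    if "\<And>i j. \<lbrakk>i < n; j < n\<rbrakk> \<Longrightarrow> norm (entry T i j) \<le> b" for T :: "'a cstar_prod imat" and b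
  proof -
    have "(\<Sum>j<n. norm (entry T i j)) \<le> real n * b" if "i < n" for i
      using sum_bounded_above[of "{..<n}" "\<lambda>j. norm (entry T i j)" b] \<open>\<And>i j. \<lbrakk>i < n; j < n\<rbrakk> \<Longrightarrow> norm (entry T i j) \<le> b\<close> that
      by simp
    then show ?thesis
      using sum_bounded_above[of "{..<n}" "\<lambda>i. \<Sum>j<n. norm (entry T i j)" "real n * b"] by simp
  qed
  have nK: "real n * real n * b \<le> K * b" if "0 \<le> b" for b
    using that by (simp add: K_def algebra_simps)
  have "homeomorphic_map m.mtopology (top_of_set (emb_uni n B ` carrier R)) (emb_uni n B)"
  proof (rule m.bilipschitz_homeomorphic_map)
    show "0 < K" by (simp add: K_def add_nonneg_pos)
    fix S T assume ST: "S \<in> carrier R" "T \<in> carrier R"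
    define D where "D = emb_mat n B S - emb_mat n B T"
    have D: "D \<in> mat_over n (alg B)" using ST by (simp add: D_def emb_mat_closed M.diff_closed)
    have "norm D \<le> (\<Sum>i<n. \<Sum>j<n. norm (entry D i j))" by (rule norm_mat_over_le[OF D])
    also have "\<dots> \<le> real n * real n * op_norm n (alg B) D"
      using C.norm_entry_le_op_norm[OF D] by (rule sum_le)
    also have "\<dots> \<le> K * op_norm n (alg B) D" by (rule nK[OF C.op_norm_nonneg[OF D]])
    finally show "dist (emb_uni n B S) (emb_uni n B T) \<le> K * cdist R S T"
      using ST by (simp add: dist cdist_mat D_def)
    have "op_norm n (alg B) D \<le> (\<Sum>i<n. \<Sum>j<n. norm (entry D i j))" by (rule C.op_norm_le_sum[OF D])
    also have "\<dots> \<le> real n * real n * norm D" using norm_entry_le by (rule sum_le)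
    also have "\<dots> \<le> K * norm D" by (rule nK) simp
    finally show "cdist R S T \<le> K * dist (emb_uni n B S) (emb_uni n B T)"
      using ST by (simp add: dist cdist_mat D_def)
  qed
  then show ?thesis by (simp add: norm_topology_def)
qed

end

section \<open>Transfer of the unitary groups\<close>

context
  fixes B :: "'a cstar" and n :: nat
  assumes B: "unital_cstar_algebra B"
begin

interpretation C: cstar_subalgebra "alg B" "emb B \<one>\<^bsub>B\<^esub>" by (rule emb_cstar_subalgebra[OF B])
interpretation M: star_subalgebra "mat_over n (alg B)" "mat_unit n B"
  by (rule C.mat_over_star_subalgebra)

abbreviation (input) "MB \<equiv> matrix_algebra n B"

lemma emb_uni_one: "emb_uni n B \<one>\<^bsub>MB\<^esub> = 1"
  by (simp add: emb_uni_def emb_mat_one[OF B])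

lemma emb_uni_inj: "inj_on (emb_uni n B) (carrier MB)"
  by (rule inj_onI) (simp add: emb_uni_def emb_mat_inject[OF B])

lemma emb_uni_mult:
  assumes "S \<in> carrier MB" "T \<in> carrier MB"
  shows "emb_uni n B (S \<otimes>\<^bsub>MB\<^esub> T) = emb_uni n B S * emb_uni n B T"
  using emb_mat_closed[OF B assms(1)] emb_mat_closed[OF B assms(2)]
  by (simp add: emb_uni_def emb_mat_mult[OF B assms] algebra_simps M.unit_left M.unit_right)

lemma emb_uni_star: "T \<in> carrier MB \<Longrightarrow> emb_uni n B (star MB T) = adj (emb_uni n B T)"
  by (simp add: emb_uni_def emb_mat_star[OF B] adj_simps)

lemma emb_uni_image: "emb_uni n B ` carrier MB = {w. w - 1 \<in> mat_over n (alg B)}"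
proof (intro equalityI subsetI)
  fix w assume "w \<in> {w. w - 1 \<in> mat_over n (alg B)}"
  then have "w - 1 + mat_unit n B \<in> mat_over n (alg B)" by (simp add: M.add_closed M.unit_closed)
  then obtain T where "T \<in> carrier MB" "emb_mat n B T = w - 1 + mat_unit n B"
    using emb_mat_surj[OF B] by blast
  then show "w \<in> emb_uni n B ` carrier MB"
    by (intro image_eqI[of _ _ T]) (auto simp: emb_uni_def)
qed (auto simp: emb_uni_def emb_mat_closed[OF B] M.diff_closed M.unit_closed)

lemma emb_uni_unitary:
  assumes u: "u \<in> carrier MB"
  shows "u \<in> carrier (unitary_group MB) \<longleftrightarrow> emb_uni n B u \<in> uni (mat_over n (alg B))"
proof -
  have iff: "S = T \<longleftrightarrow> emb_uni n B S = emb_uni n B T" if "S \<in> carrier MB" "T \<in> carrier MB" for S T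
    using inj_onD[OF emb_uni_inj _ that] by blast
  have "emb_uni n B u - 1 \<in> mat_over n (alg B)" using emb_uni_image u by blast
  then show ?thesis
    using u mat_star_closed[OF B u] mat_one_closed[OF B]
    by (simp add: unitary_group_def uni_def iff mat_mult_closed[OF B] emb_uni_mult emb_uni_star emb_uni_one)
qed

lemma carrier_U0_subset: "carrier (U0 MB) \<subseteq> carrier (unitary_group MB)" "carrier (U0 MB) \<subseteq> carrier MB"
proof -
  have "carrier (U0 MB) \<subseteq> topspace (subtopology (norm_topology MB) (carrier (unitary_group MB)))"
    using connected_component_of_subset_topspace
      [of "subtopology (norm_topology MB) (carrier (unitary_group MB))" "\<one>\<^bsub>MB\<^esub>"]
    by (simp add: U0_def)
  then show "carrier (U0 MB) \<subseteq> carrier (unitary_group MB)" by auto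
  then show "carrier (U0 MB) \<subseteq> carrier MB" by (auto simp: unitary_group_def)
qed

lemma topspace_norm_topology: "topspace (norm_topology MB) = carrier MB"
  using Metric_space.topspace_mtopology[OF metric_space_mat[OF B]] by (simp add: norm_topology_def)

lemma emb_uni_U0: "emb_uni n B ` carrier (U0 MB) = uni0 (mat_over n (alg B))"
proof -
  let ?U = "carrier (unitary_group MB)" and ?S = "emb_uni n B ` carrier MB" and ?M = "mat_over n (alg B)"
  have US: "uni ?M \<subseteq> ?S" unfolding emb_uni_image by (auto simp: uni_def)
  have U: "?U \<subseteq> carrier MB" by (auto simp: unitary_group_def)
  have im: "emb_uni n B ` ?U = uni ?M"
  proof (intro equalityI subsetI)
    fix w assume w: "w \<in> uni ?M"
    then obtain u where "u \<in> carrier MB" "w = emb_uni n B u" using US by blast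
    then show "w \<in> emb_uni n B ` ?U" using emb_uni_unitary w by blast
  qed (use U emb_uni_unitary in blast)
  have "emb_uni n B ` (topspace (norm_topology MB) \<inter> ?U) = topspace (top_of_set ?S) \<inter> uni ?M"
    using U US by (simp add: topspace_norm_topology Int_absorb1 im)
  then have hm: "homeomorphic_map (subtopology (norm_topology MB) ?U)
      (subtopology (top_of_set ?S) (uni ?M)) (emb_uni n B)"
    by (rule homeomorphic_map_subtopologies[OF homeomorphic_emb_uni[OF B]])
  have "\<one>\<^bsub>MB\<^esub> \<in> ?U"
    using emb_uni_unitary[OF mat_one_closed[OF B]] M.one_uni by (simp add: emb_uni_one)
  then have "\<one>\<^bsub>MB\<^esub> \<in> topspace (subtopology (norm_topology MB) ?U)"
    using mat_one_closed[OF B] by (simp add: topspace_norm_topology)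
  from homeomorphic_map_connected_component_of[OF hm this]
  have "emb_uni n B ` carrier (U0 MB) = connected_component_of_set (subtopology (top_of_set ?S) (uni ?M)) 1"
    by (simp add: emb_uni_one U0_def)
  also have "subtopology (top_of_set ?S) (uni ?M) = top_of_set (uni ?M)"
    using US by (simp add: subtopology_subtopology Int_absorb1)
  also have "connected_component_of_set (top_of_set (uni ?M)) 1 = uni0 ?M"
    by (auto simp: uni0_def connected_component_of_def connected_component_def connectedin_subtopology)
  finally show ?thesis .
qed

lemma mem_U0: "u \<in> carrier MB \<Longrightarrow> u \<in> carrier (U0 MB) \<longleftrightarrow> emb_uni n B u \<in> uni0 (mat_over n (alg B))"
  unfolding emb_uni_U0[symmetric]
  using inj_on_image_mem_iff[OF emb_uni_inj _ carrier_U0_subset(2)] by blast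

lemma U0_mult: "mult (U0 MB) = mult MB" and U0_one: "\<one>\<^bsub>U0 MB\<^esub> = \<one>\<^bsub>MB\<^esub>"
  by (simp_all add: U0_def unitary_group_def)

text \<open>The group laws are pulled back along the injective multiplicative map
  \<open>emb_uni\<close>, under which inverses are adjoints.\<close>

lemma group_U0: "group (U0 MB)"
proof (rule groupI)
  note cl = subsetD[OF carrier_U0_subset(2)]
  fix u v w assume u: "u \<in> carrier (U0 MB)" and v: "v \<in> carrier (U0 MB)" and w: "w \<in> carrier (U0 MB)"
  note m = mat_mult_closed[OF B]
  show "u \<otimes>\<^bsub>U0 MB\<^esub> v \<in> carrier (U0 MB)"
    using u v cl mem_U0[OF cl[OF u]] mem_U0[OF cl[OF v]] mem_U0[OF m[OF cl[OF u] cl[OF v]]]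
    by (simp add: U0_mult emb_uni_mult M.mult_uni0)
  show "u \<otimes>\<^bsub>U0 MB\<^esub> v \<otimes>\<^bsub>U0 MB\<^esub> w = u \<otimes>\<^bsub>U0 MB\<^esub> (v \<otimes>\<^bsub>U0 MB\<^esub> w)"
    using cl[OF u] cl[OF v] cl[OF w]
    by (intro inj_onD[OF emb_uni_inj]) (simp_all add: U0_mult m emb_uni_mult mult.assoc)
next
  note cl = subsetD[OF carrier_U0_subset(2)]
  show "\<one>\<^bsub>U0 MB\<^esub> \<in> carrier (U0 MB)"
    using mat_one_closed[OF B] by (simp add: U0_one mem_U0 emb_uni_one M.one_uni0)
  fix u assume u: "u \<in> carrier (U0 MB)"
  show "\<one>\<^bsub>U0 MB\<^esub> \<otimes>\<^bsub>U0 MB\<^esub> u = u"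
    using cl[OF u] mat_one_closed[OF B]
    by (intro inj_onD[OF emb_uni_inj]) (simp_all add: U0_mult U0_one mat_mult_closed[OF B] emb_uni_mult emb_uni_one)
  have "emb_uni n B u \<in> uni0 (mat_over n (alg B))" using mem_U0 cl[OF u] u by blast
  then have "adj (emb_uni n B u) * emb_uni n B u = 1" "adj (emb_uni n B u) \<in> uni0 (mat_over n (alg B))"
    using uni_adj_left uni0_subset M.adj_uni0 by blast+
  then have "star MB u \<in> carrier (U0 MB)" "star MB u \<otimes>\<^bsub>MB\<^esub> u = \<one>\<^bsub>MB\<^esub>"
    using cl[OF u] mat_star_closed[OF B cl[OF u]] mat_one_closed[OF B]
    by (auto simp: mem_U0 emb_uni_star mat_mult_closed[OF B] emb_uni_mult emb_uni_one
        intro!: inj_onD[OF emb_uni_inj])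
  then show "\<exists>v\<in>carrier (U0 MB). v \<otimes>\<^bsub>U0 MB\<^esub> u = \<one>\<^bsub>U0 MB\<^esub>"
    by (auto simp: U0_mult U0_one)
qed

lemma group_hom_emb_uni: "group_hom (U0 MB) (uni0_group (mat_over n (alg B))) (emb_uni n B)"
proof (intro group_hom.intro group_hom_axioms.intro homI)
  fix u v assume "u \<in> carrier (U0 MB)" "v \<in> carrier (U0 MB)"
  then have "u \<in> carrier MB" "v \<in> carrier MB" using carrier_U0_subset(2) by blast+
  then show "emb_uni n B (u \<otimes>\<^bsub>U0 MB\<^esub> v)
      = emb_uni n B u \<otimes>\<^bsub>uni0_group (mat_over n (alg B))\<^esub> emb_uni n B v"
    by (simp add: uni0_group_def U0_mult emb_uni_mult)
next
  fix u assume "u \<in> carrier (U0 MB)"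
  then show "emb_uni n B u \<in> carrier (uni0_group (mat_over n (alg B)))"
    using emb_uni_U0 by (auto simp: uni0_group_def)
qed (rule group_U0 M.group_uni0)+

lemma emb_uni_inv:
  assumes "u \<in> carrier (U0 MB)"
  shows "emb_uni n B (inv\<^bsub>U0 MB\<^esub> u) = adj (emb_uni n B u)"
proof -
  have "emb_uni n B u \<in> uni0 (mat_over n (alg B))" using assms emb_uni_U0 by blast
  then show ?thesis
    using group_hom.hom_inv[OF group_hom_emb_uni assms] by (simp add: M.inv_uni0)
qed

lemma emb_uni_CU: "emb_uni n B ` CU MB = cl_comm_uni (mat_over n (alg B))"
  and CU_subset: "CU MB \<subseteq> carrier MB"
proof -
  let ?D = "derived (U0 MB) (carrier (U0 MB))" and ?S = "emb_uni n B ` carrier MB"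
  let ?M = "mat_over n (alg B)"
  have D: "emb_uni n B ` ?D = comm_uni ?M"
    using group_hom.derived_img[OF group_hom_emb_uni, of "carrier (U0 MB)"]
    by (simp add: emb_uni_U0 comm_uni_def)
  have "?D \<subseteq> carrier (U0 MB)" using group.derived_in_carrier[OF group_U0] by blast
  then have "?D \<subseteq> topspace (norm_topology MB)"
    using carrier_U0_subset(2) by (auto simp: topspace_norm_topology)
  from homeomorphic_map_closure_of[OF homeomorphic_emb_uni[OF B] this]
  have "emb_uni n B ` CU MB = top_of_set ?S closure_of comm_uni ?M"
    by (simp add: CU_def D)
  also have "\<dots> = closure (comm_uni ?M)"
  proof -
    have "cl_comm_uni ?M \<subseteq> ?S"
      using M.cl_comm_uni_subset uni0_subset[of ?M] unfolding emb_uni_image by (auto simp: uni_def)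
    then show ?thesis
      unfolding closure_of_subtopology cl_comm_uni_def using closure_subset[of "comm_uni ?M"]
      by (simp add: Int_absorb1 Int_absorb2)
  qed
  finally show "emb_uni n B ` CU MB = cl_comm_uni ?M" by (simp add: cl_comm_uni_def)
  show "CU MB \<subseteq> carrier MB"
    unfolding CU_def using closure_of_subset_topspace[of "norm_topology MB"]
    by (simp add: topspace_norm_topology)
qed

lemma mem_CU: "u \<in> carrier MB \<Longrightarrow> u \<in> CU MB \<longleftrightarrow> emb_uni n B u \<in> cl_comm_uni (mat_over n (alg B))"
  unfolding emb_uni_CU[symmetric]
  using inj_on_image_mem_iff[OF emb_uni_inj _ CU_subset] by blast

lemma normal_CU: "CU MB \<lhd> U0 MB"
proof (rule group.normal_invI[OF group_U0])
  note cl = subsetD[OF carrier_U0_subset(2)] subsetD[OF CU_subset]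
  note m = U0_mult mat_mult_closed[OF B] emb_uni_mult
  have sub: "CU MB \<subseteq> carrier (U0 MB)"
    using mem_CU mem_U0 CU_subset M.cl_comm_uni_subset by blast
  have inv_cl: "inv\<^bsub>U0 MB\<^esub> u \<in> carrier MB" if "u \<in> carrier (U0 MB)" for u
    using group.inv_closed[OF group_U0 that] cl(1) by blast
  show "subgroup (CU MB) (U0 MB)"
  proof (rule group.subgroupI[OF group_U0 sub])
    show "CU MB \<noteq> {}" using emb_uni_CU M.one_cl_comm_uni by blast
    fix u assume u: "u \<in> CU MB"
    then have "u \<in> carrier (U0 MB)" using sub by blast
    then show "inv\<^bsub>U0 MB\<^esub> u \<in> CU MB"
      using u mem_CU[of u] cl by (simp add: mem_CU inv_cl emb_uni_inv M.adj_cl_comm_uni)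
    fix v assume v: "v \<in> CU MB"
    have "emb_uni n B u * emb_uni n B v \<in> cl_comm_uni (mat_over n (alg B))"
      using mem_CU cl(2) u v by (intro M.mult_cl_comm_uni) blast+
    then show "u \<otimes>\<^bsub>U0 MB\<^esub> v \<in> CU MB"
      using mem_CU[OF m(2)[OF cl(2)[OF u] cl(2)[OF v]]] emb_uni_mult[OF cl(2)[OF u] cl(2)[OF v]]
      by (simp add: U0_mult)
  qed
  fix u d assume u: "u \<in> carrier (U0 MB)" and d: "d \<in> CU MB"
  have c: "u \<in> carrier MB" "d \<in> carrier MB" "inv\<^bsub>U0 MB\<^esub> u \<in> carrier MB" "u \<otimes>\<^bsub>MB\<^esub> d \<in> carrier MB"
    using cl u d inv_cl m(2) by blast+
  have "emb_uni n B u * emb_uni n B d * adj (emb_uni n B u) \<in> cl_comm_uni (mat_over n (alg B))"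
    using mem_U0 mem_CU c u d by (intro M.conj_cl_comm_uni) blast+
  then show "u \<otimes>\<^bsub>U0 MB\<^esub> d \<otimes>\<^bsub>U0 MB\<^esub> inv\<^bsub>U0 MB\<^esub> u \<in> CU MB"
    using mem_CU[OF m(2)[OF c(4,3)]] emb_uni_mult[OF c(4,3)] emb_uni_mult[OF c(1,2)] emb_uni_inv[OF u]
    by (simp add: U0_mult)
qed

end

section \<open>The maps between the quotients\<close>

text \<open>Since \<open>h\<close> maps \<open>N\<close> into \<open>N'\<close>, all representatives
  of a coset have the same image coset, which \<open>the_elem\<close> selects. Being an isomorphism
  then amounts to a condition on the kernel and surjectivity modulo \<open>N'\<close>, both stated
  for elements so that cosets do not appear later.\<close>

lemma
  assumes G: "N \<lhd> G" and G': "N' \<lhd> G'" and h: "h \<in> hom G G'" and hN: "h ` N \<subseteq> N'"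
  defines "i \<equiv> \<lambda>K. the_elem ((\<lambda>u. N' #>\<^bsub>G'\<^esub> h u) ` K)"
  shows quotient_map_iso_imp: "i \<in> iso (G Mod N) (G' Mod N') \<Longrightarrow> u \<in> carrier G \<Longrightarrow> h u \<in> N' \<Longrightarrow> u \<in> N"
    and quotient_map_isoI: "\<lbrakk>\<And>u. \<lbrakk>u \<in> carrier G; h u \<in> N'\<rbrakk> \<Longrightarrow> u \<in> N;
      \<And>v. v \<in> carrier G' \<Longrightarrow> \<exists>u\<in>carrier G. v \<in> N' #>\<^bsub>G'\<^esub> h u\<rbrakk> \<Longrightarrow> i \<in> iso (G Mod N) (G' Mod N')"
proof -
  interpret N: normal N G by fact
  interpret N': normal N' G' by fact
  have hc: "h u \<in> carrier G'" if "u \<in> carrier G" for u using h that by (auto simp: hom_def)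
  have i_coset: "i (N #>\<^bsub>G\<^esub> u) = N' #>\<^bsub>G'\<^esub> h u" if u: "u \<in> carrier G" for u
  proof -
    have "N' #>\<^bsub>G'\<^esub> h w = N' #>\<^bsub>G'\<^esub> h u" if w: "w \<in> N #>\<^bsub>G\<^esub> u" for w
    proof -
      obtain d where d: "d \<in> N" "w = d \<otimes>\<^bsub>G\<^esub> u" using w by (auto simp: r_coset_def)
      have "h w = h d \<otimes>\<^bsub>G'\<^esub> h u" using hom_mult[OF h N.mem_carrier[OF d(1)] u] d(2) by simp
      then have "h w \<in> N' #>\<^bsub>G'\<^esub> h u" using hN d(1) by (auto simp: r_coset_def)
      then show ?thesis using N'.repr_independence[OF _ hc[OF u] N'.is_subgroup] by simp
    qed
    moreover have "u \<in> N #>\<^bsub>G\<^esub> u" using N.rcos_self[OF u N.is_subgroup] .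
    ultimately have "(\<lambda>u. N' #>\<^bsub>G'\<^esub> h u) ` (N #>\<^bsub>G\<^esub> u) = {N' #>\<^bsub>G'\<^esub> h u}" by blast
    then show ?thesis by (simp add: i_def)
  qed
  have coset_N: "N' #>\<^bsub>G'\<^esub> h u = N' \<longleftrightarrow> h u \<in> N'" if "u \<in> carrier G" for u
    using N'.coset_join1[OF _ hc[OF that] N'.is_subgroup] N'.coset_join2[OF hc[OF that] N'.is_subgroup]
    by blast
  have carr: "N #>\<^bsub>G\<^esub> u \<in> carrier (G Mod N)" if "u \<in> carrier G" for u
    using that by (auto simp: FactGroup_def RCOSETS_def)
  {
    assume iso: "i \<in> iso (G Mod N) (G' Mod N')" and u: "u \<in> carrier G" "h u \<in> N'"
    have "i (N #>\<^bsub>G\<^esub> \<one>\<^bsub>G\<^esub>) = N'"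
      using i_coset[OF N.one_closed] coset_N[OF N.one_closed] h N'.one_closed
      by (metis N'.is_group N.is_group hom_one N'.subgroup_axioms subgroup.one_closed)
    moreover have "i (N #>\<^bsub>G\<^esub> u) = N'" using i_coset[OF u(1)] coset_N[OF u(1)] u(2) by simp
    moreover have "inj_on i (carrier (G Mod N))" using iso by (auto simp: iso_def bij_betw_def)
    ultimately have "N #>\<^bsub>G\<^esub> u = N #>\<^bsub>G\<^esub> \<one>\<^bsub>G\<^esub>"
      using carr[OF u(1)] carr[OF N.one_closed] by (metis inj_onD)
    then show "u \<in> N"
      using N.rcos_self[OF u(1) N.is_subgroup] by (simp add: N.coset_mult_one N.subset)
  }
  {
    assume inj: "\<And>u. \<lbrakk>u \<in> carrier G; h u \<in> N'\<rbrakk> \<Longrightarrow> u \<in> N"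
      and surj: "\<And>v. v \<in> carrier G' \<Longrightarrow> \<exists>u\<in>carrier G. v \<in> N' #>\<^bsub>G'\<^esub> h u"
    have cosets: "\<exists>u\<in>carrier G. K = N #>\<^bsub>G\<^esub> u" if "K \<in> carrier (G Mod N)" for K
      using that by (auto simp: FactGroup_def RCOSETS_def)
    have img: "N' #>\<^bsub>G'\<^esub> h u \<in> carrier (G' Mod N')" if "u \<in> carrier G" for u
      using hc[OF that] by (auto simp: FactGroup_def RCOSETS_def)
    have "i \<in> hom (G Mod N) (G' Mod N')"
    proof (rule homI)
      fix K assume "K \<in> carrier (G Mod N)"
      then obtain u where u: "u \<in> carrier G" "K = N #>\<^bsub>G\<^esub> u" using cosets by blast
      then show "i K \<in> carrier (G' Mod N')" by (simp add: i_coset img)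
      fix L assume "L \<in> carrier (G Mod N)"
      then obtain v where v: "v \<in> carrier G" "L = N #>\<^bsub>G\<^esub> v" using cosets by blast
      show "i (K \<otimes>\<^bsub>G Mod N\<^esub> L) = i K \<otimes>\<^bsub>G' Mod N'\<^esub> i L"
        using u v by (simp add: FactGroup_def N.rcos_sum N'.rcos_sum i_coset hc hom_mult[OF h])
    qed
    moreover have "inj_on i (carrier (G Mod N))"
    proof (rule inj_onI)
      fix K L assume "K \<in> carrier (G Mod N)" "L \<in> carrier (G Mod N)" and eq: "i K = i L"
      then obtain u v where uv: "u \<in> carrier G" "K = N #>\<^bsub>G\<^esub> u" "v \<in> carrier G" "L = N #>\<^bsub>G\<^esub> v"
        using cosets by blast
      have "N' #>\<^bsub>G'\<^esub> h u = N' #>\<^bsub>G'\<^esub> h v" using eq uv by (simp add: i_coset)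
      then have "h u \<in> N' #>\<^bsub>G'\<^esub> h v" using N'.rcos_self[OF hc[OF uv(1)] N'.is_subgroup] by simp
      then obtain d where d: "d \<in> N'" "h u = d \<otimes>\<^bsub>G'\<^esub> h v" by (auto simp: r_coset_def)
      have iv: "inv\<^bsub>G\<^esub> v \<in> carrier G" using uv by simp
      have gh: "group_hom G G' h"
        by (intro group_hom.intro group_hom_axioms.intro N.is_group N'.is_group h)
      have "h (u \<otimes>\<^bsub>G\<^esub> inv\<^bsub>G\<^esub> v) = d"
        using d uv iv hc N'.mem_carrier[OF d(1)] group_hom.hom_inv[OF gh uv(3)]
        by (simp add: hom_mult[OF h] N'.m_assoc)
      then have "u \<otimes>\<^bsub>G\<^esub> inv\<^bsub>G\<^esub> v \<in> N" using inj[of "u \<otimes>\<^bsub>G\<^esub> inv\<^bsub>G\<^esub> v"] d(1) uv iv by simp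
      then have "N #>\<^bsub>G\<^esub> (u \<otimes>\<^bsub>G\<^esub> inv\<^bsub>G\<^esub> v) = N"
        using N.coset_join2[OF _ N.is_subgroup] uv iv by simp
      then show "K = L" using N.coset_mult_inv1[OF _ uv(1,3) N.subset] uv by simp
    qed
    moreover have "i ` carrier (G Mod N) = carrier (G' Mod N')"
    proof (intro equalityI subsetI)
      fix L assume "L \<in> i ` carrier (G Mod N)"
      then show "L \<in> carrier (G' Mod N')" using cosets i_coset img by force
    next
      fix L assume "L \<in> carrier (G' Mod N')"
      then obtain v where v: "v \<in> carrier G'" "L = N' #>\<^bsub>G'\<^esub> v"
        by (auto simp: FactGroup_def RCOSETS_def)
      obtain u where u: "u \<in> carrier G" "v \<in> N' #>\<^bsub>G'\<^esub> h u" using surj[OF v(1)] by blast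
      have "L = N' #>\<^bsub>G'\<^esub> h u"
        using N'.repr_independence[OF u(2) hc[OF u(1)] N'.is_subgroup] v(2) by simp
      then show "L \<in> i ` carrier (G Mod N)" using i_coset[OF u(1)] carr[OF u(1)] by (metis imageI)
    qed
    ultimately show "i \<in> iso (G Mod N) (G' Mod N')" by (simp add: iso_def bij_betw_def)
  }
qed

lemma (in cstar_subalgebra) cl_comm_uni_mat_mono:
  assumes "m \<le> n"
  shows "cl_comm_uni (mat_over m C) \<subseteq> cl_comm_uni (mat_over n C)"
proof -
  interpret Mm: star_subalgebra "mat_over m C" "unit_mat m e" by (rule mat_over_star_subalgebra)
  interpret Mn: star_subalgebra "mat_over n C" "unit_mat n e" by (rule mat_over_star_subalgebra)
  have "comm_uni (mat_over m C) \<subseteq> comm_uni (mat_over n C)"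
    using uni0_mono[OF mat_over_mono[OF assms]]
    by (intro Mm.comm_uni_minimal Mn.one_comm_uni Mn.mult_comm_uni Mn.commutator_comm_uni) auto
  then show ?thesis unfolding cl_comm_uni_def by (rule closure_mono)
qed

text \<open>Surjectivity of the map is automatic, so only injectivity remains.\<close>

lemma i_map_iso_iff:
  assumes B: "unital_cstar_algebra B" and m: "1 \<le> m" "m \<le> n"
  shows "i_map m n B \<in> iso (U0_mod_CU m B) (U0_mod_CU n B) \<longleftrightarrow>
    uni0 (mat_over m (alg B)) \<inter> cl_comm_uni (mat_over n (alg B)) \<subseteq> cl_comm_uni (mat_over m (alg B))"
proof -
  interpret C: cstar_subalgebra "alg B" "emb B \<one>\<^bsub>B\<^esub>" by (rule emb_cstar_subalgebra[OF B])
  interpret Mn: star_subalgebra "mat_over n (alg B)" "mat_unit n B" by (rule C.mat_over_star_subalgebra)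
  interpret Bl: unital_cstar_algebra B by fact
  let ?h = "diag_one m n B" and ?G = "U0 (matrix_algebra m B)" and ?G' = "U0 (matrix_algebra n B)"
  let ?N = "CU (matrix_algebra m B)" and ?N' = "CU (matrix_algebra n B)"
  let ?Mm = "mat_over m (alg B)" and ?Mn = "mat_over n (alg B)"
  have sub: "?Mm \<subseteq> ?Mn" by (rule C.mat_over_mono[OF m(2)])
  have emb_h: "emb_uni n B (?h u) = emb_uni m B u" for u
    using m(2)
    by (intro imat_eqI) (auto simp: emb_uni_def emb_mat_def unit_mat_def diag_one_def entry_simps emb_zero[OF B])
  have hcl: "?h u \<in> carrier (matrix_algebra n B)" if "u \<in> carrier (matrix_algebra m B)" for u
    unfolding carrier_mat[OF B] diag_one_def restrict_PiE_iff
    using mat_app_closed[OF B that] by auto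
  note cl = subsetD[OF carrier_U0_subset(2)[OF B]]
  have hU: "?h u \<in> carrier ?G'" if "u \<in> carrier ?G" for u
    using that mem_U0[OF B cl[OF that]] mem_U0[OF B hcl[OF cl[OF that]]] uni0_mono[OF sub]
    by (auto simp: emb_h)
  have h: "?h \<in> hom ?G ?G'"
  proof (rule homI)
    fix u v assume u: "u \<in> carrier ?G" and v: "v \<in> carrier ?G"
    show "?h (u \<otimes>\<^bsub>?G\<^esub> v) = ?h u \<otimes>\<^bsub>?G'\<^esub> ?h v"
      using cl[OF u] cl[OF v] hcl
      by (intro inj_onD[OF emb_uni_inj[OF B, of n]])
        (simp_all add: U0_mult[OF B] emb_uni_mult[OF B] emb_h mat_mult_closed[OF B])
  qed (rule hU)
  have mono: "cl_comm_uni ?Mm \<subseteq> cl_comm_uni ?Mn" by (rule C.cl_comm_uni_mat_mono[OF m(2)])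
  have hN_iff: "?h u \<in> ?N' \<longleftrightarrow> emb_uni m B u \<in> cl_comm_uni ?Mn" if "u \<in> carrier (matrix_algebra m B)" for u
    using mem_CU[OF B hcl[OF that]] by (simp add: emb_h)
  have hN: "?h ` ?N \<subseteq> ?N'"
    using hN_iff mem_CU[OF B] CU_subset[OF B] mono by blast
  note q = quotient_map_iso_imp[OF normal_CU[OF B] normal_CU[OF B] h hN]
    quotient_map_isoI[OF normal_CU[OF B] normal_CU[OF B] h hN]
  have i_map: "i_map m n B = (\<lambda>K. the_elem ((\<lambda>u. ?N' #>\<^bsub>?G'\<^esub> ?h u) ` K))"
    by (simp add: i_map_def fun_eq_iff)
  show ?thesis
    unfolding i_map U0_mod_CU_def
  proof
    assume iso: "(\<lambda>K. the_elem ((\<lambda>u. ?N' #>\<^bsub>?G'\<^esub> ?h u) ` K)) \<in> iso (?G Mod ?N) (?G' Mod ?N')"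
    show "uni0 ?Mm \<inter> cl_comm_uni ?Mn \<subseteq> cl_comm_uni ?Mm"
    proof
      fix w assume w: "w \<in> uni0 ?Mm \<inter> cl_comm_uni ?Mn"
      then obtain u where u: "u \<in> carrier ?G" "w = emb_uni m B u"
        using emb_uni_U0[OF B, of m] by blast
      then have "?h u \<in> ?N'" using w hN_iff[OF cl[OF u(1)]] by simp
      then have "u \<in> ?N" by (rule q(1)[OF iso u(1)])
      then show "w \<in> cl_comm_uni ?Mm" using mem_CU[OF B cl[OF u(1)]] u(2) by simp
    qed
  next
    assume inj: "uni0 ?Mm \<inter> cl_comm_uni ?Mn \<subseteq> cl_comm_uni ?Mm"
    show "(\<lambda>K. the_elem ((\<lambda>u. ?N' #>\<^bsub>?G'\<^esub> ?h u) ` K)) \<in> iso (?G Mod ?N) (?G' Mod ?N')"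
    proof (rule q(2))
      fix u assume u: "u \<in> carrier ?G" "?h u \<in> ?N'"
      then have "emb_uni m B u \<in> uni0 ?Mm \<inter> cl_comm_uni ?Mn"
        using mem_U0[OF B cl[OF u(1)]] hN_iff[OF cl[OF u(1)]] by simp
      then show "u \<in> ?N" using inj mem_CU[OF B cl[OF u(1)]] by blast
    next
      fix v assume v: "v \<in> carrier ?G'"
      then have "emb_uni n B v \<in> uni0 ?Mn" using emb_uni_U0[OF B] by blast
      moreover have "spans (2 * real n) ?Mm ?Mn"
        by (rule C.spans_mat_over[OF C.norm_unit_le m])
      moreover have "1 \<le> 2 * real n" using m by simp
      ultimately obtain g d where gd: "g \<in> uni0 ?Mm" "d \<in> cl_comm_uni ?Mn" "emb_uni n B v = g * d"
        using Mn.factor_uni0[OF C.mat_over_star_subalgebra sub] by blast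
      obtain u where u: "u \<in> carrier ?G" "g = emb_uni m B u" using gd(1) emb_uni_U0[OF B, of m] by blast
      have gn: "g \<in> uni0 ?Mn" "g \<in> uni ?Mn" using gd(1) uni0_mono[OF sub] uni0_subset by blast+
      \<comment> \<open>The cosets have \<open>N'\<close> on the left while the factorization has
        \<open>d\<close> on the right; \<open>g * d = (g * d * adj g) * g\<close> moves it
        across.\<close>
      have "g * d * adj g \<in> cl_comm_uni ?Mn" by (rule Mn.conj_cl_comm_uni[OF gn(1) gd(2)])
      then obtain c where c: "c \<in> ?N'" "emb_uni n B c = g * d * adj g"
        using emb_uni_CU[OF B, of n] by (metis imageE)
      have "v = c \<otimes>\<^bsub>?G'\<^esub> ?h u"
      proof (rule inj_onD[OF emb_uni_inj[OF B, of n]])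
        note cs = subsetD[OF CU_subset[OF B] c(1)] hcl[OF cl[OF u(1)]]
        show "emb_uni n B v = emb_uni n B (c \<otimes>\<^bsub>?G'\<^esub> ?h u)"
          using uni_adj_left[OF gn(2)] gd(3) c(2) u(2) cs
          by (simp add: U0_mult[OF B] emb_uni_mult[OF B] emb_h mult.assoc)
        show "c \<otimes>\<^bsub>?G'\<^esub> ?h u \<in> carrier (matrix_algebra n B)"
          using cs by (simp add: U0_mult[OF B] mat_mult_closed[OF B])
      qed (rule cl[OF v])
      then show "\<exists>u\<in>carrier ?G. v \<in> ?N' #>\<^bsub>?G'\<^esub> ?h u"
        using u(1) c(1) by (auto simp: r_coset_def)
    qed
  qed
qed

section \<open>Inductive limits of matrix algebras\<close>

text \<open>The size \<open>n\<close> is only an upper bound: the same map acts on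
  \<open>mat_over k C\<close> for every \<open>k \<le> n\<close>. This lets the systems of sizes
  \<open>k\<close> and \<open>n\<close> share their maps, as \<open>limit_cl_comm_uni\<close>
  demands.\<close>

definition map_mat :: "nat \<Rightarrow> ('a::star_algebra_1 \<Rightarrow> 'b::star_algebra_1) \<Rightarrow> 'a imat \<Rightarrow> 'b imat" where
  "map_mat n F T = mk_mat n (\<lambda>i j. F (entry T i j))"

lemma (in star_map) F_sum:
  "(\<And>i. i \<in> I \<Longrightarrow> f i \<in> C) \<Longrightarrow> F (\<Sum>i\<in>I. f i) = (\<Sum>i\<in>I. F (f i))"
proof (induction I rule: infinite_finite_induct)
  case (insert i I)
  then have "(\<Sum>i\<in>I. f i) \<in> C" by (intro C.closed_rules) auto
  then show ?case using insert by (simp add: F_add)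
qed (simp_all add: F_zero)

lemma (in star_map) entry_map_mat:
  assumes "k \<le> n" "T \<in> mat_over k C"
  shows "entry (map_mat n F T) i j = F (entry T i j)"
  using mat_over_entry(2)[OF assms(2), of i j] assms(1) by (auto simp: map_mat_def F_zero)

lemma (in star_map) star_map_mat:
  assumes k: "k \<le> n"
  shows "star_map (mat_over k C) (unit_mat k e) (mat_over k D) (unit_mat k e') (map_mat n F)"
proof -
  interpret Ck: star_subalgebra "mat_over k C" "unit_mat k e" by (rule C.mat_over_star_subalgebra)
  interpret Dk: star_subalgebra "mat_over k D" "unit_mat k e'" by (rule D.mat_over_star_subalgebra)
  note en = entry_map_mat[OF k] and m = mat_over_entry
  have cl: "entry T i j \<in> C" if "T \<in> mat_over k C" for T i j
    using m[OF that, of i j] C.zero_closed by (cases "i < k \<and> j < k") auto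
  have closed: "map_mat n F T \<in> mat_over k D" if T: "T \<in> mat_over k C" for T
  proof -
    have "map_mat n F T = mk_mat k (\<lambda>i j. F (entry T i j))"
      using m(2)[OF T] by (intro imat_eqI) (auto simp: en[OF T] F_zero)
    then show ?thesis using cl[OF T] F_closed by (simp add: mk_mat_over)
  qed
  show ?thesis
  proof
    fix S T :: "'a imat" and r :: real
    assume T: "T \<in> mat_over k C"
    show "map_mat n F T \<in> mat_over k D" by (rule closed[OF T])
    show "map_mat n F (r *\<^sub>R T) = r *\<^sub>R map_mat n F T"
      by (rule imat_eqI) (simp add: en[OF T] en[OF Ck.scaleR_closed[OF T]] entry_simps F_scaleR[OF cl[OF T]])
    show "map_mat n F (adj T) = adj (map_mat n F T)"
      by (rule imat_eqI) (simp add: en[OF T] en[OF Ck.adj_closed[OF T]] entry_simps F_adj[OF cl[OF T]])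
    show "norm (map_mat n F T) \<le> norm T"
      by (rule norm_imat_mono) (simp add: en[OF T] F_contractive[OF cl[OF T]])
    assume S: "S \<in> mat_over k C"
    show "map_mat n F (S + T) = map_mat n F S + map_mat n F T"
      by (rule imat_eqI)
        (simp add: en[OF S] en[OF T] en[OF Ck.add_closed[OF S T]] entry_simps F_add[OF cl[OF S] cl[OF T]])
    show "map_mat n F (S * T) = map_mat n F S * map_mat n F T"
      by (rule imat_eqI)
        (simp add: en[OF S] en[OF T] en[OF Ck.mult_closed[OF S T]] entry_times[OF S]
          entry_times[OF closed[OF S]] F_sum C.mult_closed cl[OF S] cl[OF T] F_mult)
  qed
qed

definition lift_hom :: "'a cstar \<Rightarrow> 'b cstar \<Rightarrow> ('a \<Rightarrow> 'b) \<Rightarrow> 'a cstar_prod \<Rightarrow> 'b cstar_prod" where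
  "lift_hom B B' f x = emb B' (f (coord x B))"

lemma lift_hom_emb:
  "\<lbrakk>unital_cstar_algebra B; x \<in> carrier B\<rbrakk> \<Longrightarrow> lift_hom B B' f (emb B x) = emb B' (f x)"
  by (simp add: lift_hom_def coord_emb)

lemma star_map_lift_hom:
  assumes B: "unital_cstar_algebra B" and B': "unital_cstar_algebra B'" and f: "f \<in> star_hom B B'"
  shows "star_map (alg B) (emb B \<one>\<^bsub>B\<^esub>) (alg B') (emb B' \<one>\<^bsub>B'\<^esub>) (lift_hom B B' f)"
proof -
  interpret B: unital_cstar_algebra B by fact
  interpret B': unital_cstar_algebra B' by fact
  interpret C: cstar_subalgebra "alg B" "emb B \<one>\<^bsub>B\<^esub>" by (rule emb_cstar_subalgebra[OF B])
  interpret D: cstar_subalgebra "alg B'" "emb B' \<one>\<^bsub>B'\<^esub>" by (rule emb_cstar_subalgebra[OF B'])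
  have fc: "f a \<in> carrier B'" if "a \<in> carrier B" for a using f that by (auto simp: star_hom_def)
  have F: "lift_hom B B' f x \<in> alg B'" if "x \<in> alg B" for x
    using that fc by (auto simp: lift_hom_emb[OF B])
  have add: "lift_hom B B' f (x + y) = lift_hom B B' f x + lift_hom B B' f y"
    and mult: "lift_hom B B' f (x * y) = lift_hom B B' f x * lift_hom B B' f y"
    if xy: "x \<in> alg B" "y \<in> alg B" for x y
  proof -
    obtain a b where ab: "a \<in> carrier B" "b \<in> carrier B" "x = emb B a" "y = emb B b" using xy by blast
    then show "lift_hom B B' f (x + y) = lift_hom B B' f x + lift_hom B B' f y"
      using f by (simp add: lift_hom_emb[OF B] emb_add[OF B, symmetric] emb_add[OF B', symmetric]
          star_hom_def fc)
    show "lift_hom B B' f (x * y) = lift_hom B B' f x * lift_hom B B' f y"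
      using ab f by (simp add: lift_hom_emb[OF B] emb_mult[OF B, symmetric] emb_mult[OF B', symmetric]
          star_hom_def fc)
  qed
  have scaleR: "lift_hom B B' f (r *\<^sub>R x) = r *\<^sub>R lift_hom B B' f x"
    and adj: "lift_hom B B' f (adj x) = adj (lift_hom B B' f x)" if x: "x \<in> alg B" for r x
  proof -
    obtain a where a: "a \<in> carrier B" "x = emb B a" using x by blast
    then show "lift_hom B B' f (r *\<^sub>R x) = r *\<^sub>R lift_hom B B' f x"
      using f by (simp add: lift_hom_emb[OF B] emb_scaleR[OF B, symmetric] emb_scaleR[OF B', symmetric]
          star_hom_def fc B.scale_closed)
    show "lift_hom B B' f (adj x) = adj (lift_hom B B' f x)"
      using a f by (simp add: lift_hom_emb[OF B] emb_star[OF B, symmetric] emb_star[OF B', symmetric]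
          star_hom_def fc B.star_closed)
  qed
  show ?thesis
  proof
    fix x assume "x \<in> alg B"
    then show "norm (lift_hom B B' f x) \<le> norm x"
      by (rule star_hom_contractive[OF C.cstar_subalgebra_axioms D.cstar_subalgebra_axioms, rotated -1])
        (rule F add mult scaleR adj; assumption)+
  qed (rule F add mult scaleR adj; assumption)+
qed

lemma star_hom_comp: "\<lbrakk>f \<in> star_hom B C; g \<in> star_hom C D\<rbrakk> \<Longrightarrow> (\<lambda>x. g (f x)) \<in> star_hom B D"
  by (simp add: star_hom_def Pi_iff)

lemma connecting_star_hom:
  assumes "\<And>n. \<phi> n \<in> star_hom (As n) (As (Suc n))"
  shows "connecting \<phi> n k \<in> star_hom (As n) (As (n + k))"
proof (induction k)
  case (Suc k)
  then show ?case using star_hom_comp[OF Suc assms[of "n + k"]] by simp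
qed (simp add: star_hom_def)

lemma connecting_compat:
  assumes "\<And>n. \<phi> n \<in> star_hom (As n) (As (Suc n))"
    and "\<And>n x. x \<in> carrier (As n) \<Longrightarrow> \<psi> (Suc n) (\<phi> n x) = \<psi> n x" and "x \<in> carrier (As n)"
  shows "\<psi> (n + k) (connecting \<phi> n k x) = \<psi> n x"
proof (induction k)
  case (Suc k)
  have "connecting \<phi> n k x \<in> carrier (As (n + k))"
    using connecting_star_hom[of \<phi> As n k, OF assms(1)] assms(3) by (auto simp: star_hom_def)
  then show ?case using Suc assms(2) by simp
qed simp

text \<open>Norms converge for each entry separately. The finitely many entries are small at a
  common late stage, and the passage from entries to the matrix costs the factor
  \<open>k * k\<close>, bounded by \<open>n * n\<close> so that both sizes have the same
  constant.\<close>

lemma limit_system_mat: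
  fixes As :: "nat \<Rightarrow> 'a cstar" and A :: "'b cstar"
  assumes As: "\<And>m. unital_cstar_algebra (As m)" and A: "unital_cstar_algebra A"
    and lim: "inductive_limit As \<phi> A \<psi>" and k: "k \<le> n" and n: "1 \<le> n"
  shows "limit_system (\<lambda>m. mat_over k (alg (As m))) (\<lambda>m. mat_unit k (As m)) (mat_over k (alg A)) (mat_unit k A)
    (\<lambda>m l. map_mat n (lift_hom (As m) (As l) (connecting \<phi> m (l - m))))
    (\<lambda>m. map_mat n (lift_hom (As m) A (\<psi> m))) (real n * real n)"
proof -
  interpret A: unital_cstar_algebra A by fact
  have \<phi>: "\<And>n. \<phi> n \<in> star_hom (As n) (As (Suc n))" and \<psi>: "\<And>n. \<psi> n \<in> star_hom (As n) A"
    and \<psi>\<phi>: "\<And>n x. x \<in> carrier (As n) \<Longrightarrow> \<psi> (Suc n) (\<phi> n x) = \<psi> n x"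
    and norm_lim: "\<And>n x. x \<in> carrier (As n) \<Longrightarrow>
      (\<lambda>k. cnorm (As (n + k)) (connecting \<phi> n k x)) \<longlonglongrightarrow> cnorm A (\<psi> n x)"
    and dense: "norm_topology A closure_of (\<Union>n. \<psi> n ` carrier (As n)) = carrier A"
    using lim unfolding inductive_limit_def by blast+
  let ?\<Phi> = "\<lambda>m l. lift_hom (As m) (As l) (connecting \<phi> m (l - m))"
  let ?\<Psi> = "\<lambda>m. lift_hom (As m) A (\<psi> m)"
  have con: "connecting \<phi> m (l - m) \<in> star_hom (As m) (As l)" if "m \<le> l" for m l
    using connecting_star_hom[of \<phi> As m "l - m", OF \<phi>] that by simp
  have con_cl: "connecting \<phi> m (l - m) x \<in> carrier (As l)" if "m \<le> l" "x \<in> carrier (As m)" for m l x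
    using con[OF that(1)] that(2) by (auto simp: star_hom_def)
  have \<psi>_cl: "\<psi> m x \<in> carrier A" if "x \<in> carrier (As m)" for m x
    using \<psi>[of m] that by (auto simp: star_hom_def)
  have \<psi>_con: "\<psi> l (connecting \<phi> m (l - m) x) = \<psi> m x" if "m \<le> l" "x \<in> carrier (As m)" for m l x
    using connecting_compat[of \<phi> As \<psi> x m "l - m", OF \<phi> \<psi>\<phi> that(2)] that(1) by simp
  have \<Phi>: "star_map (alg (As m)) (emb (As m) \<one>\<^bsub>As m\<^esub>) (alg (As l)) (emb (As l) \<one>\<^bsub>As l\<^esub>) (?\<Phi> m l)"
    if "m \<le> l" for m l by (rule star_map_lift_hom[OF As As con[OF that]])
  have \<Psi>: "star_map (alg (As m)) (emb (As m) \<one>\<^bsub>As m\<^esub>) (alg A) (emb A \<one>\<^bsub>A\<^esub>) (?\<Psi> m)" for m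
    by (rule star_map_lift_hom[OF As A \<psi>])
  note \<Phi>_mat = star_map.star_map_mat[OF \<Phi> k] and \<Psi>_mat = star_map.star_map_mat[OF \<Psi> k]
  note \<Phi>_cl = star_map.F_closed[OF \<Phi>_mat] and \<Psi>_cl = star_map.F_closed[OF \<Psi>_mat]
  have \<Phi>_entry: "entry (map_mat n (?\<Phi> m l) T) i j = emb (As l) (connecting \<phi> m (l - m) a)"
    if "m \<le> l" "T \<in> mat_over k (alg (As m))" "a \<in> carrier (As m)" "entry T i j = emb (As m) a" for m l T i j a
    using star_map.entry_map_mat[OF \<Phi>[OF that(1)] k that(2)] lift_hom_emb[OF As that(3)] that(4) by simp
  have \<Psi>_entry: "entry (map_mat n (?\<Psi> m) T) i j = emb A (\<psi> m a)"
    if "T \<in> mat_over k (alg (As m))" "a \<in> carrier (As m)" "entry T i j = emb (As m) a" for m T i j a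
    using star_map.entry_map_mat[OF \<Psi> k that(1)] lift_hom_emb[OF As that(2)] that(3) by simp
  have norm_le: "norm T \<le> real k * real k * b"
    if T: "T \<in> mat_over k C" and b: "\<And>i j. \<lbrakk>i < k; j < k\<rbrakk> \<Longrightarrow> norm (entry T i j) \<le> b"
    for T :: "'c::star_algebra_1 imat" and C b
  proof -
    have "(\<Sum>j<k. norm (entry T i j)) \<le> real k * b" if "i < k" for i
      using sum_bounded_above[of "{..<k}" "\<lambda>j. norm (entry T i j)" b] b that by simp
    then have "(\<Sum>i<k. \<Sum>j<k. norm (entry T i j)) \<le> real k * (real k * b)"
      using sum_bounded_above[of "{..<k}" "\<lambda>i. \<Sum>j<k. norm (entry T i j)" "real k * b"] by simp
    then show ?thesis using norm_mat_over_le[OF T] by simp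
  qed
  have kn: "real k * real k \<le> real n * real n" using k by (intro mult_mono) auto
  show ?thesis
  proof (rule limit_system.intro)
    show "star_map (mat_over k (alg (As m))) (mat_unit k (As m)) (mat_over k (alg (As l))) (mat_unit k (As l))
        (map_mat n (?\<Phi> m l))" if "m \<le> l" for m l by (rule \<Phi>_mat[OF that])
    show "star_map (mat_over k (alg (As m))) (mat_unit k (As m)) (mat_over k (alg A)) (mat_unit k A)
        (map_mat n (?\<Psi> m))" for m by (rule \<Psi>_mat)
    show "1 \<le> real n * real n" using n by (simp flip: of_nat_mult)
  next
    fix m l T assume ml: "m \<le> l" and T: "T \<in> mat_over k (alg (As m))"
    show "map_mat n (?\<Psi> l) (map_mat n (?\<Phi> m l) T) = map_mat n (?\<Psi> m) T"
    proof (rule mat_over_eqI[OF \<Psi>_cl[OF \<Phi>_cl[OF ml T]] \<Psi>_cl[OF T]])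
      fix i j assume "i < k" "j < k"
      then obtain a where a: "a \<in> carrier (As m)" "entry T i j = emb (As m) a"
        using mat_over_entry(1)[OF T] by blast
      show "entry (map_mat n (?\<Psi> l) (map_mat n (?\<Phi> m l) T)) i j = entry (map_mat n (?\<Psi> m) T) i j"
        using \<Psi>_entry[OF \<Phi>_cl[OF ml T] con_cl[OF ml a(1)] \<Phi>_entry[OF ml T a]] \<Psi>_entry[OF T a]
          \<psi>_con[OF ml a(1)] by simp
    qed
  next
    fix m T and r :: real
    assume T: "T \<in> mat_over k (alg (As m))" and less: "norm (map_mat n (?\<Psi> m) T) < r"
    have "\<forall>\<^sub>F d in sequentially. norm (entry (map_mat n (?\<Phi> m (m + d)) T) i j) < r"
      if ij: "i < k" "j < k" for i j
    proof -
      obtain a where a: "a \<in> carrier (As m)" "entry T i j = emb (As m) a"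
        using mat_over_entry(1)[OF T ij] by blast
      have "cnorm A (\<psi> m a) = norm (entry (map_mat n (?\<Psi> m) T) i j)"
        using \<Psi>_entry[OF T a] norm_emb[OF A \<psi>_cl[OF a(1)]] by simp
      also have "\<dots> < r" using norm_entry_le less by (rule order.strict_trans1)
      finally have "\<forall>\<^sub>F d in sequentially. cnorm (As (m + d)) (connecting \<phi> m d a) < r"
        by (rule order_tendstoD(2)[OF norm_lim[OF a(1)]])
      moreover have "norm (entry (map_mat n (?\<Phi> m (m + d)) T) i j)
          = cnorm (As (m + d)) (connecting \<phi> m d a)" for d
        using \<Phi>_entry[OF _ T a, of "m + d"] norm_emb[OF As con_cl[OF _ a(1), of "m + d"]] by simp
      ultimately show ?thesis by simp
    qed
    then have "\<forall>\<^sub>F d in sequentially. \<forall>i\<in>{..<k}. \<forall>j\<in>{..<k}.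
        norm (entry (map_mat n (?\<Phi> m (m + d)) T) i j) < r"
      by (intro eventually_ball_finite ballI) auto
    then obtain d where d: "\<And>i j. \<lbrakk>i < k; j < k\<rbrakk> \<Longrightarrow> norm (entry (map_mat n (?\<Phi> m (m + d)) T) i j) < r"
      using eventually_happens'[OF sequentially_bot] by fastforce
    have "norm (map_mat n (?\<Phi> m (m + d)) T) \<le> real k * real k * r"
      using d by (intro norm_le[OF \<Phi>_cl[OF _ T]]) (auto intro: less_imp_le)
    also have "\<dots> \<le> real n * real n * r"
      using kn less norm_ge_zero[of "map_mat n (?\<Psi> m) T"] by (intro mult_right_mono) linarith+
    finally show "\<exists>l\<ge>m. norm (map_mat n (?\<Phi> m l) T) \<le> real n * real n * r"
      by (intro exI[of _ "m + d"]) simp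
  next
    show "mat_over k (alg A) \<subseteq> closure (\<Union>m. map_mat n (?\<Psi> m) ` mat_over k (alg (As m)))"
    proof
      fix T assume T: "T \<in> mat_over k (alg A)"
      show "T \<in> closure (\<Union>m. map_mat n (?\<Psi> m) ` mat_over k (alg (As m)))"
        unfolding closure_approachable
      proof (intro allI impI)
        fix \<epsilon> :: real assume \<epsilon>: "0 < \<epsilon>"
        \<comment> \<open>The summand 1 keeps the denominator positive for \<open>k = 0\<close> and
          the final inequality strict.\<close>
        define \<delta> where "\<delta> = \<epsilon> / (real k * real k + 1)"
        have \<delta>: "0 < \<delta>" "real k * real k * \<delta> < \<epsilon>"
        proof -
          have "0 < real k * real k + 1" by (rule add_nonneg_pos) simp_all
          then show "0 < \<delta>" "real k * real k * \<delta> < \<epsilon>" using \<epsilon> by (simp_all add: \<delta>_def divide_simps)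
        qed
        have "\<exists>N b. b \<in> carrier (As N) \<and> norm (emb A (\<psi> N b) - entry T i j) < \<delta>" if ij: "i < k" "j < k" for i j
        proof -
          obtain a where a: "a \<in> carrier A" "entry T i j = emb A a" using mat_over_entry(1)[OF T ij] by blast
          then have "a \<in> A.metric.mtopology closure_of (\<Union>n. \<psi> n ` carrier (As n))"
            using dense by (simp add: norm_topology_def)
          then obtain N b where Nb: "b \<in> carrier (As N)" "cdist A a (\<psi> N b) < \<delta>"
            using \<delta>(1) by (auto simp: A.metric.metric_closure_of A.metric.in_mball)
          then have "norm (emb A (\<psi> N b) - entry T i j) < \<delta>"
            using dist_emb[OF A a(1) \<psi>_cl[OF Nb(1)]] a(2) by (simp add: dist_norm norm_minus_commute)
          then show ?thesis using Nb(1) by blast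
        qed
        then obtain N b where Nb: "\<And>i j. \<lbrakk>i < k; j < k\<rbrakk> \<Longrightarrow> b i j \<in> carrier (As (N i j))"
          "\<And>i j. \<lbrakk>i < k; j < k\<rbrakk> \<Longrightarrow> norm (emb A (\<psi> (N i j) (b i j)) - entry T i j) < \<delta>"
          by metis
        \<comment> \<open>The sum serves as a common upper bound for the stages of all
          entries.\<close>
        define M where "M = (\<Sum>i<k. \<Sum>j<k. N i j)"
        have NM: "N i j \<le> M" if "i < k" "j < k" for i j
        proof -
          have "N i j \<le> (\<Sum>j<k. N i j)" using that by (intro member_le_sum) auto
          also have "\<dots> \<le> M" unfolding M_def using that by (intro member_le_sum) auto
          finally show ?thesis .
        qed
        define S where "S = mk_mat k (\<lambda>i j. emb (As M) (connecting \<phi> (N i j) (M - N i j) (b i j)))"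
        have S: "S \<in> mat_over k (alg (As M))"
          unfolding S_def using con_cl[OF NM Nb(1)] by (intro mk_mat_over) auto
        interpret C: cstar_subalgebra "alg A" "emb A \<one>\<^bsub>A\<^esub>" by (rule emb_cstar_subalgebra[OF A])
        interpret M: star_subalgebra "mat_over k (alg A)" "mat_unit k A" by (rule C.mat_over_star_subalgebra)
        have "norm (entry (map_mat n (?\<Psi> M) S - T) i j) \<le> \<delta>" if ij: "i < k" "j < k" for i j
        proof -
          have "entry S i j = emb (As M) (connecting \<phi> (N i j) (M - N i j) (b i j))"
            using ij by (simp add: S_def)
          from \<Psi>_entry[OF S con_cl[OF NM[OF ij] Nb(1)[OF ij]] this]
          show ?thesis using Nb(2)[OF ij] \<psi>_con[OF NM[OF ij] Nb(1)[OF ij]] by simp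
        qed
        then have "norm (map_mat n (?\<Psi> M) S - T) \<le> real k * real k * \<delta>"
          by (intro norm_le[OF M.diff_closed[OF \<Psi>_cl[OF S] T]])
        then have "dist (map_mat n (?\<Psi> M) S) T < \<epsilon>" using \<delta>(2) by (simp add: dist_norm)
        then show "\<exists>y\<in>\<Union>m. map_mat n (?\<Psi> m) ` mat_over k (alg (As m)). dist y T < \<epsilon>"
          using S by blast
      qed
    qed
  qed
qed

section \<open>The determinant rank\<close>

text \<open>
  The determinant rank \<open>m\<close> may be smaller than \<open>k\<close>; but modulo the closed commutators over \<open>M\<^sub>k(B)\<close>
  every element of \<open>U\<^sub>0(M\<^sub>k(B))\<close> comes from \<open>U\<^sub>0(M\<^sub>m(B))\<close>.
\<close>

lemma Dur_le_inj:
  assumes B: "unital_cstar_algebra B" and Dur: "Dur B \<le> enat k" and n: "k < n"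
  shows "1 \<le> k"
    and "uni0 (mat_over k (alg B)) \<inter> cl_comm_uni (mat_over n (alg B)) \<subseteq> cl_comm_uni (mat_over k (alg B))"
proof -
  interpret C: cstar_subalgebra "alg B" "emb B \<one>\<^bsub>B\<^esub>" by (rule emb_cstar_subalgebra[OF B])
  interpret Mk: star_subalgebra "mat_over k (alg B)" "mat_unit k B" by (rule C.mat_over_star_subalgebra)
  interpret Mn: star_subalgebra "mat_over n (alg B)" "mat_unit n B" by (rule C.mat_over_star_subalgebra)
  let ?S = "enat ` {m. 1 \<le> m \<and> (\<forall>n>m. i_map m n B \<in> iso (U0_mod_CU m B) (U0_mod_CU n B))}"
  have D: "Dur B = Inf ?S" by (simp add: Dur_def)
  have "?S \<noteq> {}"
  proof
    assume "?S = {}"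
    then have "Dur B = \<infinity>" unfolding D by (simp only: Inf_enat_def) simp
    then show False using Dur by simp
  qed
  \<comment> \<open>A nonempty set in \<open>enat\<close> attains its infimum.\<close>
  then have "Dur B \<in> ?S" unfolding D Inf_enat_def by (metis (mono_tags, lifting) LeastI ex_in_conv)
  then obtain m where m: "1 \<le> m" "m \<le> k" "\<And>n. m < n \<Longrightarrow> i_map m n B \<in> iso (U0_mod_CU m B) (U0_mod_CU n B)"
    using Dur by force
  then show "1 \<le> k" by simp
  have inj: "uni0 (mat_over m (alg B)) \<inter> cl_comm_uni (mat_over n (alg B)) \<subseteq> cl_comm_uni (mat_over m (alg B))"
    using i_map_iso_iff[OF B m(1), of n] m n by simp
  show "uni0 (mat_over k (alg B)) \<inter> cl_comm_uni (mat_over n (alg B)) \<subseteq> cl_comm_uni (mat_over k (alg B))"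
  proof
    fix u assume u: "u \<in> uni0 (mat_over k (alg B)) \<inter> cl_comm_uni (mat_over n (alg B))"
    have mk: "mat_over m (alg B) \<subseteq> mat_over k (alg B)" by (rule C.mat_over_mono[OF m(2)])
    have "spans (2 * real k) (mat_over m (alg B)) (mat_over k (alg B))"
      by (rule C.spans_mat_over[OF C.norm_unit_le m(1,2)])
    moreover have "1 \<le> 2 * real k" using m by simp
    ultimately obtain w d where wd: "w \<in> uni0 (mat_over m (alg B))" "d \<in> cl_comm_uni (mat_over k (alg B))" "u = w * d"
      using Mk.factor_uni0[OF C.mat_over_star_subalgebra mk] u by blast
    have dU: "d \<in> uni (mat_over k (alg B))" using Mk.cl_comm_uni_subset uni0_subset wd(2) by blast
    have "adj d \<in> cl_comm_uni (mat_over n (alg B))"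
      using C.cl_comm_uni_mat_mono[of k n] n Mk.adj_cl_comm_uni[OF wd(2)] by auto
    then have "u * adj d \<in> cl_comm_uni (mat_over n (alg B))" using u by (intro Mn.mult_cl_comm_uni) auto
    also have "u * adj d = w" using wd(3) uni_adj_right[OF dU] by (simp add: mult.assoc)
    finally have "w \<in> cl_comm_uni (mat_over k (alg B))"
      using inj wd(1) C.cl_comm_uni_mat_mono[OF m(2)] by blast
    then show "u \<in> cl_comm_uni (mat_over k (alg B))" unfolding wd(3) using wd(2) by (rule Mk.mult_cl_comm_uni)
  qed
qed

theorem theorem3p5:
  fixes As :: "nat \<Rightarrow> 'a cstar" and \<phi> :: "nat \<Rightarrow> 'a \<Rightarrow> 'a"
    and A :: "'b cstar" and \<psi> :: "nat \<Rightarrow> 'a \<Rightarrow> 'b"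
    and r :: enat
  assumes "\<And>n. unital_cstar_algebra (As n)"
    and "unital_cstar_algebra A"
    and "inductive_limit As \<phi> A \<psi>"
    and "\<And>n. Dur (As n) \<le> r"
  shows "Dur A \<le> r"
proof (cases r)
  case (enat k)
  note Dur = assms(4)[unfolded enat]
  have k: "1 \<le> k" by (rule Dur_le_inj(1)[OF assms(1) Dur lessI])
  have "i_map k n A \<in> iso (U0_mod_CU k A) (U0_mod_CU n A)" if n: "k < n" for n
  proof -
    have kn: "k \<le> n" "1 \<le> n" "1 \<le> 2 * real n" using k n by simp_all
    have "uni0 (mat_over k (alg A)) \<inter> cl_comm_uni (mat_over n (alg A)) \<subseteq> cl_comm_uni (mat_over k (alg A))"
    proof (rule limit_cl_comm_uni[OF limit_system_mat[OF assms(1-3) order.refl kn(2)]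
          limit_system_mat[OF assms(1-3) kn(1,2)] _ _ kn(3)])
      fix m
      interpret C: cstar_subalgebra "alg (As m)" "emb (As m) \<one>\<^bsub>As m\<^esub>"
        by (rule emb_cstar_subalgebra[OF assms(1)])
      show "mat_over k (alg (As m)) \<subseteq> mat_over n (alg (As m))" by (rule C.mat_over_mono[OF kn(1)])
      show "spans (2 * real n) (mat_over k (alg (As m))) (mat_over n (alg (As m)))"
        by (rule C.spans_mat_over[OF C.norm_unit_le k kn(1)])
      show "uni0 (mat_over k (alg (As m))) \<inter> cl_comm_uni (mat_over n (alg (As m)))
          \<subseteq> cl_comm_uni (mat_over k (alg (As m)))"
        by (rule Dur_le_inj(2)[OF assms(1) Dur n])
    qed
    then show ?thesis unfolding i_map_iso_iff[OF assms(2) k kn(1)] .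
  qed
  \<comment> \<open>\<open>k\<close> itself belongs to the set whose infimum is
    \<open>Dur A\<close>.\<close>
  then show ?thesis using k unfolding enat Dur_def by (intro Inf_lower) auto
qed simp

end
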